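(* Let $c_n\to c>0$ as $n\to\infty$. Let $m\in\mathbb{N}$ and $u_i\in(0,1]$, $i=1,\ldots,m$, with $\sum_{i=1}^m u_i\le1$. Then $$\lim_{\delta\to0}\limsup_{n\to\infty}\frac1n\log\mathbf{P}\bigl(A^n_\delta(u_1,\ldots,u_m)\bigr)=\lim_{\delta\to0}\liminf_{n\to\infty}\frac1n\log\mathbf{P}\bigl(A^n_\delta(u_1,\ldots,u_m)\bigr)$$ $$=\lim_{\substack{\delta\to0\\ \epsilon\to0}}\limsup_{n\to\infty}\frac1n\log\mathbf{P}\bigl(\tilde A^n_{\delta,\epsilon}(u_1,\ldots,u_m)\bigr)=\lim_{\substack{\delta\to0\\ \epsilon\to0}}\liminf_{n\to\infty}\frac1n\log\mathbf{P}\bigl(\tilde A^n_{\delta,\epsilon}(u_1,\ldots,u_m)\bigr)=-\Bigl(\sum_{i=1}^mK_c(u_i)+L_c\Bigl(\sum_{i=1}^mu_i\Bigr)\Bigr)$$ and, for every $\epsilon>0$, $$\lim_{\delta\to0}\liminf_{n\to\infty}\mathbf{P}\bigl(\tilde A^n_{\delta,\epsilon}(u_1,\ldots,u_m)\,\big|\,A^n_\delta(u_1,\ldots,u_m)\bigr)=1.$$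
   Context: $\mathcal{G}(n,c_n/n)$ is the random graph on $n$ vertices in which every two vertices are independently connected by an edge with probability $c_n/n$ ($c_n/n\in[0,1]$ for all large $n$). The size of a connected component is its number of vertices; the number of excess edges of a connected component with $v$ vertices and $e$ edges is $e-(v-1)$. For $u\in[0,1]$: $K_c(u)=u\log\frac{cu}{1-e^{-cu}}-\frac{cu^2}{2}$ and $L_c(u)=(1-u)\log(1-u)+(c-\log c)u-\frac{cu^2}{2}$, with $0/0=1$ and $0\log 0=0$. For $\delta>0$, $A^n_\delta(u_1,\ldots,u_m)$ is the event that there exist $m$ (distinct) connected components of $\mathcal{G}(n,c_n/n)$ whose respective sizes are between $n(u_i-\delta)$ and $n(u_i+\delta)$ for $i=1,\ldots,m$. For $\epsilon>0$ the event $\tilde A^n_{\delta,\epsilon}(u_1,\ldots,u_m)$ is defined as follows. Let $r_i^*=cu_i^2/(1-\exp(-cu_i))-cu_i^2/2-u_i$. (i) If $\sum_{i=1}^mu_i\ge1-1/c$, then $\tilde A^n_{\delta,\epsilon}(u_1,\ldots,u_m)$ is the intersection of $A^n_\delta(u_1,\ldots,u_m)$, the event that the numbers of excess edges of the $m$ components are within the respective intervals $(n(r_i^*-\epsilon),n(r_i^*+\epsilon))$, and the event that any other connected component is of size less than $n\epsilon$. (ii) If $\sum_{i=1}^mu_i<1-1/c$, let $u^*>0$ be defined by $u^*/(1-\exp(-cu^* ))=1-\sum_{i=1}^mu_i$ and let $r^*=c{u^*}^2/(1-\exp(-cu^* ))-c{u^*}^2/2-u^*$; then $\tilde A^n_{\delta,\epsilon}(u_1,\ldots,u_m)$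 is the intersection of $A^n_\delta(u_1,\ldots,u_m)$, the event that there exists another connected component whose size is in $(n(u^*-\epsilon),n(u^*+\epsilon))$, the event that the numbers of excess edges of these $m+1$ components are within the respective intervals $(n(r_i^*-\epsilon),n(r_i^*+\epsilon))$, $i=1,\ldots,m$, and $(n(r^*-\epsilon),n(r^*+\epsilon))$, and the event that any other connected component is of size less than $n\epsilon$. *)

theory Defs
  imports "HOL-Probability.Probability"
begin

text \<open>
  The vertices are \<open>0, \<dots>, n - 1\<close>; a simple graph is its set of edges, each edge being a
  two-element set of vertices.
\<close>

definition all_edges :: "nat \<Rightarrow> nat set set" where
  "all_edges n = {e. e \<subseteq> {..<n} \<and> card e = 2}"

text \<open>
  The law of the random graph. For \<open>p\<close> outside \<open>[0, 1]\<close>, \<^const>\<open>bernoulli_pmf\<close> truncates its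
  parameter, which is irrelevant for limits along \<open>p = c\<^sub>n / n\<close>, as these lie in \<open>[0, 1]\<close>
  for all large \<open>n\<close>.
\<close>

definition random_graph :: "nat \<Rightarrow> real \<Rightarrow> nat set set pmf" where
  "random_graph n p =
     map_pmf (\<lambda>f. {e \<in> all_edges n. f e}) (Pi_pmf (all_edges n) False (\<lambda>_. bernoulli_pmf p))"

definition adjacency :: "nat set set \<Rightarrow> (nat \<times> nat) set" where
  "adjacency G = {(v, w). {v, w} \<in> G}"

definition components :: "nat \<Rightarrow> nat set set \<Rightarrow> nat set set" where
  "components n G = (\<lambda>v. {w. (v, w) \<in> (adjacency G)\<^sup>*}) ` {..<n}"

definition excess :: "nat set set \<Rightarrow> nat set \<Rightarrow> real" where
  "excess G C = real (card {e \<in> G. e \<subseteq> C}) - (real (card C) - 1)"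

text \<open>
  The conventions \<open>0 / 0 = 1\<close> and \<open>0 log 0 = 0\<close> only matter for \<open>K\<^sub>c(0)\<close> and \<open>L\<^sub>c(1)\<close>. There the
  logarithm has a zero factor, so HOL's \<open>x / 0 = 0\<close> and \<open>ln 0 = 0\<close> give the same values.
\<close>

definition K :: "real \<Rightarrow> real \<Rightarrow> real" where
  "K c u = u * ln (c * u / (1 - exp (- c * u))) - c * u\<^sup>2 / 2"

definition L :: "real \<Rightarrow> real \<Rightarrow> real" where
  "L c u = (1 - u) * ln (1 - u) + (c - ln c) * u - c * u\<^sup>2 / 2"

definition r_star :: "real \<Rightarrow> real \<Rightarrow> real" where
  "r_star c u = c * u\<^sup>2 / (1 - exp (- c * u)) - c * u\<^sup>2 / 2 - u"

text \<open>
  \<open>s\<close> is the total \<open>\<Sum>i. u\<^sub>i\<close>. The left-hand side is strictly increasing in \<open>v > 0\<close> with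
  limit \<open>1 / c\<close> at \<open>0\<close>, so the solution exists uniquely when \<open>s < 1 - 1 / c\<close>.
\<close>

definition u_star :: "real \<Rightarrow> real \<Rightarrow> real" where
  "u_star c s = (THE v. v > 0 \<and> v / (1 - exp (- c * v)) = 1 - s)"

definition selects ::
  "nat \<Rightarrow> real \<Rightarrow> nat \<Rightarrow> (nat \<Rightarrow> real) \<Rightarrow> nat set set \<Rightarrow> (nat \<Rightarrow> nat set) \<Rightarrow> bool" where
  "selects n \<delta> m u G C \<longleftrightarrow>
     inj_on C {1..m} \<and>
     (\<forall>i\<in>{1..m}. C i \<in> components n G \<and>
        real (card (C i)) \<in> {real n * (u i - \<delta>) .. real n * (u i + \<delta>)})"

definition A_event :: "nat \<Rightarrow> real \<Rightarrow> nat \<Rightarrow> (nat \<Rightarrow> real) \<Rightarrow> nat set set set" where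
  "A_event n \<delta> m u = {G. \<exists>C. selects n \<delta> m u G C}"

text \<open>
  All conditions in the refined event concern one and the same choice \<open>C\<close> of the \<open>m\<close> components.
\<close>

definition A_tilde_event ::
  "real \<Rightarrow> nat \<Rightarrow> real \<Rightarrow> real \<Rightarrow> nat \<Rightarrow> (nat \<Rightarrow> real) \<Rightarrow> nat set set set" where
  "A_tilde_event c n \<delta> \<epsilon> m u =
     (let s = (\<Sum>i=1..m. u i);
          near = (\<lambda>x y. x \<in> {real n * (y - \<epsilon>) <..< real n * (y + \<epsilon>)})
      in if s \<ge> 1 - 1 / c then
           {G. \<exists>C. selects n \<delta> m u G C \<and>
              (\<forall>i\<in>{1..m}. near (excess G (C i)) (r_star c (u i))) \<and>
              (\<forall>D \<in> components n G - C ` {1..m}. real (card D) < real n * \<epsilon>)}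
         else
           {G. \<exists>C. selects n \<delta> m u G C \<and>
              (\<forall>i\<in>{1..m}. near (excess G (C i)) (r_star c (u i))) \<and>
              (\<exists>B \<in> components n G - C ` {1..m}.
                 near (real (card B)) (u_star c s) \<and>
                 near (excess G B) (r_star c (u_star c s)) \<and>
                 (\<forall>D \<in> components n G - insert B (C ` {1..m}). real (card D) < real n * \<epsilon>))})"

text \<open>The logarithm on \<open>[0, 1]\<close> with \<open>log 0 = -\<infinity>\<close>, for probabilities that may vanish.\<close>

definition log_prob :: "real \<Rightarrow> ereal" where
  "log_prob p = (if p = 0 then -\<infinity> else ereal (ln p))"

end

theory Submission
  imports Defs
begin

text \<open>
  Let \<open>\<pi> k\<close> be the probability that the random graph on \<open>k\<close> vertices is connected. The expected
  number of components of size \<open>k\<close> on \<open>N\<close> vertices is \<open>(N choose k) * \<pi> k * (1 - p) ^ (k * (N - k))\<close>,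
  and the sum of these numbers, weighted by \<open>k\<close>, is \<open>N\<close>. This identity, used for a suitable \<open>N\<close> of
  order \<open>n\<close>, determines the exponential rate of \<open>\<pi> k\<close> for \<open>k \<sim> x n\<close> and \<open>p \<sim> c / n\<close>: it is
  \<open>x * ln (1 - exp (- (c * x)))\<close>. The upper bound is immediate. For the lower bound, the upper bound
  shows that sizes of order \<open>n\<close> other than that of the giant component carry a negligible share of
  the sum, and comparison with the dual subcritical graph bounds the share of the small sizes.

  Given \<open>\<pi>\<close>, the expected number of tuples of components of prescribed sizes is explicit. Since a
  graph has boundedly many such tuples, its rate is also that of the probability that one exists.
  Conditionally on given sets being components, the graphs on these sets are independent connected
  graphs, and the rest is an independent random graph on about \<open>n (1 - s)\<close> vertices. The numbers of
  edges concentrate by Chernoff's bound, as tilting merely changes the edge probability, and the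
  rest has exactly one component of order \<open>n\<close> or none, according to the sign of \<open>c (1 - s) - 1\<close>.
\<close>

section \<open>Independent edge sets\<close>

text \<open>The obstacle is uniformity: windows and sums over component sizes need bounds valid for
  all sizes of order \<open>n\<close> at once, whereas a rate concerns one size for each
  \<open>n\<close>. The asymptotic lemmas are therefore stated along an arbitrary filter
  \<open>F\<close>, with \<open>n\<close>, \<open>p\<close>, sizes and vertex sets as functions of
  its index. Applied to filters on pairs of an index and an object (\<open>at_limit\<close>,
  \<open>window_filter\<close>) they yield uniform bounds, and finite subcovers extend these to
  compact ranges of sizes.

  The identity only shows that some size near \<open>x n\<close> has the expected rate. Attaching
  vertices one at a time to a slightly smaller connected graph transfers the lower bound to every
  size.

  The equation \<open>v = y * (1 - exp (- (c * v)))\<close> gives the fraction \<open>v\<close> of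
  the giant component on \<open>y n\<close> vertices; it is also where the relative entropy in the
  first-moment rate vanishes. Tilting by \<open>z\<close> turns \<open>c\<close> into
  \<open>c * z\<close>, so the typical number of edges of a connected graph on \<open>x n\<close>
  vertices, \<open>r_star c x + x\<close> in units of \<open>n\<close>, is the derivative of the
  tilted rate at \<open>z = 1\<close>.\<close>

text \<open>
  For \<open>0 \<le> p \<le> 1\<close> this is the expectation of \<open>f G\<close> when the elements of \<open>E\<close> belong to \<open>G\<close>
  independently with probability \<open>p\<close>. Probabilities are expectations of \<^const>\<open>of_bool\<close>.
\<close>

definition gex :: "real \<Rightarrow> 'e set \<Rightarrow> ('e set \<Rightarrow> real) \<Rightarrow> real" where
  "gex p E f = (\<Sum>G\<in>Pow E. p ^ card G * (1 - p) ^ card (E - G) * f G)"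

lemma gex_mono:
  assumes "0 \<le> p" "p \<le> 1" "\<And>G. G \<subseteq> E \<Longrightarrow> f G \<le> g G"
  shows "gex p E f \<le> gex p E g"
  unfolding gex_def using assms by (intro sum_mono mult_left_mono) auto

lemma gex_cong:
  assumes "\<And>G. G \<subseteq> E \<Longrightarrow> f G = g G"
  shows "gex p E f = gex p E g"
  unfolding gex_def using assms by (intro sum.cong) auto

lemma gex_sum: "gex p E (\<lambda>G. \<Sum>i\<in>I. f i G) = (\<Sum>i\<in>I. gex p E (f i))"
  unfolding gex_def sum_distrib_left by (rule sum.swap)

lemma gex_cmult: "gex p E (\<lambda>G. a * f G) = a * gex p E f"
  unfolding gex_def sum_distrib_left by (simp add: mult_ac)

lemma gex_add: "gex p E (\<lambda>G. f G + g G) = gex p E f + gex p E g"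
  unfolding gex_def by (simp add: distrib_left sum.distrib)

lemma gex_diff: "gex p E (\<lambda>G. f G - g G) = gex p E f - gex p E g"
  unfolding gex_def by (simp add: right_diff_distrib sum_subtractf)

lemma gex_nonneg:
  assumes "0 \<le> p" "p \<le> 1" "\<And>G. G \<subseteq> E \<Longrightarrow> 0 \<le> f G"
  shows "0 \<le> gex p E f"
  unfolding gex_def using assms by (intro sum_nonneg mult_nonneg_nonneg) auto

lemma gex_empty_set [simp]: "gex p {} f = f {}"
  by (simp add: gex_def)

lemma gex_const:
  assumes "finite E"
  shows "gex p E (\<lambda>_. a) = a"
proof -
  have "(\<Sum>G\<in>Pow E. p ^ card G * (1 - p) ^ card (E - G)) = (\<Prod>e\<in>E. p + (1 - p))"
    by (subst prod_add[OF assms]) simp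
  then show ?thesis
    by (simp add: gex_def flip: sum_distrib_right)
qed

lemma gex_no_edge:
  assumes "finite E"
  shows "gex p E (\<lambda>G. of_bool (G = {})) = (1 - p) ^ card E"
proof -
  have "gex p E (\<lambda>G. of_bool (G = {})) =
      (\<Sum>G\<in>{{}}. p ^ card G * (1 - p) ^ card (E - G) * of_bool (G = {}))"
    unfolding gex_def using assms by (intro sum.mono_neutral_right) auto
  then show ?thesis by simp
qed

text \<open>Independence over disjoint edge sets: a graph corresponds to the pair of its traces on
  \<open>E\<close> and \<open>E'\<close>, and its weight is the product of their weights.\<close>

lemma gex_Un:
  assumes "finite E" "finite E'" "E \<inter> E' = {}"
  shows "gex p (E \<union> E') (\<lambda>G. f (G \<inter> E) * g (G \<inter> E')) = gex p E f * gex p E' g"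
proof -
  let ?w = "\<lambda>E G. p ^ card G * (1 - p) ^ card (E - G)"
  have "gex p E f * gex p E' g = (\<Sum>(A, B)\<in>Pow E \<times> Pow E'. (?w E A * f A) * (?w E' B * g B))"
    by (simp add: gex_def sum_product sum.cartesian_product)
  also have "\<dots> = (\<Sum>G\<in>Pow (E \<union> E'). ?w (E \<union> E') G * (f (G \<inter> E) * g (G \<inter> E')))"
  proof (rule sum.reindex_bij_witness[where i = "\<lambda>G. (G \<inter> E, G \<inter> E')" and j = "\<lambda>(A, B). A \<union> B"];
      clarsimp?)
    fix A B assume AB: "A \<subseteq> E" "B \<subseteq> E'"
    have fin: "finite A" "finite B" using AB assms(1,2) finite_subset by blast+
    have eqs: "(A \<union> B) \<inter> E = A" "(A \<union> B) \<inter> E' = B" "E \<union> E' - (A \<union> B) = (E - A) \<union> (E' - B)"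
      using AB assms by auto
    have "card (A \<union> B) = card A + card B"
      using AB assms fin by (intro card_Un_disjoint) auto
    moreover have "card ((E - A) \<union> (E' - B)) = card (E - A) + card (E' - B)"
      using assms by (intro card_Un_disjoint) auto
    ultimately show "?w (E \<union> E') (A \<union> B) * (f ((A \<union> B) \<inter> E) * g ((A \<union> B) \<inter> E')) =
        ?w E A * f A * (?w E' B * g B)"
      unfolding eqs by (simp add: power_add)
  qed (use assms in auto)
  finally show ?thesis by (simp add: gex_def)
qed

lemma gex_UN:
  assumes "finite I" "\<And>i. i \<in> I \<Longrightarrow> finite (E i)" "disjoint_family_on E I"
  shows "gex p (\<Union>i\<in>I. E i) (\<lambda>G. \<Prod>i\<in>I. f i (G \<inter> E i)) = (\<Prod>i\<in>I. gex p (E i) (f i))"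
  using assms
proof (induction I rule: finite_induct)
  case (insert i I)
  have disj: "E i \<inter> (\<Union>j\<in>I. E j) = {}"
    using insert.prems(2) insert.hyps(2) by (fastforce simp: disjoint_family_on_def)
  have int: "G \<inter> (\<Union>j\<in>I. E j) \<inter> E j = G \<inter> E j" if "j \<in> I" for G j
    using that by blast
  have "gex p (\<Union>j\<in>insert i I. E j) (\<lambda>G. \<Prod>j\<in>insert i I. f j (G \<inter> E j))
      = gex p (E i \<union> (\<Union>j\<in>I. E j))
          (\<lambda>G. f i (G \<inter> E i) * (\<lambda>H. \<Prod>j\<in>I. f j (H \<inter> E j)) (G \<inter> (\<Union>j\<in>I. E j)))"
    using insert.hyps int by simp
  also have "\<dots> = gex p (E i) (f i) * gex p (\<Union>j\<in>I. E j) (\<lambda>H. \<Prod>j\<in>I. f j (H \<inter> E j))"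
    using insert.prems insert.hyps disj by (intro gex_Un) auto
  also have "gex p (\<Union>j\<in>I. E j) (\<lambda>H. \<Prod>j\<in>I. f j (H \<inter> E j)) = (\<Prod>j\<in>I. gex p (E j) (f j))"
    using insert.prems by (intro insert.IH) (auto simp: disjoint_family_on_def)
  finally show ?case using insert.hyps by simp
qed simp

text \<open>A factor \<open>z\<close> for each present edge turns the weights \<open>p\<close> and
  \<open>1 - p\<close> into \<open>p * z\<close> and \<open>1 - p\<close>. Normalised by their sum,
  these are Bernoulli weights again, so an exponential moment becomes an expectation for another
  edge probability.\<close>

lemma gex_tilt:
  assumes "finite E" "1 - p + p * z \<noteq> 0"
  shows "gex p E (\<lambda>G. z ^ card G * f G) =
    (1 - p + p * z) ^ card E * gex (p * z / (1 - p + p * z)) E f"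
proof -
  let ?d = "1 - p + p * z"
  have "p ^ card G * (1 - p) ^ card (E - G) * (z ^ card G * f G) =
      ?d ^ card E * ((p * z / ?d) ^ card G * (1 - p * z / ?d) ^ card (E - G) * f G)"
    if "G \<in> Pow E" for G
  proof -
    have c: "card E = card G + card (E - G)"
      using that assms(1) by (metis PowD card_Diff_subset card_mono finite_subset le_add_diff_inverse)
    have d: "1 - p * z / ?d = (1 - p) / ?d"
      using assms(2) by (simp add: field_simps)
    show ?thesis
      unfolding c d power_add power_divide using assms(2) by (simp add: power_mult_distrib)
  qed
  then show ?thesis
    unfolding gex_def sum_distrib_left by (intro sum.cong) auto
qed

lemma gex_image:
  assumes "inj_on h E"
  shows "gex p (h ` E) f = gex p E (\<lambda>G. f (h ` G))"
proof -
  have inj: "inj_on ((`) h) (Pow E)"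
    using assms by (intro inj_on_image_Pow) 
  have "card (h ` G) = card G \<and> card (h ` E - h ` G) = card (E - G)" if "G \<subseteq> E" for G
    using that assms
    by (metis Diff_subset card_image inj_on_image_set_diff inj_on_subset subset_refl)
  then show ?thesis
    unfolding gex_def image_Pow_surj[OF refl, symmetric]
    by (subst sum.reindex[OF inj]) (auto intro!: sum.cong)
qed

section \<open>The law of the random graph as a finite weighted sum\<close>

lemma finite_all_edges: "finite (all_edges n)"
  by (rule finite_subset[of _ "Pow {..<n}"]) (auto simp: all_edges_def)

lemma measure_random_graph:
  assumes "0 \<le> p" "p \<le> 1"
  shows "measure (measure_pmf (random_graph n p)) X = gex p (all_edges n) (\<lambda>G. of_bool (G \<in> X))"
proof -
  let ?E = "all_edges n"
  let ?M = "Pi_pmf ?E False (\<lambda>_. bernoulli_pmf p)"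
  have pmf: "pmf (random_graph n p) G = p ^ card G * (1 - p) ^ card (?E - G)" if "G \<subseteq> ?E" for G
  proof -
    have fG: "finite G" using that finite_all_edges finite_subset by blast
    have "pmf (random_graph n p) G = measure ?M ((\<lambda>f. {e \<in> ?E. f e}) -` {G})"
      by (simp add: random_graph_def pmf_map)
    \<comment> \<open>Almost surely \<open>f\<close> has the default value \<open>False\<close>
      outside the edge set, so the graph determines \<open>f\<close>.\<close>
    also have "\<dots> = measure ?M {\<lambda>e. e \<in> G}"
    proof (rule measure_pmf.finite_measure_eq_AE)
      show "AE f in measure_pmf ?M. f \<in> (\<lambda>f. {e \<in> ?E. f e}) -` {G} \<longleftrightarrow> f \<in> {\<lambda>e. e \<in> G}"
        using set_Pi_pmf_subset[OF finite_all_edges] that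
        by (fastforce simp: AE_measure_pmf_iff)
    qed auto
    also have "\<dots> = (\<Prod>e\<in>?E. pmf (bernoulli_pmf p) (e \<in> G))"
      using that by (subst measure_pmf_single, subst pmf_Pi') (auto simp: finite_all_edges)
    also have "\<dots> = (\<Prod>e\<in>G. p) * (\<Prod>e\<in>?E - G. 1 - p)"
      using that assms finite_all_edges[of n]
      by (subst prod.subset_diff[OF that]) (auto intro!: arg_cong2[where f = "(*)"] prod.cong)
    finally show ?thesis by simp
  qed
  have "measure (measure_pmf (random_graph n p)) X
      = measure (measure_pmf (random_graph n p)) (X \<inter> Pow ?E)"
    by (rule measure_pmf.finite_measure_eq_AE) (auto simp: AE_measure_pmf_iff random_graph_def)
  also have "\<dots> = (\<Sum>G\<in>X \<inter> Pow ?E. pmf (random_graph n p) G)"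
    by (rule measure_measure_pmf_finite) (simp add: finite_all_edges)
  also have "\<dots> = gex p ?E (\<lambda>G. of_bool (G \<in> X))"
    unfolding gex_def using finite_all_edges[of n]
    by (intro sum.mono_neutral_cong_left) (auto simp: pmf)
  finally show ?thesis .
qed

section \<open>Components and connection probabilities\<close>

definition edges :: "nat set \<Rightarrow> nat set set" where
  "edges V = {e. e \<subseteq> V \<and> card e = 2}"

text \<open>Nonemptiness is included because components are nonempty; otherwise
  \<open>comps_iff\<close> would fail for the empty set.\<close>

definition conn :: "nat set \<Rightarrow> nat set set \<Rightarrow> bool" where
  "conn V H \<longleftrightarrow> V \<noteq> {} \<and> (\<forall>v\<in>V. \<forall>w\<in>V. (v, w) \<in> (adjacency H)\<^sup>*)"

text \<open>A version of \<open>components\<close> for arbitrary vertex sets: what remains after the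
  removal of components need not be an initial segment.\<close>

definition comps :: "nat set \<Rightarrow> nat set set \<Rightarrow> nat set set" where
  "comps U G = (\<lambda>v. {w. (v, w) \<in> (adjacency G)\<^sup>*}) ` U"

lemma components_eq_comps: "components n G = comps {..<n} G"
  by (simp add: components_def comps_def)

lemma all_edges_eq_edges: "all_edges n = edges {..<n}"
  by (simp add: all_edges_def edges_def)

lemma edges_mono: "V \<subseteq> W \<Longrightarrow> edges V \<subseteq> edges W"
  by (auto simp: edges_def)

lemma finite_edges: "finite V \<Longrightarrow> finite (edges V)"
  by (rule finite_subset[of _ "Pow V"]) (auto simp: edges_def)

lemma card_edges: "finite V \<Longrightarrow> card (edges V) = card V choose 2"
  unfolding edges_def by (rule n_subsets)

lemma edges_disjoint: "V \<inter> W = {} \<Longrightarrow> edges V \<inter> edges W = {}"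
proof -
  assume VW: "V \<inter> W = {}"
  have "e \<notin> edges W" if e: "e \<in> edges V" for e
  proof
    assume "e \<in> edges W"
    then have "e = {}" "card e = 2" using e VW by (auto simp: edges_def)
    then show False by simp
  qed
  then show ?thesis by blast
qed

lemma adjacency_mono: "H \<subseteq> G \<Longrightarrow> adjacency H \<subseteq> adjacency G"
  by (auto simp: adjacency_def)

lemma conn_mono: "conn V H \<Longrightarrow> H \<subseteq> G \<Longrightarrow> conn V G"
  unfolding conn_def using rtrancl_mono[OF adjacency_mono] by blast

lemma reach_sym:
  assumes "(v, w) \<in> (adjacency G)\<^sup>*"
  shows "(w, v) \<in> (adjacency G)\<^sup>*"
proof -
  have "sym (adjacency G)"
    by (auto simp: sym_def adjacency_def insert_commute)
  then show ?thesis using assms by (meson sym_rtrancl symD)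
qed

lemma reach_in:
  assumes "G \<subseteq> edges U" "v \<in> U" "(v, w) \<in> (adjacency G)\<^sup>*"
  shows "w \<in> U"
  using assms(3) by (induction rule: rtrancl_induct) (use assms in \<open>auto simp: adjacency_def edges_def\<close>)

lemma comps_cases:
  assumes "V \<in> comps U G"
  obtains v where "v \<in> U" "V = {w. (v, w) \<in> (adjacency G)\<^sup>*}" "v \<in> V"
  using assms by (auto simp: comps_def)

lemma comps_eqI:
  assumes "V \<in> comps U G" "W \<in> comps U G" "x \<in> V" "x \<in> W"
  shows "V = W"
proof -
  obtain v w where v: "V = {y. (v, y) \<in> (adjacency G)\<^sup>*}" and w: "W = {y. (w, y) \<in> (adjacency G)\<^sup>*}"
    using assms(1,2) unfolding comps_def by blast
  have "(v, x) \<in> (adjacency G)\<^sup>*" "(w, x) \<in> (adjacency G)\<^sup>*"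
    using assms(3,4) unfolding v w by simp_all
  then have vw: "(v, w) \<in> (adjacency G)\<^sup>*" and wv: "(w, v) \<in> (adjacency G)\<^sup>*"
    by (rule rtrancl_trans[OF _ reach_sym], rule rtrancl_trans[OF _ reach_sym, rotated])
  have "(v, y) \<in> (adjacency G)\<^sup>* \<longleftrightarrow> (w, y) \<in> (adjacency G)\<^sup>*" for y
    using rtrancl_trans[OF vw, of y] rtrancl_trans[OF wv, of y] by iprover
  then show ?thesis unfolding v w by simp
qed

text \<open>This splits the event into conditions on disjoint sets of pairs: those inside
  \<open>V\<close> and those with exactly one end in \<open>V\<close>. Independence can then be
  applied.\<close>

lemma comps_iff:
  assumes G: "G \<subseteq> edges U"
  shows "V \<in> comps U G \<longleftrightarrow> V \<subseteq> U \<and> conn V (G \<inter> edges V) \<and> (\<forall>e\<in>G. e \<subseteq> V \<or> e \<inter> V = {})"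
proof
  assume V: "V \<in> comps U G"
  then obtain v where v: "v \<in> U" "V = {w. (v, w) \<in> (adjacency G)\<^sup>*}" "v \<in> V"
    by (rule comps_cases)
  have sub: "V \<subseteq> U" using v reach_in[OF G] by auto
  \<comment> \<open>Every vertex on a path from \<open>v\<close> is in \<open>V\<close>, so the path
    only uses edges inside \<open>V\<close>.\<close>
  have *: "(v, w) \<in> (adjacency (G \<inter> edges V))\<^sup>*" if "(v, w) \<in> (adjacency G)\<^sup>*" for w
    using that
  proof (induction rule: rtrancl_induct)
    case (step y z)
    have "y \<in> V" "z \<in> V" using step v by (auto intro: rtrancl_into_rtrancl)
    moreover have "{y, z} \<in> G" using step by (simp add: adjacency_def)
    moreover have "card {y, z} = 2" using \<open>{y, z} \<in> G\<close> G by (auto simp: edges_def)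
    ultimately have "(y, z) \<in> adjacency (G \<inter> edges V)" by (simp add: adjacency_def edges_def)
    then show ?case using step.IH by (meson rtrancl_into_rtrancl)
  qed simp
  have "conn V (G \<inter> edges V)"
    unfolding conn_def
  proof (intro conjI ballI)
    fix a b assume "a \<in> V" "b \<in> V"
    then have "(v, a) \<in> (adjacency (G \<inter> edges V))\<^sup>*" "(v, b) \<in> (adjacency (G \<inter> edges V))\<^sup>*"
      using * v(2) by simp_all
    then show "(a, b) \<in> (adjacency (G \<inter> edges V))\<^sup>*"
      by (rule rtrancl_trans[OF reach_sym])
  qed (use v in auto)
  moreover have "e \<subseteq> V \<or> e \<inter> V = {}" if "e \<in> G" for e
  proof -
    have "e \<in> edges U" using that G by blast
    then obtain a b where e: "e = {a, b}"
      by (auto simp: edges_def card_2_iff)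
    then have "(a, b) \<in> adjacency G" "(b, a) \<in> adjacency G"
      using that by (auto simp: adjacency_def insert_commute)
    then have "a \<in> V \<longleftrightarrow> b \<in> V"
      using rtrancl_into_rtrancl[of v a "adjacency G" b] rtrancl_into_rtrancl[of v b "adjacency G" a]
      unfolding v(2) by blast
    then show ?thesis using e by auto
  qed
  ultimately show "V \<subseteq> U \<and> conn V (G \<inter> edges V) \<and> (\<forall>e\<in>G. e \<subseteq> V \<or> e \<inter> V = {})"
    using sub by blast
next
  assume V: "V \<subseteq> U \<and> conn V (G \<inter> edges V) \<and> (\<forall>e\<in>G. e \<subseteq> V \<or> e \<inter> V = {})"
  then obtain v where v: "v \<in> V" by (auto simp: conn_def)
  have "w \<in> V" if "(v, w) \<in> (adjacency G)\<^sup>*" for w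
    using that
  proof (induction rule: rtrancl_induct)
    case (step y z)
    then have "{y, z} \<in> G" by (simp add: adjacency_def)
    moreover have "\<forall>e\<in>G. e \<subseteq> V \<or> e \<inter> V = {}" using V by simp
    ultimately have "{y, z} \<subseteq> V \<or> {y, z} \<inter> V = {}" by (rule bspec[rotated])
    then show ?case using step.IH by simp
  qed (rule v)
  moreover have "(v, w) \<in> (adjacency G)\<^sup>*" if "w \<in> V" for w
  proof -
    have "conn V G" using V by (intro conn_mono[of V "G \<inter> edges V" G]) auto
    then show ?thesis using v that by (simp add: conn_def)
  qed
  ultimately have "V = {w. (v, w) \<in> (adjacency G)\<^sup>*}" by blast
  then show "V \<in> comps U G" unfolding comps_def using V v by (intro image_eqI[of _ _ v]) auto
qed

lemma comps_nonempty: "V \<in> comps U G \<Longrightarrow> V \<noteq> {}"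
  by (auto simp: comps_def)

lemma comps_subset: "G \<subseteq> edges U \<Longrightarrow> V \<in> comps U G \<Longrightarrow> V \<subseteq> U"
  by (simp add: comps_iff)

lemma finite_comps: "finite U \<Longrightarrow> finite (comps U G)"
  by (simp add: comps_def)

lemma Union_comps: "G \<subseteq> edges U \<Longrightarrow> \<Union>(comps U G) = U"
proof
  assume G: "G \<subseteq> edges U"
  show "\<Union>(comps U G) \<subseteq> U" using comps_subset[OF G] by blast
  show "U \<subseteq> \<Union>(comps U G)" by (auto simp: comps_def)
qed

lemma sum_card_comps:
  assumes "finite U" "G \<subseteq> edges U"
  shows "(\<Sum>D\<in>comps U G. card D) = card U"
proof -
  have "card (\<Union>(comps U G)) = (\<Sum>D\<in>comps U G. card D)"
  proof (rule card_Union_disjoint)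
    show "pairwise disjnt (comps U G)"
      using comps_eqI unfolding pairwise_def disjnt_def by blast
  qed (meson assms comps_subset finite_subset)
  then show ?thesis using Union_comps[OF assms(2)] by simp
qed

text \<open>No edge leaves a component, so an edge meeting the rest lies inside it. Conditions on
  all other components thus become events of the graph on the remaining vertices.\<close>

lemma comps_rest:
  assumes G: "G \<subseteq> edges U" and V: "\<And>i. i \<in> I \<Longrightarrow> V i \<in> comps U G"
  shows "comps U G - V ` I = comps (U - (\<Union>i\<in>I. V i)) (G \<inter> edges (U - (\<Union>i\<in>I. V i)))"
proof -
  let ?R = "U - (\<Union>i\<in>I. V i)"
  have "D \<in> comps U G - V ` I \<longleftrightarrow> D \<in> comps ?R (G \<inter> edges ?R)" for D
  proof
    assume D: "D \<in> comps U G - V ` I"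
    have "D \<inter> V i = {}" if "i \<in> I" for i
      using D V[OF that] that comps_eqI[of D U G "V i"] by blast
    then have sub: "D \<subseteq> ?R" using D comps_subset[OF G] by blast
    then have "G \<inter> edges ?R \<inter> edges D = G \<inter> edges D"
      using edges_mono[of D ?R] by blast
    then show "D \<in> comps ?R (G \<inter> edges ?R)"
      using D sub comps_iff[OF G, of D] by (subst comps_iff) auto
  next
    assume D: "D \<in> comps ?R (G \<inter> edges ?R)"
    have sub: "D \<subseteq> ?R" using comps_subset[OF _ D] by blast
    then have eq: "G \<inter> edges ?R \<inter> edges D = G \<inter> edges D"
      using edges_mono[of D ?R] by blast
    have "e \<subseteq> D \<or> e \<inter> D = {}" if e: "e \<in> G" for e
    proof (cases "e \<subseteq> ?R")
      case True
      then have "e \<in> G \<inter> edges ?R" using e G by (auto simp: edges_def)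
      then show ?thesis using D comps_iff[of "G \<inter> edges ?R" ?R D] by blast
    next
      case False
      then obtain i where i: "i \<in> I" "e \<inter> V i \<noteq> {}"
        using e G by (auto simp: edges_def)
      then have "e \<subseteq> V i" using V[OF i(1)] comps_iff[OF G, of "V i"] e by blast
      then show ?thesis using sub i by blast
    qed
    then have "D \<in> comps U G"
      using D sub eq comps_iff[of "G \<inter> edges ?R" ?R D] by (subst comps_iff[OF G]) auto
    moreover have "D \<noteq> V i" if "i \<in> I" for i
      using sub comps_nonempty[OF D] that by blast
    ultimately show "D \<in> comps U G - V ` I" by blast
  qed
  then show ?thesis by blast
qed

text \<open>The pairs that must be absent from the graph for the sets \<open>V i\<close> to be components.\<close>

definition cross_pairs :: "nat set \<Rightarrow> 'i set \<Rightarrow> ('i \<Rightarrow> nat set) \<Rightarrow> nat set set" where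
  "cross_pairs U I V = edges U - (\<Union>i\<in>I. edges (V i)) - edges (U - (\<Union>i\<in>I. V i))"

text \<open>An edge that no \<open>V i\<close> splits lies inside one of them or inside the rest,
  that is, outside the cross pairs. Conversely, by disjointness, an edge inside one
  \<open>V j\<close> misses all the others.\<close>

lemma all_comps_iff:
  assumes G: "G \<subseteq> edges U" and V: "\<And>i. i \<in> I \<Longrightarrow> V i \<subseteq> U" and disj: "disjoint_family_on V I"
  shows "(\<forall>i\<in>I. V i \<in> comps U G) \<longleftrightarrow>
    (\<forall>i\<in>I. conn (V i) (G \<inter> edges (V i))) \<and> G \<inter> cross_pairs U I V = {}"
proof -
  have "(\<forall>i\<in>I. \<forall>e\<in>G. e \<subseteq> V i \<or> e \<inter> V i = {}) \<longleftrightarrow> G \<inter> cross_pairs U I V = {}"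
  proof
    assume *: "\<forall>i\<in>I. \<forall>e\<in>G. e \<subseteq> V i \<or> e \<inter> V i = {}"
    show "G \<inter> cross_pairs U I V = {}"
    proof (rule ccontr)
      assume "G \<inter> cross_pairs U I V \<noteq> {}"
      then obtain e where e: "e \<in> G" "e \<in> cross_pairs U I V" by blast
      then have "e \<subseteq> U" "card e = 2" "\<not> e \<subseteq> U - (\<Union>i\<in>I. V i)" "\<forall>i\<in>I. \<not> e \<subseteq> V i"
        by (auto simp: cross_pairs_def edges_def)
      then show False using * e by blast
    qed
  next
    assume *: "G \<inter> cross_pairs U I V = {}"
    show "\<forall>i\<in>I. \<forall>e\<in>G. e \<subseteq> V i \<or> e \<inter> V i = {}"
    proof (intro ballI)
      fix i e assume i: "i \<in> I" and e: "e \<in> G"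
      then have "e \<notin> cross_pairs U I V" "e \<in> edges U" using * G by auto
      then consider j where "j \<in> I" "e \<subseteq> V j" | "e \<subseteq> U - (\<Union>i\<in>I. V i)"
        by (auto simp: cross_pairs_def edges_def)
      then show "e \<subseteq> V i \<or> e \<inter> V i = {}"
      proof cases
        case 1
        then show ?thesis using disj i by (cases "i = j") (fastforce simp: disjoint_family_on_def)+
      next
        case 2
        then show ?thesis using i by blast
      qed
    qed
  qed
  moreover have "V i \<in> comps U G \<longleftrightarrow> conn (V i) (G \<inter> edges (V i)) \<and> (\<forall>e\<in>G. e \<subseteq> V i \<or> e \<inter> V i = {})"
    if "i \<in> I" for i
    using comps_iff[OF G, of "V i"] V[OF that] by simp
  ultimately show ?thesis by (metis (no_types, lifting))
qed

lemma edges_decomp: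
  assumes V: "\<And>i. i \<in> I \<Longrightarrow> V i \<subseteq> U"
  shows "edges U = (\<Union>i\<in>I. edges (V i)) \<union> (edges (U - (\<Union>i\<in>I. V i)) \<union> cross_pairs U I V)"
proof -
  have "(\<Union>i\<in>I. edges (V i)) \<subseteq> edges U" using V edges_mono by (intro UN_least) blast
  moreover have "edges (U - (\<Union>i\<in>I. V i)) \<subseteq> edges U" by (rule edges_mono) blast
  ultimately show ?thesis unfolding cross_pairs_def by blast
qed

lemma edges_family_disjoint: "disjoint_family_on V I \<Longrightarrow> disjoint_family_on (\<lambda>i. edges (V i)) I"
  using edges_disjoint by (simp add: disjoint_family_on_def)

lemma edges_rest_disjoint:
  "(\<Union>i\<in>I. edges (V i)) \<inter> edges (U - (\<Union>i\<in>I. V i)) = {}"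
proof -
  have "edges (V i) \<inter> edges (U - (\<Union>i\<in>I. V i)) = {}" if "i \<in> I" for i
    using that by (intro edges_disjoint) blast
  then show ?thesis by blast
qed

text \<open>The pairs inside the \<open>V i\<close>, inside the rest and across are disjoint blocks.
  This is the conditional independence behind all later estimates: given that the \<open>V i\<close>
  are components, the graphs on them are independent connected graphs and the rest is an
  unconditioned random graph.\<close>

lemma gex_comps:
  fixes V :: "'i \<Rightarrow> nat set"
  assumes U: "finite U" and I: "finite I"
    and V: "\<And>i. i \<in> I \<Longrightarrow> V i \<subseteq> U" and disj: "disjoint_family_on V I"
  shows "gex p (edges U) (\<lambda>G. of_bool (\<forall>i\<in>I. V i \<in> comps U G) *
      (\<Prod>i\<in>I. f i (G \<inter> edges (V i))) * g (G \<inter> edges (U - (\<Union>i\<in>I. V i)))) =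
    (\<Prod>i\<in>I. gex p (edges (V i)) (\<lambda>H. of_bool (conn (V i) H) * f i H)) *
    (1 - p) ^ card (cross_pairs U I V) * gex p (edges (U - (\<Union>i\<in>I. V i))) g"
proof -
  let ?R = "U - (\<Union>i\<in>I. V i)" and ?X = "cross_pairs U I V"
  let ?E = "\<Union>i\<in>I. edges (V i)"
  let ?f = "\<lambda>i H. of_bool (conn (V i) H) * f i H"
  have finV: "finite (V i)" if "i \<in> I" for i using V[OF that] U finite_subset by blast
  have finX: "finite ?X" using finite_edges[OF U] by (simp add: cross_pairs_def)
  have finE: "finite ?E" using I finV finite_edges by blast
  have finR: "finite (edges ?R)" using U finite_edges by blast
  have disjX: "edges ?R \<inter> ?X = {}" "?E \<inter> (edges ?R \<union> ?X) = {}"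
    using edges_rest_disjoint[of V I U] by (auto simp: cross_pairs_def)
  \<comment> \<open>The integrand is written through the traces of \<open>G\<close> on
    \<open>?E\<close> and on \<open>edges ?R \<union> ?X\<close>, the form in which
    \<open>gex_Un\<close> factorises it.\<close>
  have "gex p (edges U) (\<lambda>G. of_bool (\<forall>i\<in>I. V i \<in> comps U G) *
      (\<Prod>i\<in>I. f i (G \<inter> edges (V i))) * g (G \<inter> edges ?R)) =
    gex p (edges U) (\<lambda>G. (\<Prod>i\<in>I. ?f i (G \<inter> ?E \<inter> edges (V i))) *
      (g (G \<inter> (edges ?R \<union> ?X) \<inter> edges ?R) * of_bool (G \<inter> (edges ?R \<union> ?X) \<inter> ?X = {})))"
  proof (rule gex_cong)
    fix G assume G: "G \<subseteq> edges U"
    have "(\<Prod>i\<in>I. ?f i (G \<inter> ?E \<inter> edges (V i))) = (\<Prod>i\<in>I. ?f i (G \<inter> edges (V i)))"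
    proof (intro prod.cong refl)
      fix i assume "i \<in> I"
      then have "G \<inter> ?E \<inter> edges (V i) = G \<inter> edges (V i)" by blast
      then show "?f i (G \<inter> ?E \<inter> edges (V i)) = ?f i (G \<inter> edges (V i))" by simp
    qed
    also have "\<dots> = of_bool (\<forall>i\<in>I. conn (V i) (G \<inter> edges (V i))) * (\<Prod>i\<in>I. f i (G \<inter> edges (V i)))"
      using I by (simp add: prod.distrib)
    finally have 1: "(\<Prod>i\<in>I. ?f i (G \<inter> ?E \<inter> edges (V i))) = \<dots>" .
    have 2: "G \<inter> (edges ?R \<union> ?X) \<inter> edges ?R = G \<inter> edges ?R"
      "G \<inter> (edges ?R \<union> ?X) \<inter> ?X = G \<inter> ?X" by auto
    have iff: "(\<forall>i\<in>I. V i \<in> comps U G) \<longleftrightarrow>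
      (\<forall>i\<in>I. conn (V i) (G \<inter> edges (V i))) \<and> G \<inter> ?X = {}"
      by (rule all_comps_iff[OF G V disj])
    show "of_bool (\<forall>i\<in>I. V i \<in> comps U G) * (\<Prod>i\<in>I. f i (G \<inter> edges (V i))) * g (G \<inter> edges ?R) =
      (\<Prod>i\<in>I. ?f i (G \<inter> ?E \<inter> edges (V i))) *
      (g (G \<inter> (edges ?R \<union> ?X) \<inter> edges ?R) * of_bool (G \<inter> (edges ?R \<union> ?X) \<inter> ?X = {}))"
      unfolding 1 2 iff by simp
  qed
  also have "\<dots> = gex p (?E \<union> (edges ?R \<union> ?X)) (\<lambda>G. (\<Prod>i\<in>I. ?f i (G \<inter> ?E \<inter> edges (V i))) *
      (g (G \<inter> (edges ?R \<union> ?X) \<inter> edges ?R) * of_bool (G \<inter> (edges ?R \<union> ?X) \<inter> ?X = {})))"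
    using edges_decomp[OF V, of I] by simp
  also have "\<dots> = gex p ?E (\<lambda>H. \<Prod>i\<in>I. ?f i (H \<inter> edges (V i))) *
      gex p (edges ?R \<union> ?X) (\<lambda>H. g (H \<inter> edges ?R) * of_bool (H \<inter> ?X = {}))"
    using finE finR finX disjX
    by (intro gex_Un[where f = "\<lambda>H. \<Prod>i\<in>I. ?f i (H \<inter> edges (V i))"
          and g = "\<lambda>H. g (H \<inter> edges ?R) * of_bool (H \<inter> ?X = {})"]) auto
  also have "gex p ?E (\<lambda>H. \<Prod>i\<in>I. ?f i (H \<inter> edges (V i))) = (\<Prod>i\<in>I. gex p (edges (V i)) (?f i))"
    using I finV finite_edges edges_family_disjoint[OF disj] by (intro gex_UN) auto
  also have "gex p (edges ?R \<union> ?X) (\<lambda>H. g (H \<inter> edges ?R) * of_bool (H \<inter> ?X = {})) =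
      gex p (edges ?R) g * gex p ?X (\<lambda>H. of_bool (H = {}))"
    using finR finX disjX by (intro gex_Un[where g = "\<lambda>H. of_bool (H = {})"]) auto
  finally show ?thesis by (simp add: gex_no_edge[OF finX] mult_ac)
qed

section \<open>Counting the pairs that must be absent\<close>

lemma choose_two_real: "2 * real (k choose 2) = (real k)\<^sup>2 - real k"
proof (cases k)
  case (Suc j)
  have "even (k * (k - 1))" by (cases "even k") auto
  then have "2 * (k choose 2) = k * (k - 1)" by (simp add: choose_two)
  then have "real (2 * (k choose 2)) = real (k * (k - 1))" by simp
  then show ?thesis using Suc by (simp add: power2_eq_square algebra_simps)
qed simp

text \<open>Each block contributes half of its size squared minus its size. The linear terms cancel
  because the sizes add up to \<open>card U\<close>.\<close>

lemma card_cross_pairs: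
  fixes V :: "'i \<Rightarrow> nat set"
  assumes U: "finite U" and I: "finite I"
    and V: "\<And>i. i \<in> I \<Longrightarrow> V i \<subseteq> U" and disj: "disjoint_family_on V I"
  shows "card (U - (\<Union>i\<in>I. V i)) + (\<Sum>i\<in>I. card (V i)) = card U"
    and "2 * real (card (cross_pairs U I V)) =
      (real (card U))\<^sup>2 - (\<Sum>i\<in>I. (real (card (V i)))\<^sup>2) - (real (card (U - (\<Union>i\<in>I. V i))))\<^sup>2"
proof -
  let ?R = "U - (\<Union>i\<in>I. V i)" and ?X = "cross_pairs U I V"
  let ?E = "\<Union>i\<in>I. edges (V i)"
  have finV: "finite (V i)" if "i \<in> I" for i using V[OF that] U finite_subset by blast
  have "card (\<Union>i\<in>I. V i) = (\<Sum>i\<in>I. card (V i))"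
    using I finV disj by (intro card_UN_disjoint) (auto simp: disjoint_family_on_def)
  moreover have "card ?R = card U - card (\<Union>i\<in>I. V i)" "card (\<Union>i\<in>I. V i) \<le> card U"
    using U V I finV by (auto intro!: card_Diff_subset card_mono)
  ultimately show 1: "card ?R + (\<Sum>i\<in>I. card (V i)) = card U" by simp
  have finX: "finite ?X" using finite_edges[OF U] by (simp add: cross_pairs_def)
  have finE: "finite ?E" using I finV finite_edges by blast
  have finR: "finite (edges ?R)" using U finite_edges by blast
  have "card (edges U) = card (?E \<union> (edges ?R \<union> ?X))"
    using edges_decomp[OF V, of I] by simp
  also have "\<dots> = card ?E + card (edges ?R \<union> ?X)"
    using finE finR finX edges_rest_disjoint[of V I U]
    by (intro card_Un_disjoint) (auto simp: cross_pairs_def)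
  also have "card (edges ?R \<union> ?X) = card (edges ?R) + card ?X"
    using finR finX by (intro card_Un_disjoint) (auto simp: cross_pairs_def)
  also have "card ?E = (\<Sum>i\<in>I. card (edges (V i)))"
    using I finV finite_edges edges_family_disjoint[OF disj]
    by (intro card_UN_disjoint) (auto simp: disjoint_family_on_def)
  finally have "2 * real (card (edges U)) =
      (\<Sum>i\<in>I. 2 * real (card (edges (V i)))) + 2 * real (card (edges ?R)) + 2 * real (card ?X)"
    by (simp flip: sum_distrib_left)
  moreover have "(\<Sum>i\<in>I. 2 * real (card (edges (V i)))) = (\<Sum>i\<in>I. (real (card (V i)))\<^sup>2 - real (card (V i)))"
    using finV by (intro sum.cong refl) (simp add: card_edges choose_two_real)
  moreover have "2 * real (card (edges ?R)) = (real (card ?R))\<^sup>2 - real (card ?R)"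
    "2 * real (card (edges U)) = (real (card U))\<^sup>2 - real (card U)"
    using U by (simp_all add: card_edges choose_two_real)
  moreover have "real (card U) = real (card ?R) + (\<Sum>i\<in>I. real (card (V i)))"
    by (simp flip: 1)
  ultimately show "2 * real (card ?X) =
      (real (card U))\<^sup>2 - (\<Sum>i\<in>I. (real (card (V i)))\<^sup>2) - (real (card ?R))\<^sup>2"
    by (simp add: sum_subtractf)
qed

lemma gex_comp:
  assumes "finite U" "V \<subseteq> U"
  shows "gex p (edges U) (\<lambda>G. of_bool (V \<in> comps U G) * f (G \<inter> edges V) * g (G \<inter> edges (U - V))) =
    gex p (edges V) (\<lambda>H. of_bool (conn V H) * f H) *
    (1 - p) ^ (card V * (card U - card V)) * gex p (edges (U - V)) g"
proof -
  have "card (cross_pairs U {()} (\<lambda>_. V)) = card V * (card U - card V)"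
  proof -
    have 1: "card (U - V) + card V = card U"
      and 2: "2 * real (card (cross_pairs U {()} (\<lambda>_. V))) =
        (real (card U))\<^sup>2 - (real (card V))\<^sup>2 - (real (card (U - V)))\<^sup>2"
      using card_cross_pairs[of U "{()}" "\<lambda>_. V"] assms by (auto simp: disjoint_family_on_def)
    have "real (card (cross_pairs U {()} (\<lambda>_. V))) = real (card V * (card U - card V))"
      using 2 unfolding 1[symmetric] by (simp add: power2_eq_square algebra_simps)
    then show ?thesis by (simp only: of_nat_eq_iff)
  qed
  then show ?thesis
    using gex_comps[of U "{()}" "\<lambda>_. V" p "\<lambda>_. f" g] assms by (auto simp: disjoint_family_on_def)
qed

definition pconn :: "nat \<Rightarrow> real \<Rightarrow> real" where
  "pconn k p = gex p (edges {..<k}) (\<lambda>H. of_bool (conn {..<k} H))"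

lemma conn_image:
  assumes "conn V H"
  shows "conn (f ` V) ((`) f ` H)"
proof -
  have "(f v, f w) \<in> (adjacency ((`) f ` H))\<^sup>*" if "(v, w) \<in> (adjacency H)\<^sup>*" for v w
    using that
  proof (induction rule: rtrancl_induct)
    case (step y z)
    then have "{y, z} \<in> H" by (simp add: adjacency_def)
    then have "f ` {y, z} \<in> (`) f ` H" by blast
    then have "(f y, f z) \<in> adjacency ((`) f ` H)" by (simp add: adjacency_def)
    then show ?case using step.IH by (meson rtrancl_into_rtrancl)
  qed simp
  then show ?thesis using assms by (auto simp: conn_def)
qed

text \<open>A bijection of the vertices preserves weights and connectedness, so the probability
  depends on the size of \<open>V\<close> alone and every factor in \<open>gex_comps\<close> is a
  \<open>pconn\<close>.\<close>

lemma gex_conn: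
  assumes "finite V"
  shows "gex p (edges V) (\<lambda>H. of_bool (conn V H)) = pconn (card V) p"
proof -
  obtain h where h: "bij_betw h {..<card V} V"
    using ex_bij_betw_nat_finite[OF assms] by (auto simp: atLeast0LessThan)
  let ?W = "{..<card V}"
  define g where "g = inv_into ?W h"
  have V: "V = h ` ?W" and inj: "inj_on h ?W" using h by (auto simp: bij_betw_def)
  have gh: "g (h x) = x" if "x \<in> ?W" for x using that inj by (simp add: g_def)
  have ghs: "g ` h ` e = e" if "e \<subseteq> ?W" for e
  proof -
    have "g ` h ` e = (\<lambda>x. x) ` e"
      unfolding image_image using that gh by (intro image_cong) auto
    then show ?thesis by simp
  qed
  have E: "edges V = (`) h ` edges ?W"
  proof
    show "edges V \<subseteq> (`) h ` edges ?W"
    proof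
      fix e assume "e \<in> edges V"
      then have e: "e \<subseteq> h ` ?W" "card e = 2" using V by (auto simp: edges_def)
      then obtain d where d: "d \<subseteq> ?W" "e = h ` d" by (meson subset_imageE)
      then have "card d = 2" using e inj by (metis card_image inj_on_subset)
      then show "e \<in> (`) h ` edges ?W" using d by (auto simp: edges_def)
    qed
    show "(`) h ` edges ?W \<subseteq> edges V"
      using V inj by (auto simp: edges_def card_image inj_on_subset)
  qed
  have injE: "inj_on ((`) h) (edges ?W)"
    using inj by (intro inj_on_subset[OF inj_on_image_Pow[OF inj]]) (auto simp: edges_def)
  have iff: "conn V ((`) h ` G) \<longleftrightarrow> conn ?W G" if G: "G \<subseteq> edges ?W" for G
  proof
    assume "conn V ((`) h ` G)"
    then have "conn (g ` h ` ?W) ((`) g ` (`) h ` G)" using V conn_image by metis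
    moreover have "(`) g ` (`) h ` G = (\<lambda>x. x) ` G"
      unfolding image_image[of "(`) g"]
    proof (rule image_cong[OF refl])
      fix e assume "e \<in> G"
      then show "g ` h ` e = e" using G by (intro ghs) (auto simp: edges_def)
    qed
    ultimately show "conn ?W G" using ghs[of ?W] by simp
  next
    assume "conn ?W G"
    then show "conn V ((`) h ` G)" using conn_image V by metis
  qed
  have "gex p (edges V) (\<lambda>H. of_bool (conn V H)) =
      gex p (edges ?W) (\<lambda>H. of_bool (conn V ((`) h ` H)))"
    unfolding E by (rule gex_image[OF injE])
  also have "\<dots> = pconn (card V) p"
    unfolding pconn_def using iff by (intro gex_cong) simp
  finally show ?thesis .
qed

lemma pconn_1 [simp]: "pconn (Suc 0) p = 1"
proof -
  have "edges {..<Suc 0} = {}"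
    by (auto simp: edges_def card_2_iff subset_singleton_iff lessThan_Suc)
  then show ?thesis by (simp add: pconn_def conn_def lessThan_Suc)
qed

lemma pconn_nonneg: "0 \<le> p \<Longrightarrow> p \<le> 1 \<Longrightarrow> 0 \<le> pconn k p"
  unfolding pconn_def by (intro gex_nonneg) auto

text \<open>It suffices that the first \<open>k\<close> vertices are connected among themselves and
  that the new vertex has an edge to at least one of them. These events depend on disjoint sets of
  pairs.\<close>

lemma pconn_Suc_ge:
  assumes p: "0 \<le> p" "p \<le> 1" and k: "k \<ge> 1"
  shows "pconn k p * (1 - (1 - p) ^ k) \<le> pconn (Suc k) p"
proof -
  let ?V = "{..<k}" and ?U = "{..<Suc k}"
  let ?X = "(\<lambda>v. {k, v}) ` ?V"
  have inj: "inj_on (\<lambda>v. {k, v}) ?V" by (auto simp: inj_on_def doubleton_eq_iff)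
  have E: "edges ?U = edges ?V \<union> ?X"
  proof
    show "edges ?U \<subseteq> edges ?V \<union> ?X"
    proof
      fix e assume "e \<in> edges ?U"
      then obtain a b where e: "e = {a, b}" "a \<noteq> b" "a < Suc k" "b < Suc k"
        by (auto simp: edges_def card_2_iff)
      then show "e \<in> edges ?V \<union> ?X"
        by (auto simp: edges_def less_Suc_eq insert_commute)
    qed
    show "edges ?V \<union> ?X \<subseteq> edges ?U" by (auto simp: edges_def)
  qed
  have fin: "finite (edges ?V)" "finite ?X" by (simp_all add: finite_edges)
  have disj: "edges ?V \<inter> ?X = {}" by (auto simp: edges_def)
  have "pconn k p * (1 - (1 - p) ^ k) =
      gex p (edges ?V) (\<lambda>H. of_bool (conn ?V H)) * gex p ?X (\<lambda>H. 1 - of_bool (H = {}))"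
    by (simp add: pconn_def gex_diff gex_const gex_no_edge card_image[OF inj])
  also have "\<dots> = gex p (edges ?U) (\<lambda>G. of_bool (conn ?V (G \<inter> edges ?V)) * (1 - of_bool (G \<inter> ?X = {})))"
    unfolding E
    by (rule gex_Un[OF fin disj, where f = "\<lambda>H. of_bool (conn ?V H)" and g = "\<lambda>H. 1 - of_bool (H = {})",
          symmetric])
  also have "\<dots> \<le> gex p (edges ?U) (\<lambda>G. of_bool (conn ?U G))"
  proof (rule gex_mono[OF p])
    fix G assume G: "G \<subseteq> edges ?U"
    have "conn ?U G" if c: "conn ?V (G \<inter> edges ?V)" and x: "G \<inter> ?X \<noteq> {}"
    proof -
      obtain v where v: "v < k" "{k, v} \<in> G" using x by auto
      then have kv: "(k, v) \<in> (adjacency G)\<^sup>*" by (auto simp: adjacency_def)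
      have "(v, w) \<in> (adjacency G)\<^sup>*" if "w < Suc k" for w
        using that conn_mono[OF c, of G] v reach_sym[OF kv] by (auto simp: conn_def less_Suc_eq)
      then have "(x, y) \<in> (adjacency G)\<^sup>*" if "x < Suc k" "y < Suc k" for x y
        using that rtrancl_trans[OF reach_sym[of v x G], of y] by blast
      then show ?thesis
        unfolding conn_def by (auto simp: lessThan_Suc)
    qed
    then show "of_bool (conn ?V (G \<inter> edges ?V)) * (1 - of_bool (G \<inter> ?X = {})) \<le> (of_bool (conn ?U G) :: real)"
      by auto
  qed
  finally show ?thesis by (simp add: pconn_def)
qed

lemma pconn_pos:
  assumes "0 < p" "p < 1" "k \<ge> 1"
  shows "0 < pconn k p"
  using assms(3)
proof (induction k rule: dec_induct)
  case (step k)
  have "(1 - p) ^ k < 1" using assms step by (intro power_less_one_iff[THEN iffD2]) auto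
  then have "0 < pconn k p * (1 - (1 - p) ^ k)" using step by simp
  then show ?case using pconn_Suc_ge[of p k] assms step by simp
qed simp

text \<open>
  The expected number of components of size \<open>k\<close> of the random graph on \<open>N\<close> vertices.
\<close>

definition ncomp :: "nat \<Rightarrow> nat \<Rightarrow> real \<Rightarrow> real" where
  "ncomp N k p = real (N choose k) * pconn k p * (1 - p) ^ (k * (N - k))"

lemma ncomp_nonneg: "0 \<le> p \<Longrightarrow> p \<le> 1 \<Longrightarrow> 0 \<le> ncomp N k p"
  by (simp add: ncomp_def pconn_nonneg)

text \<open>By \<open>gex_comp\<close> the probability that \<open>V\<close> is a component depends
  on \<open>card V\<close> only, so sums over vertex sets reduce to sums over sizes.\<close>

lemma sum_comps_rest:
  assumes "finite U" "finite S"
  shows "(\<Sum>V | V \<subseteq> U \<and> card V \<in> S. a (card V) * gex p (edges U) (\<lambda>G. of_bool (V \<in> comps U G))) =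
    (\<Sum>k\<in>S. a k * ncomp (card U) k p)"
proof -
  have "gex p (edges U) (\<lambda>G. of_bool (V \<in> comps U G)) =
      pconn (card V) p * (1 - p) ^ (card V * (card U - card V))" if "V \<subseteq> U" for V
    using gex_comp[OF assms(1) that, of p "\<lambda>_. 1" "\<lambda>_. 1"] finite_subset[OF that assms(1)] assms(1)
    by (simp add: gex_conn gex_const finite_edges)
  then have "(\<Sum>V | V \<subseteq> U \<and> card V \<in> S. a (card V) * gex p (edges U) (\<lambda>G. of_bool (V \<in> comps U G))) =
     (\<Sum>V | V \<subseteq> U \<and> card V \<in> S. a (card V) * (pconn (card V) p * (1 - p) ^ (card V * (card U - card V))))"
    by (intro sum.cong) auto
  also have "\<dots> = (\<Sum>k\<in>S. \<Sum>V | V \<in> {V. V \<subseteq> U \<and> card V \<in> S} \<and> card V = k.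
      a (card V) * (pconn (card V) p * (1 - p) ^ (card V * (card U - card V))))"
    using assms by (intro sum.group[symmetric]) auto
  also have "\<dots> = (\<Sum>k\<in>S. a k * ncomp (card U) k p)"
  proof (intro sum.cong refl)
    fix k assume k: "k \<in> S"
    have "(\<Sum>V | V \<in> {V. V \<subseteq> U \<and> card V \<in> S} \<and> card V = k.
        a (card V) * (pconn (card V) p * (1 - p) ^ (card V * (card U - card V)))) =
      (\<Sum>V | V \<subseteq> U \<and> card V = k. a k * (pconn k p * (1 - p) ^ (k * (card U - k))))"
      using k by (intro sum.cong) auto
    then show "(\<Sum>V | V \<in> {V. V \<subseteq> U \<and> card V \<in> S} \<and> card V = k.
        a (card V) * (pconn (card V) p * (1 - p) ^ (card V * (card U - card V)))) = a k * ncomp (card U) k p"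
      using assms by (simp add: ncomp_def n_subsets)
  qed
  finally show ?thesis .
qed

text \<open>The components partition the vertices, so their sizes add up to \<open>N\<close> in
  every graph; the identity is the expectation of this.\<close>

lemma sum_ncomp:
  assumes p: "0 \<le> p" "p \<le> 1"
  shows "(\<Sum>k\<le>N. real k * ncomp N k p) = real N"
proof -
  let ?U = "{..<N}"
  have "(\<Sum>k\<le>N. real k * ncomp N k p) =
      (\<Sum>V | V \<subseteq> ?U \<and> card V \<in> {..N}. real (card V) * gex p (edges ?U) (\<lambda>G. of_bool (V \<in> comps ?U G)))"
    by (subst sum_comps_rest) auto
  also have "{V. V \<subseteq> ?U \<and> card V \<in> {..N}} = Pow ?U"
    using card_mono[of ?U] by fastforce
  also have "(\<Sum>V\<in>Pow ?U. real (card V) * gex p (edges ?U) (\<lambda>G. of_bool (V \<in> comps ?U G))) =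
      gex p (edges ?U) (\<lambda>G. \<Sum>V\<in>Pow ?U. real (card V) * of_bool (V \<in> comps ?U G))"
    by (simp only: gex_sum gex_cmult)
  also have "\<dots> = gex p (edges ?U) (\<lambda>G. real N)"
  proof (rule gex_cong)
    fix G assume G: "G \<subseteq> edges ?U"
    have "(\<Sum>V\<in>Pow ?U. real (card V) * of_bool (V \<in> comps ?U G)) = (\<Sum>V\<in>comps ?U G. real (card V))"
      using comps_subset[OF G] by (intro sum.mono_neutral_cong_right) auto
    also have "\<dots> = real N"
      using sum_card_comps[OF _ G] by (simp flip: of_nat_sum)
    finally show "(\<Sum>V\<in>Pow ?U. real (card V) * of_bool (V \<in> comps ?U G)) = real N" .
  qed
  finally show ?thesis by (simp add: gex_const finite_edges)
qed

lemma ncomp_le: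
  assumes "0 \<le> p" "p \<le> 1"
  shows "real k * ncomp N k p \<le> real N"
proof (cases "k \<le> N")
  case True
  have "real k * ncomp N k p \<le> (\<Sum>k\<le>N. real k * ncomp N k p)"
    using True assms by (intro member_le_sum) (auto simp: ncomp_nonneg)
  then show ?thesis by (simp add: sum_ncomp assms)
qed (simp add: ncomp_def binomial_eq_0)

section \<open>Upper bounds for component counts\<close>

definition xlog :: "real \<Rightarrow> real" where
  "xlog x = x * ln x"

lemma xlog_0 [simp]: "xlog 0 = 0"
  by (simp add: xlog_def)

lemma continuous_on_xlog: "continuous_on {0..} xlog"
  unfolding continuous_on_def
proof
  fix x :: real assume x: "x \<in> {0..}"
  show "(xlog \<longlongrightarrow> xlog x) (at x within {0..})"
  proof (cases "x = 0")
    case True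
    have "((\<lambda>t::real. ln (inverse t) / inverse t) \<longlongrightarrow> 0) (at_right 0)"
      by (rule filterlim_compose[OF ln_x_over_x_tendsto_0 filterlim_inverse_at_top_right])
    then have "((\<lambda>t::real. - (ln (inverse t) / inverse t)) \<longlongrightarrow> - 0) (at_right 0)"
      by (rule tendsto_minus)
    moreover have "- (ln (inverse t) / inverse t) = xlog t" for t :: real
      by (simp add: xlog_def ln_inverse divide_inverse)
    ultimately show ?thesis using True by (simp add: at_within_Ici_at_right)
  next
    case False
    then have "isCont xlog x"
      using x unfolding xlog_def by (intro continuous_intros) auto
    then show ?thesis
      using continuous_at_imp_continuous_at_within continuous_within by blast
  qed
qed

lemma tendsto_xlog:
  assumes "(f \<longlongrightarrow> x) F" "\<forall>\<^sub>F a in F. f a \<ge> 0"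
  shows "((\<lambda>a. xlog (f a)) \<longlongrightarrow> xlog x) F"
proof (cases "F = bot")
  case False
  then have "x \<ge> 0" using tendsto_lowerbound assms by blast
  then show ?thesis
    using continuous_on_tendsto_compose[OF continuous_on_xlog assms(1)] assms(2) by simp
qed simp

text \<open>\<open>s\<close> may tend to infinity. The error of \<open>ln (1 + u)\<close> against
  \<open>u\<close> is at most \<open>2 * u\<^sup>2\<close>, and \<open>s * u\<^sup>2\<close> is the
  bounded \<open>s * u\<close> times the vanishing \<open>u\<close>.\<close>

lemma n_ln_one_plus:
  assumes u: "(u \<longlongrightarrow> (0::real)) F" and nu: "((\<lambda>a. s a * u a) \<longlongrightarrow> d) F"
  shows "((\<lambda>a. s a * ln (1 + u a)) \<longlongrightarrow> d) F"
proof -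
  have "\<forall>\<^sub>F a in F. norm (s a * ln (1 + u a) - s a * u a) \<le> 2 * \<bar>(s a * u a) * u a\<bar>"
  proof -
    have "\<forall>\<^sub>F a in F. \<bar>u a\<bar> \<le> 1 / 2"
      using tendstoD[OF u, of "1 / 2"] by (auto elim: eventually_mono)
    then show ?thesis
    proof eventually_elim
      case (elim a)
      have "\<bar>ln (1 + u a) - u a\<bar> \<le> 2 * (u a)\<^sup>2"
        using elim by (rule abs_ln_one_plus_x_minus_x_bound)
      then have "\<bar>s a\<bar> * \<bar>ln (1 + u a) - u a\<bar> \<le> \<bar>s a\<bar> * (2 * (u a)\<^sup>2)"
        by (intro mult_left_mono) auto
      then show ?case by (simp add: abs_mult power2_eq_square flip: right_diff_distrib)
    qed
  qed
  moreover have "((\<lambda>a. 2 * \<bar>(s a * u a) * u a\<bar>) \<longlongrightarrow> 2 * \<bar>d * 0\<bar>) F"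
    by (intro tendsto_intros u nu)
  then have "((\<lambda>a. 2 * \<bar>(s a * u a) * u a\<bar>) \<longlongrightarrow> 0) F" by simp
  ultimately have "((\<lambda>a. s a * ln (1 + u a) - s a * u a) \<longlongrightarrow> 0) F"
    by (rule Lim_null_comparison)
  from tendsto_add[OF this nu] show ?thesis by simp
qed

section \<open>The equation for the size of the giant component\<close>

lemma exp_gt_one_plus:
  fixes z :: real
  assumes "z \<noteq> 0"
  shows "1 + z < exp z"
proof (cases "1 + z / 2 \<ge> 0")
  case True
  have "1 + z < 1 + z + (z / 2)\<^sup>2" using assms by simp
  also have "\<dots> = (1 + z / 2)\<^sup>2" by (simp add: power2_eq_square algebra_simps)
  also have "\<dots> \<le> (exp (z / 2))\<^sup>2" using True by (intro power_mono exp_ge_add_one_self)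
  also have "\<dots> = exp z" by (simp flip: exp_double)
  finally show ?thesis .
next
  case False
  then have "1 + z < 0" by simp
  then show ?thesis using exp_gt_zero[of z] by linarith
qed

text \<open>Strict convexity of \<open>exp (- (c * t))\<close> on the interval from 0 to
  \<open>v\<close>: the tangent at \<open>t\<close> lies below the curve at both ends, strictly at
  0, and the value at \<open>t\<close> is the corresponding convex combination of the tangent's end
  values.\<close>

lemma exp_chord:
  fixes t v b :: real
  assumes "0 < t" "t < v" "c > 0"
  shows "exp (- (c * t)) < 1 - t / v * (1 - exp (- (c * v)))"
proof -
  have "exp (- (c * t)) * (1 + c * t) < exp (- (c * t)) * exp (c * t)"
    using assms exp_gt_one_plus[of "c * t"] by simp
  then have 1: "exp (- (c * t)) * (1 + c * t) < 1" by (simp flip: exp_add)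
  have "exp (- (c * t)) * (1 + (c * t - c * v)) \<le> exp (- (c * t)) * exp (c * t - c * v)"
    by (intro mult_left_mono) auto
  then have 2: "exp (- (c * t)) * (1 + (c * t - c * v)) \<le> exp (- (c * v))" by (simp flip: exp_add)
  have r: "0 < t / v" "t / v < 1" using assms by auto
  have "exp (- (c * t)) = (1 - t / v) * (exp (- (c * t)) * (1 + c * t)) +
      t / v * (exp (- (c * t)) * (1 + (c * t - c * v)))"
    using assms by (simp add: field_simps)
  also have "\<dots> < (1 - t / v) * 1 + t / v * exp (- (c * v))"
    using r 1 2 by (intro add_less_le_mono mult_strict_left_mono mult_left_mono) auto
  finally show ?thesis by (simp add: algebra_simps)
qed

text \<open>Strictly between 0 and its positive fixed point \<open>v\<close>, the concave map from
  \<open>t\<close> to \<open>y * (1 - exp (- (c * t)))\<close> exceeds \<open>t\<close>.\<close>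

lemma exp_below_root:
  fixes t v y c :: real
  assumes "0 < t" "t < v" "c > 0" "v = y * (1 - exp (- (c * v)))"
  shows "y * exp (- (c * t)) < y - t"
proof -
  have pos: "1 - exp (- (c * v)) > 0" using assms by simp
  then have y: "y > 0" using assms by (metis zero_less_mult_pos2 less_trans)
  have "y * exp (- (c * t)) < y * (1 - t / v * (1 - exp (- (c * v))))"
    using exp_chord[OF assms(1-3)] y by simp
  also have "\<dots> = y - t / v * (y * (1 - exp (- (c * v))))" by (simp add: algebra_simps)
  also have "\<dots> = y - t" using assms by simp
  finally show ?thesis .
qed

text \<open>The smaller of two positive roots would lie strictly between 0 and the larger one, where
  \<open>exp_below_root\<close> excludes roots.\<close>

lemma root_unique:
  fixes v v' y c :: real
  assumes "0 < v" "0 < v'" "c > 0" "v = y * (1 - exp (- (c * v)))" "v' = y * (1 - exp (- (c * v')))"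
  shows "v = v'"
proof (rule ccontr)
  assume "v \<noteq> v'"
  then consider "v < v'" | "v' < v" by linarith
  then show False
  proof cases
    case 1
    from exp_below_root[OF assms(1) 1 assms(3,5)] assms(4) show False by (simp add: algebra_simps)
  next
    case 2
    from exp_below_root[OF assms(2) 2 assms(3,4)] assms(5) show False by (simp add: algebra_simps)
  qed
qed

text \<open>The equality case of \<open>rate_neg\<close>: for this \<open>w\<close> the number
  \<open>x\<close> is the giant fraction on \<open>w n\<close> vertices. Then
  \<open>w - x = w * exp (- (c * x))\<close>, so \<open>ln (w - x)\<close> is
  \<open>ln w - c * x\<close> and the logarithms collapse.\<close>

lemma dual_rate:
  assumes x: "x > 0" and c: "c > 0"
  defines "\<theta> \<equiv> 1 - exp (- (c * x))"
  defines "w \<equiv> x / \<theta>"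
  shows "xlog w - xlog x - xlog (w - x) - c * x * (w - x) = - (x * ln \<theta>)"
proof -
  have th: "\<theta> > 0" using x c by (simp add: \<theta>_def)
  have w: "w > 0" using th x by (simp add: w_def)
  have e: "w - x = w * exp (- (c * x))"
  proof -
    have "x = w * \<theta>" using th by (simp add: w_def)
    then show ?thesis by (simp add: \<theta>_def algebra_simps)
  qed
  have d: "xlog (w - x) = (w - x) * (ln w - c * x)"
    unfolding xlog_def e using w by (simp add: ln_mult)
  have t: "ln \<theta> = ln x - ln w" using x th by (simp add: w_def ln_div)
  show ?thesis unfolding d t xlog_def[of w] xlog_def[of x] by (simp add: algebra_simps)
qed

text \<open>
  The left-hand side is \<open>- y\<close> times the relative entropy of the Bernoulli law with parameter
  \<open>x / y\<close> with respect to the one with parameter \<open>1 - exp (- (c * x))\<close>.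
\<close>

lemma rate_neg:
  fixes c x y :: real
  assumes c: "c > 0" and x: "x > 0" and xy: "x \<le> y" and ne: "x \<noteq> y * (1 - exp (- (c * x)))"
  shows "xlog y - xlog x - xlog (y - x) - c * x * (y - x) + x * ln (1 - exp (- (c * x))) < 0"
proof -
  define \<theta> where "\<theta> = 1 - exp (- (c * x))"
  have th: "0 < \<theta>" "\<theta> < 1" using x c by (auto simp: \<theta>_def)
  show ?thesis
  proof (cases "x = y")
    case True
    have "x * ln \<theta> < 0" using th x by (intro mult_pos_neg) auto
    then show ?thesis using True by (simp add: \<theta>_def)
  next
    case False
    then have y: "y - x > 0" "y > 0" using xy x by auto
    \<comment> \<open>With \<open>\<theta>\<close> the Bernoulli parameter, \<open>s\<close> and
      \<open>r\<close> are the likelihood ratios of \<open>\<theta>\<close> to \<open>x / y\<close>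
      and of \<open>1 - \<theta>\<close> to \<open>1 - x / y\<close>. The bounds from
      \<open>ln t \<le> t - 1\<close>, strict at \<open>s\<close>, add up to 0.\<close>
    define s where "s = y * \<theta> / x"
    have s: "s > 0" "s \<noteq> 1" using y th x ne by (auto simp: s_def \<theta>_def)
    then have "ln s < s - 1" using ln_eq_minus_one[of s] ln_le_minus_one[of s] by fastforce
    then have 1: "x * ln s < x * (s - 1)" using x by simp
    define r where "r = y * exp (- (c * x)) / (y - x)"
    have r: "r > 0" using y by (simp add: r_def)
    then have 2: "(y - x) * ln r \<le> (y - x) * (r - 1)"
      using y ln_le_minus_one[of r] by simp
    have "xlog y - xlog x - xlog (y - x) - c * x * (y - x) + x * ln \<theta> = x * ln s + (y - x) * ln r"
      unfolding xlog_def s_def r_def using x y th by (simp add: ln_div ln_mult algebra_simps)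
    also have "\<dots> < x * (s - 1) + (y - x) * (r - 1)" using 1 2 by simp
    also have "\<dots> = y * \<theta> - x + y * exp (- (c * x)) - (y - x)"
      using x y by (simp add: s_def r_def right_diff_distrib)
    also have "\<dots> = 0" by (simp add: \<theta>_def algebra_simps)
    finally show ?thesis by (simp add: \<theta>_def)
  qed
qed

section \<open>Logarithms of factorials\<close>

lemma ln_fact_bounds:
  assumes "k \<ge> 1"
  shows "xlog (real k) - real k \<le> ln (fact k)"
    and "ln (fact k) \<le> xlog (real k) - real k + 1 + ln (real k)"
proof -
  have "xlog (real k) - real k \<le> ln (fact k) \<and> ln (fact k) \<le> xlog (real k) - real k + 1 + ln (real k)"
    using assms
  proof (induction k rule: dec_induct)
    case (step k)
    then have k: "real k > 0" by simp
    have l: "ln (real (Suc k)) = ln (real k) + ln (1 + 1 / real k)"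
    proof -
      have "real (Suc k) = real k * (1 + 1 / real k)" using k by (simp add: field_simps)
      moreover have "1 + 1 / real k > 0" using k by (simp add: add_pos_pos)
      ultimately show ?thesis using k by (simp add: ln_mult)
    qed
    \<comment> \<open>The two bounds follow inductively from
      \<open>k * ln (1 + 1 / k) \<le> 1 \<le> (k + 1) * ln (1 + 1 / k)\<close>. Their gap of order
      \<open>ln k\<close> vanishes after division by \<open>n\<close>.\<close>
    have up: "real k * ln (1 + 1 / real k) \<le> 1"
    proof -
      have "ln (1 + 1 / real k) \<le> 1 / real k" using k by (intro ln_add_one_self_le_self) auto
      then have "real k * ln (1 + 1 / real k) \<le> real k * (1 / real k)" by (intro mult_left_mono) auto
      then show ?thesis using k by simp
    qed
    have lo: "(real k + 1) * ln (1 + 1 / real k) \<ge> 1"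
    proof -
      have "ln (real k / (real k + 1)) \<le> real k / (real k + 1) - 1"
        using k by (intro ln_le_minus_one) auto
      moreover have "ln (real k / (real k + 1)) = - ln (1 + 1 / real k)"
        using k by (subst ln_inverse[symmetric]) (auto simp: field_simps)
      ultimately have "ln (1 + 1 / real k) \<ge> 1 - real k / (real k + 1)" by linarith
      also have "1 - real k / (real k + 1) = 1 / (real k + 1)" using k by (simp add: field_simps)
      finally have "(real k + 1) * ln (1 + 1 / real k) \<ge> (real k + 1) * (1 / (real k + 1))"
        by (intro mult_left_mono) auto
      then show ?thesis using k by simp
    qed
    have f: "ln (fact (Suc k)) = ln (real (Suc k)) + ln (fact k :: real)"
      by (simp add: ln_mult del: of_nat_Suc)
    have "xlog (real (Suc k)) = real k * ln (real k) + real k * ln (1 + 1 / real k) + ln (real (Suc k))"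
      unfolding xlog_def using l by (simp add: algebra_simps)
    then have 1: "xlog (real (Suc k)) - real (Suc k) \<le> ln (fact (Suc k))"
      using step.IH up unfolding f xlog_def by simp
    have "xlog (real (Suc k)) + ln (real (Suc k)) = real k * ln (real k) + ln (real k)
        + (real k + 1) * ln (1 + 1 / real k) + ln (real (Suc k))"
      unfolding xlog_def using l by (simp add: algebra_simps)
    then have 2: "ln (fact (Suc k)) \<le> xlog (real (Suc k)) - real (Suc k) + 1 + ln (real (Suc k))"
      using step.IH lo unfolding f xlog_def by simp
    show ?case using 1 2 by blast
  qed (simp add: xlog_def)
  then show "xlog (real k) - real k \<le> ln (fact k)"
    "ln (fact k) \<le> xlog (real k) - real k + 1 + ln (real k)" by auto
qed

section \<open>Asymptotics along an arbitrary filter\<close>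

context
  fixes F :: "'a filter" and n :: "'a \<Rightarrow> nat"
  assumes n: "filterlim n at_top F"
begin

lemma n_at_top: "filterlim (\<lambda>a. real (n a)) at_top F"
  by (rule filterlim_compose[OF filterlim_real_sequentially n])

lemma ev_n_ge: "\<forall>\<^sub>F a in F. n a \<ge> m"
  by (rule eventually_compose_filterlim[OF eventually_ge_at_top n])

lemma ev_n_real_ge: "\<forall>\<^sub>F a in F. real (n a) \<ge> B"
  by (rule eventually_compose_filterlim[OF eventually_ge_at_top n_at_top])

lemma inverse_n: "((\<lambda>a. 1 / real (n a)) \<longlongrightarrow> 0) F"
  using tendsto_inverse_0_at_top[OF n_at_top] by (simp add: divide_inverse)

lemma ln_n_over_n: "((\<lambda>a. ln (real (n a)) / real (n a)) \<longlongrightarrow> 0) F"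
  by (rule filterlim_compose[OF lim_ln_over_n n])

lemma tendsto_nat_ceiling:
  assumes "((\<lambda>a. s a / real (n a)) \<longlongrightarrow> w) F" "\<And>a. s a \<ge> 0"
  shows "((\<lambda>a. real (nat \<lceil>s a\<rceil>) / real (n a)) \<longlongrightarrow> w) F"
proof (rule tendsto_sandwich)
  have "s a \<le> real (nat \<lceil>s a\<rceil>) \<and> real (nat \<lceil>s a\<rceil>) \<le> s a + 1" for a
    using assms(2)[of a] by linarith
  then have "s a / real (n a) \<le> real (nat \<lceil>s a\<rceil>) / real (n a)"
    "real (nat \<lceil>s a\<rceil>) / real (n a) \<le> s a / real (n a) + 1 / real (n a)" for a
    by (auto simp flip: add_divide_distrib intro!: divide_right_mono)
  then show "\<forall>\<^sub>F a in F. s a / real (n a) \<le> real (nat \<lceil>s a\<rceil>) / real (n a)"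
    "\<forall>\<^sub>F a in F. real (nat \<lceil>s a\<rceil>) / real (n a) \<le> s a / real (n a) + 1 / real (n a)"
    by (auto intro: always_eventually)
  show "((\<lambda>a. s a / real (n a) + 1 / real (n a)) \<longlongrightarrow> w) F"
    using tendsto_add[OF assms(1) inverse_n] by simp
qed (rule assms)

lemma ln_k_over_n:
  assumes "((\<lambda>a. real (k a) / real (n a)) \<longlongrightarrow> x) F" "x > 0"
  shows "((\<lambda>a. ln (real (k a)) / real (n a)) \<longlongrightarrow> 0) F"
proof (rule Lim_transform_eventually)
  have "((\<lambda>a. ln (real (k a) / real (n a)) * (1 / real (n a)) + ln (real (n a)) / real (n a))
      \<longlongrightarrow> ln x * 0 + 0) F"
    using assms by (intro tendsto_intros inverse_n ln_n_over_n) auto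
  then show "((\<lambda>a. ln (real (k a) / real (n a)) * (1 / real (n a)) + ln (real (n a)) / real (n a))
      \<longlongrightarrow> 0) F" by simp
  show "\<forall>\<^sub>F a in F. ln (real (k a) / real (n a)) * (1 / real (n a)) + ln (real (n a)) / real (n a)
      = ln (real (k a)) / real (n a)"
    using order_tendstoD(1)[OF assms] ev_n_ge[of 1]
    by eventually_elim (auto simp: ln_div diff_divide_distrib zero_less_divide_iff)
qed

lemma ev_k_ge:
  assumes "((\<lambda>a. real (k a) / real (n a)) \<longlongrightarrow> x) F" "x > 0"
  shows "\<forall>\<^sub>F a in F. k a \<ge> 1"
  using order_tendstoD(1)[OF assms]
  by eventually_elim (auto simp: zero_less_divide_iff)

lemma exp_decay_square: "b > 0 \<Longrightarrow> ((\<lambda>a. (real (n a))\<^sup>2 * exp (- (b * real (n a)))) \<longlongrightarrow> 0) F"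
proof -
  assume b: "b > 0"
  have "((\<lambda>a. 1 / b\<^sup>2 * ((b * real (n a)) ^ 2 / exp (b * real (n a)))) \<longlongrightarrow> 1 / b\<^sup>2 * 0) F"
    using b by (intro tendsto_intros filterlim_compose[OF tendsto_power_div_exp_0]
        filterlim_tendsto_pos_mult_at_top[OF tendsto_const _ n_at_top])
  then show ?thesis
    using b by (simp add: exp_minus field_simps power_mult_distrib)
qed

lemma exp_decay: "b > 0 \<Longrightarrow> ((\<lambda>a. exp (- (b * real (n a)))) \<longlongrightarrow> 0) F"
proof -
  assume b: "b > 0"
  have "filterlim (\<lambda>a. b * real (n a)) at_top F"
    by (rule filterlim_tendsto_pos_mult_at_top[OF tendsto_const b n_at_top])
  then have "filterlim (\<lambda>a. - (b * real (n a))) at_bot F"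
    by (simp add: filterlim_uminus_at_top)
  then show ?thesis by (rule filterlim_compose[OF exp_at_bot])
qed

text \<open>The subtracted multiple of \<open>ln n\<close> is what \<open>ln k\<close> contributes
  beyond \<open>ln (k / n)\<close>. It is proportional to \<open>k\<close>, so it cancels in every
  binomial or multinomial coefficient.\<close>

lemma ln_fact_asymp:
  assumes k: "((\<lambda>a. real (k a) / real (n a)) \<longlongrightarrow> x) F"
  shows "((\<lambda>a. ln (fact (k a)) / real (n a) - real (k a) / real (n a) * ln (real (n a))) \<longlongrightarrow> xlog x - x) F"
proof (cases "F = bot")
  case False
  have x: "x \<ge> 0" by (rule tendsto_lowerbound[OF k _ False]) simp
  define err where "err a = ln (fact (k a)) - (xlog (real (k a)) - real (k a))" for a
  \<comment> \<open>The case \<open>x = 0\<close> is covered, so \<open>k a = 0\<close> can occur;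
    there the error is 0 because \<open>ln (fact 0)\<close> and \<open>xlog 0\<close> are.\<close>
  have err0: "0 \<le> err a / real (n a)" for a
    using ln_fact_bounds(1)[of "k a"] by (cases "k a = 0") (auto simp: err_def)
  have err1: "\<forall>\<^sub>F a in F. err a / real (n a) \<le> (1 + ln (x + 1)) * (1 / real (n a)) + ln (real (n a)) / real (n a)"
    using order_tendstoD(2)[OF k less_add_one] ev_n_ge[of 1]
  proof eventually_elim
    case (elim a)
    have "err a \<le> 1 + ln (x + 1) + ln (real (n a))"
    proof (cases "k a = 0")
      case True
      then show ?thesis using x elim by (auto simp: err_def)
    next
      case False
      have "err a \<le> 1 + ln (real (k a))"
        using ln_fact_bounds(2)[of "k a"] False by (auto simp: err_def)
      also have "real (k a) \<le> (x + 1) * real (n a)" using elim by (auto simp: field_simps)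
      then have "ln (real (k a)) \<le> ln ((x + 1) * real (n a))" using False by simp
      also have "\<dots> = ln (x + 1) + ln (real (n a))" using x elim by (subst ln_mult) auto
      finally show ?thesis by simp
    qed
    then have "err a / real (n a) \<le> (1 + ln (x + 1) + ln (real (n a))) / real (n a)"
      by (rule divide_right_mono) simp
    then show ?case by (simp add: add_divide_distrib)
  qed
  have "((\<lambda>a. (1 + ln (x + 1)) * (1 / real (n a)) + ln (real (n a)) / real (n a)) \<longlongrightarrow> (1 + ln (x + 1)) * 0 + 0) F"
    by (intro tendsto_intros inverse_n ln_n_over_n)
  then have err: "((\<lambda>a. err a / real (n a)) \<longlongrightarrow> 0) F"
    using err0 err1 by (intro tendsto_sandwich[OF _ err1 tendsto_const]) auto
  show ?thesis
  proof (rule Lim_transform_eventually)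
    show "((\<lambda>a. xlog (real (k a) / real (n a)) - real (k a) / real (n a) + err a / real (n a)) \<longlongrightarrow> xlog x - x) F"
      using tendsto_add[OF tendsto_diff[OF tendsto_xlog[OF k] k] err] by simp
    show "\<forall>\<^sub>F a in F. xlog (real (k a) / real (n a)) - real (k a) / real (n a) + err a / real (n a)
        = ln (fact (k a)) / real (n a) - real (k a) / real (n a) * ln (real (n a))"
      using ev_n_ge[of 1]
    proof eventually_elim
      case (elim a)
      then show ?case
        by (cases "k a = 0") (auto simp: err_def xlog_def ln_div field_simps)
    qed
  qed
qed simp

lemma ln_binomial_asymp:
  assumes k: "((\<lambda>a. real (k a) / real (n a)) \<longlongrightarrow> x) F"
    and N: "((\<lambda>a. real (N a) / real (n a)) \<longlongrightarrow> y) F"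
    and le: "\<forall>\<^sub>F a in F. k a \<le> N a"
  shows "((\<lambda>a. ln (real (N a choose k a)) / real (n a)) \<longlongrightarrow> xlog y - xlog x - xlog (y - x)) F"
proof -
  have d: "((\<lambda>a. real (N a - k a) / real (n a)) \<longlongrightarrow> y - x) F"
  proof (rule Lim_transform_eventually[OF tendsto_diff[OF N k]])
    show "\<forall>\<^sub>F a in F. real (N a) / real (n a) - real (k a) / real (n a) = real (N a - k a) / real (n a)"
      using le by eventually_elim (simp add: of_nat_diff diff_divide_distrib)
  qed
  define f where "f j a = ln (fact (j a)) / real (n a) - real (j a) / real (n a) * ln (real (n a))"
    for j and a :: 'a
  have "((\<lambda>a. f N a - f k a - f (\<lambda>a. N a - k a) a) \<longlongrightarrow>
      (xlog y - y) - (xlog x - x) - (xlog (y - x) - (y - x))) F"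
    unfolding f_def by (intro tendsto_diff ln_fact_asymp N k d)
  then have "((\<lambda>a. f N a - f k a - f (\<lambda>a. N a - k a) a) \<longlongrightarrow> xlog y - xlog x - xlog (y - x)) F"
    by (simp add: algebra_simps)
  then show ?thesis
  proof (rule Lim_transform_eventually)
    show "\<forall>\<^sub>F a in F. f N a - f k a - f (\<lambda>a. N a - k a) a = ln (real (N a choose k a)) / real (n a)"
      using le ev_n_ge[of 1]
    proof eventually_elim
      case (elim a)
      have "real (N a choose k a) = fact (N a) / (fact (k a) * fact (N a - k a))"
        using elim by (intro binomial_fact)
      then have "ln (real (N a choose k a)) = ln (fact (N a)) - ln (fact (k a)) - ln (fact (N a - k a))"
        by (simp add: ln_div ln_mult)
      moreover have "real (N a - k a) = real (N a) - real (k a)" using elim by simp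
      ultimately show ?case using elim by (simp add: f_def diff_divide_distrib left_diff_distrib)
    qed
  qed
qed

context
  fixes p :: "'a \<Rightarrow> real" and c :: real
  assumes pc: "((\<lambda>a. real (n a) * p a) \<longlongrightarrow> c) F" and c: "c > 0"
begin

lemma p_tendsto_0: "(p \<longlongrightarrow> 0) F"
proof (rule Lim_transform_eventually)
  show "((\<lambda>a. (real (n a) * p a) * (1 / real (n a))) \<longlongrightarrow> 0) F"
    using tendsto_mult[OF pc inverse_n] by simp
  show "\<forall>\<^sub>F a in F. (real (n a) * p a) * (1 / real (n a)) = p a"
    using ev_n_ge[of 1] by eventually_elim simp
qed

lemma ev_p_pos: "\<forall>\<^sub>F a in F. 0 < p a"
  using order_tendstoD(1)[OF pc c] by eventually_elim (auto simp: zero_less_mult_iff)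

lemma ev_p_less: "b > 0 \<Longrightarrow> \<forall>\<^sub>F a in F. p a < b"
  using order_tendstoD(2)[OF p_tendsto_0] .

lemma ln_one_minus_p: "((\<lambda>a. real (n a) * ln (1 - p a)) \<longlongrightarrow> - c) F"
proof -
  have "((\<lambda>a. real (n a) * - p a) \<longlongrightarrow> - c) F" using tendsto_minus[OF pc] by simp
  from n_ln_one_plus[OF _ this] show ?thesis using tendsto_minus[OF p_tendsto_0] by simp
qed

lemma ln_non_edges:
  assumes k: "((\<lambda>a. real (k a) / real (n a)) \<longlongrightarrow> x) F"
  shows "((\<lambda>a. real (k a) * ln (1 - p a)) \<longlongrightarrow> - (c * x)) F"
proof (rule Lim_transform_eventually)
  show "((\<lambda>a. real (k a) / real (n a) * (real (n a) * ln (1 - p a))) \<longlongrightarrow> - (c * x)) F"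
    using tendsto_mult[OF k ln_one_minus_p] by (simp add: mult_ac)
  show "\<forall>\<^sub>F a in F. real (k a) / real (n a) * (real (n a) * ln (1 - p a)) = real (k a) * ln (1 - p a)"
    using ev_n_ge[of 1] by eventually_elim simp
qed

lemma pow_non_edges:
  assumes k: "((\<lambda>a. real (k a) / real (n a)) \<longlongrightarrow> x) F"
  shows "((\<lambda>a. (1 - p a) ^ k a) \<longlongrightarrow> exp (- (c * x))) F"
proof (rule Lim_transform_eventually[OF tendsto_exp[OF ln_non_edges[OF k]]])
  show "\<forall>\<^sub>F a in F. exp (real (k a) * ln (1 - p a)) = (1 - p a) ^ k a"
    using ev_p_less[OF zero_less_one] by eventually_elim (auto simp: exp_of_nat_mult)
qed

text \<open>The rate of the expected number of \<open>k\<close>-sets without an edge to the other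
  vertices. The factor of \<open>ncomp\<close> that is left is the connection probability.\<close>

lemma ln_cut_asymp:
  assumes k: "((\<lambda>a. real (k a) / real (n a)) \<longlongrightarrow> x) F"
    and N: "((\<lambda>a. real (N a) / real (n a)) \<longlongrightarrow> y) F"
    and le: "\<forall>\<^sub>F a in F. k a \<le> N a"
  shows "((\<lambda>a. (ln (real (N a choose k a)) + real (k a) * (real (N a) - real (k a)) * ln (1 - p a)) / real (n a))
    \<longlongrightarrow> xlog y - xlog x - xlog (y - x) - c * x * (y - x)) F"
proof -
  have "((\<lambda>a. ln (real (N a choose k a)) / real (n a) +
      real (k a) * ln (1 - p a) * (real (N a) / real (n a) - real (k a) / real (n a)))
      \<longlongrightarrow> (xlog y - xlog x - xlog (y - x)) + - (c * x) * (y - x)) F"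
    by (intro tendsto_intros ln_binomial_asymp ln_non_edges assms)
  then show ?thesis by (simp add: add_divide_distrib diff_divide_distrib algebra_simps)
qed

text \<open>
  Components of size \<open>k\<close> occupy at most \<open>M\<close> vertices on average, whatever \<open>M\<close> is. The bound is
  sharp on the exponential scale if \<open>k\<close> is the typical size of the giant component on \<open>M\<close>
  vertices, that is, for \<open>M = k / (1 - exp (- (c * x)))\<close>.
\<close>

lemma pconn_upper:
  assumes k: "((\<lambda>a. real (k a) / real (n a)) \<longlongrightarrow> x) F" and x: "x > 0"
    and b: "x * ln (1 - exp (- (c * x))) < b"
  shows "\<forall>\<^sub>F a in F. ln (pconn (k a) (p a)) / real (n a) < b"
proof -
  define \<theta> where "\<theta> = 1 - exp (- (c * x))"
  have th: "0 < \<theta>" "\<theta> < 1" using x c by (auto simp: \<theta>_def)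
  define w where "w = x / \<theta>"
  have w: "w > 0" using th x by (simp add: w_def)
  define M where "M a = nat \<lceil>real (k a) / \<theta>\<rceil>" for a
  have "((\<lambda>a. real (k a) / real (n a) / \<theta>) \<longlongrightarrow> w) F"
    unfolding w_def using th by (intro tendsto_intros k) auto
  then have M: "((\<lambda>a. real (M a) / real (n a)) \<longlongrightarrow> w) F"
    unfolding M_def using th by (intro tendsto_nat_ceiling) (auto simp: mult_ac)
  have kM: "k a \<le> M a" for a
  proof -
    have "real (k a) * \<theta> \<le> real (k a) * 1" using th by (intro mult_left_mono) auto
    then have "real (k a) \<le> real (k a) / \<theta>" using th by (simp add: field_simps)
    then show ?thesis unfolding M_def by linarith
  qed
  have "((\<lambda>a. ln (real (M a)) / real (n a) - ln (real (k a)) / real (n a) -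
      (ln (real (M a choose k a)) + real (k a) * (real (M a) - real (k a)) * ln (1 - p a)) / real (n a))
      \<longlongrightarrow> 0 - 0 - (xlog w - xlog x - xlog (w - x) - c * x * (w - x))) F"
    by (intro tendsto_diff ln_k_over_n[OF M w] ln_k_over_n[OF k x] ln_cut_asymp k M always_eventually allI kM)
  also have "0 - 0 - (xlog w - xlog x - xlog (w - x) - c * x * (w - x)) = x * ln \<theta>"
    using dual_rate[OF x c] by (simp add: w_def \<theta>_def)
  finally have "\<forall>\<^sub>F a in F. ln (real (M a)) / real (n a) - ln (real (k a)) / real (n a) -
      (ln (real (M a choose k a)) + real (k a) * (real (M a) - real (k a)) * ln (1 - p a)) / real (n a) < b"
    using order_tendstoD(2) b unfolding \<theta>_def by blast
  then show ?thesis
    using ev_k_ge[OF k x] ev_p_pos ev_p_less[OF zero_less_one]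
  proof eventually_elim
    case (elim a)
    have pconn: "pconn (k a) (p a) > 0" using elim by (intro pconn_pos) auto
    have C: "real (M a choose k a) > 0" using kM by simp
    have "real (k a) * ncomp (M a) (k a) (p a) \<le> real (M a)" using elim by (intro ncomp_le) auto
    then have "ln (real (k a) * ncomp (M a) (k a) (p a)) \<le> ln (real (M a))"
      using elim pconn C kM[of a] by (subst ln_le_cancel_iff) (auto simp: ncomp_def)
    moreover have "ln (real (k a) * ncomp (M a) (k a) (p a)) = ln (real (k a)) + ln (real (M a choose k a)) +
        ln (pconn (k a) (p a)) + real (k a) * (real (M a) - real (k a)) * ln (1 - p a)"
      using elim pconn C kM[of a] by (simp add: ncomp_def ln_mult ln_realpow of_nat_diff)
    ultimately have "ln (pconn (k a) (p a)) \<le> ln (real (M a)) - ln (real (k a)) -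
       (ln (real (M a choose k a)) + real (k a) * (real (M a) - real (k a)) * ln (1 - p a))" by simp
    then have "ln (pconn (k a) (p a)) / real (n a) \<le> (ln (real (M a)) - ln (real (k a)) -
       (ln (real (M a choose k a)) + real (k a) * (real (M a) - real (k a)) * ln (1 - p a))) / real (n a)"
      by (intro divide_right_mono) auto
    then show ?case using elim by (simp add: diff_divide_distrib)
  qed
qed

text \<open>The upper bound on the connection probability makes the total rate that of
  \<open>rate_neg\<close>, negative unless \<open>x\<close> is the giant fraction on
  \<open>y n\<close> vertices. The factor \<open>n\<^sup>2\<close> pays for summing
  \<open>k * ncomp\<close> over the sizes, up to a bounded factor.\<close>

lemma ncomp_decay:
  assumes k: "((\<lambda>a. real (k a) / real (n a)) \<longlongrightarrow> x) F" and x: "x > 0"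
    and N: "((\<lambda>a. real (N a) / real (n a)) \<longlongrightarrow> y) F"
    and le: "\<forall>\<^sub>F a in F. k a \<le> N a"
    and ne: "x \<noteq> y * (1 - exp (- (c * x)))"
  shows "((\<lambda>a. (real (n a))\<^sup>2 * ncomp (N a) (k a) (p a)) \<longlongrightarrow> 0) F"
proof (cases "F = bot")
  case False
  have "\<forall>\<^sub>F a in F. real (k a) / real (n a) \<le> real (N a) / real (n a)"
    using le by eventually_elim (simp add: divide_right_mono)
  then have xy: "x \<le> y" by (rule tendsto_le[OF False N k])
  define R where "R = xlog y - xlog x - xlog (y - x) - c * x * (y - x)"
  \<comment> \<open>The total rate is \<open>- 4 * b\<close>. An error \<open>b\<close> in each of
    the two factors leaves \<open>- 2 * b\<close>.\<close>
  define b where "b = - (R + x * ln (1 - exp (- (c * x)))) / 4"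
  have b: "b > 0" using rate_neg[OF c x xy ne] by (simp add: b_def R_def)
  have "\<forall>\<^sub>F a in F. (ln (real (N a choose k a)) + real (k a) * (real (N a) - real (k a)) * ln (1 - p a)) / real (n a) < R + b"
    using order_tendstoD(2)[OF ln_cut_asymp[OF k N le], of "R + b"] b by (simp add: R_def)
  moreover have "\<forall>\<^sub>F a in F. ln (pconn (k a) (p a)) / real (n a) < - R - 3 * b"
    using b by (intro pconn_upper[OF k x]) (auto simp: b_def field_simps)
  ultimately have "\<forall>\<^sub>F a in F. ncomp (N a) (k a) (p a) \<le> exp (- (b * real (n a)))"
    using ev_k_ge[OF k x] ev_p_pos ev_p_less[OF zero_less_one] le ev_n_ge[of 1]
  proof eventually_elim
    case (elim a)
    have pconn: "pconn (k a) (p a) > 0" using elim by (intro pconn_pos) auto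
    have C: "real (N a choose k a) > 0" using elim by simp
    have pos: "ncomp (N a) (k a) (p a) > 0" using elim pconn C by (simp add: ncomp_def)
    have "ln (ncomp (N a) (k a) (p a)) / real (n a) =
        (ln (real (N a choose k a)) + real (k a) * (real (N a) - real (k a)) * ln (1 - p a)) / real (n a)
        + ln (pconn (k a) (p a)) / real (n a)"
      using elim pconn C by (simp add: ncomp_def ln_mult ln_realpow of_nat_diff add_divide_distrib)
    also have "\<dots> < - 2 * b" using elim by simp
    also have "\<dots> < - b" using b by simp
    finally have "ln (ncomp (N a) (k a) (p a)) < - (b * real (n a))" using elim by (simp add: field_simps)
    then show ?case using pos by (metis exp_less_mono exp_ln less_imp_le)
  qed
  then have up: "\<forall>\<^sub>F a in F. (real (n a))\<^sup>2 * ncomp (N a) (k a) (p a) \<le> (real (n a))\<^sup>2 * exp (- (b * real (n a)))"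
    by eventually_elim (simp add: mult_left_mono)
  have "\<forall>\<^sub>F a in F. 0 \<le> (real (n a))\<^sup>2 * ncomp (N a) (k a) (p a)"
    using ev_p_pos ev_p_less[OF zero_less_one] by eventually_elim (simp add: ncomp_nonneg)
  then show ?thesis
    by (rule tendsto_sandwich[OF _ up tendsto_const exp_decay_square[OF b]])
qed simp

end

end

text \<open>Going from \<open>M\<close> to \<open>N\<close> vertices enlarges the binomial by the
  factors \<open>(N - i) / (M - i)\<close> for \<open>i < k\<close>, while each of the
  \<open>k\<close> vertices must avoid \<open>N - M\<close> more vertices, which costs
  \<open>(1 - p) ^ (N - M)\<close>. The hypothesis makes the cost outweigh the gain in each of the
  \<open>k\<close> factors.\<close>

lemma ncomp_le_ncomp:
  assumes p: "0 < p" "p < 1" and kM: "k \<le> M" "M \<le> N"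
    and le: "real N * (1 - p) ^ (N - M) \<le> real M - real k"
  shows "ncomp N k p \<le> ncomp M k p"
proof -
  define r where "r = (1 - p) ^ (N - M)"
  have r: "r \<ge> 0" using p by (simp add: r_def)
  have "real (N choose k) * r ^ k = (\<Prod>i<k. real (N - i) / real (k - i) * r)"
  proof -
    have "real (N choose k) = (\<Prod>i<k. real (N - i) / real (k - i))"
      using kM by (simp add: binomial_altdef_of_nat atLeast0LessThan)
    then show ?thesis by (simp only: prod.distrib prod_constant card_lessThan)
  qed
  also have "\<dots> \<le> (\<Prod>i<k. real (M - i) / real (k - i))"
  proof (rule prod_mono)
    fix i assume i: "i \<in> {..<k}"
    have "real (N - i) * r \<le> real N * r" using r by (intro mult_right_mono) auto
    also have "\<dots> \<le> real (M - i)" using le i kM by (simp add: r_def of_nat_diff)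
    finally have "real (N - i) * r / real (k - i) \<le> real (M - i) / real (k - i)"
      by (rule divide_right_mono) simp
    then show "0 \<le> real (N - i) / real (k - i) * r \<and> real (N - i) / real (k - i) * r \<le> real (M - i) / real (k - i)"
      using r by (simp add: mult_ac)
  qed
  also have "\<dots> = real (M choose k)"
    using kM by (simp add: binomial_altdef_of_nat atLeast0LessThan)
  finally have *: "real (N choose k) * r ^ k \<le> real (M choose k)" .
  have "k * (N - k) = k * (M - k) + (N - M) * k" using kM by (simp add: algebra_simps flip: distrib_left)
  then have "ncomp N k p = (real (N choose k) * r ^ k) * (pconn k p * (1 - p) ^ (k * (M - k)))"
    by (simp add: ncomp_def r_def power_add power_mult)
  also have "\<dots> \<le> real (M choose k) * (pconn k p * (1 - p) ^ (k * (M - k)))"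
    using * p pconn_nonneg[of p k] by (intro mult_right_mono) auto
  finally show ?thesis by (simp add: ncomp_def)
qed

section \<open>The exponential rate of the connection probability\<close>

text \<open>
  A property that holds eventually along this filter holds, for \<open>a\<close> far enough along \<open>F\<close>,
  uniformly in all \<open>b\<close> for which \<open>r a b\<close> is close to \<open>x\<close>.
\<close>

definition at_limit :: "'a filter \<Rightarrow> ('a \<Rightarrow> 'b \<Rightarrow> real) \<Rightarrow> real \<Rightarrow> ('a \<times> 'b) filter" where
  "at_limit F r x = inf (filtercomap fst F) (filtercomap (\<lambda>z. r (fst z) (snd z)) (nhds x))"

lemma filterlim_at_limit_fst: "filterlim f G F \<Longrightarrow> filterlim (\<lambda>z. f (fst z)) G (at_limit F r x)"
  unfolding at_limit_def
  by (rule filterlim_mono[OF filterlim_compose[OF _ filterlim_filtercomap] order_refl inf_le1])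

lemma tendsto_at_limit: "((\<lambda>z. r (fst z) (snd z)) \<longlongrightarrow> x) (at_limit F r x)"
  unfolding at_limit_def
  by (rule filterlim_mono[OF filterlim_filtercomap order_refl inf_le2])

lemma eventually_at_limitD:
  assumes "eventually Q (at_limit F r x)"
  obtains \<eta> where "\<eta> > 0" "\<forall>\<^sub>F a in F. \<forall>b. \<bar>r a b - x\<bar> \<le> \<eta> \<longrightarrow> Q (a, b)"
proof -
  obtain P S where P: "eventually P F" and S: "eventually S (nhds x)"
    and PS: "\<And>z. P (fst z) \<Longrightarrow> S (r (fst z) (snd z)) \<Longrightarrow> Q z"
    using assms unfolding at_limit_def eventually_inf eventually_filtercomap by blast
  obtain d where d: "d > 0" "\<And>t. dist t x < d \<Longrightarrow> S t"
    using S unfolding eventually_nhds_metric by blast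
  show ?thesis
  proof
    show "d / 2 > 0" using d by simp
    show "\<forall>\<^sub>F a in F. \<forall>b. \<bar>r a b - x\<bar> \<le> d / 2 \<longrightarrow> Q (a, b)"
      using P
    proof eventually_elim
      case (elim a)
      show ?case
      proof (intro allI impI)
        fix b assume "\<bar>r a b - x\<bar> \<le> d / 2"
        then have "dist (r a b) x < d" using d by (simp add: dist_real_def)
        then show "Q (a, b)" using d(2) elim PS[of "(a, b)"] by simp
      qed
    qed
  qed
qed

text \<open>Near each point of \<open>S\<close> the property holds from some index on; finitely many
  of these neighbourhoods cover \<open>S\<close>, and finitely many thresholds have a common
  one.\<close>

lemma eventually_compact:
  fixes r :: "'a \<Rightarrow> 'b \<Rightarrow> real"
  assumes S: "compact S" and Q: "\<And>x. x \<in> S \<Longrightarrow> eventually Q (at_limit F r x)"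
  shows "\<forall>\<^sub>F a in F. \<forall>b. r a b \<in> S \<longrightarrow> Q (a, b)"
proof -
  have "\<forall>x\<in>S. \<exists>\<eta>>0. \<forall>\<^sub>F a in F. \<forall>b. \<bar>r a b - x\<bar> \<le> \<eta> \<longrightarrow> Q (a, b)"
    using Q by (blast elim: eventually_at_limitD)
  then have "\<exists>\<eta>. \<forall>x\<in>S. \<eta> x > 0 \<and> (\<forall>\<^sub>F a in F. \<forall>b. \<bar>r a b - x\<bar> \<le> \<eta> x \<longrightarrow> Q (a, b))"
    by (rule bchoice)
  then obtain \<eta> where \<eta>: "\<And>x. x \<in> S \<Longrightarrow> \<eta> x > 0"
    "\<And>x. x \<in> S \<Longrightarrow> \<forall>\<^sub>F a in F. \<forall>b. \<bar>r a b - x\<bar> \<le> \<eta> x \<longrightarrow> Q (a, b)"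
    by blast
  have cover: "S \<subseteq> (\<Union>x\<in>S. ball x (\<eta> x))" using \<eta>(1) by force
  obtain T where T: "T \<subseteq> S" "finite T" "S \<subseteq> (\<Union>x\<in>T. ball x (\<eta> x))"
    by (rule compactE_image[OF S _ cover]) auto
  have "\<forall>\<^sub>F a in F. \<forall>x\<in>T. \<forall>b. \<bar>r a b - x\<bar> \<le> \<eta> x \<longrightarrow> Q (a, b)"
    using T \<eta>(2) by (intro eventually_ball_finite) auto
  then show ?thesis
  proof eventually_elim
    case (elim a)
    show ?case
    proof (intro allI impI)
      fix b assume "r a b \<in> S"
      then obtain x where x: "x \<in> T" "r a b \<in> ball x (\<eta> x)" using T by blast
      then have "\<bar>r a b - x\<bar> \<le> \<eta> x" by (simp add: dist_real_def abs_minus_commute)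
      then show "Q (a, b)" using elim x(1) by blast
    qed
  qed
qed

lemma tendsto_nat_ceiling_mult:
  assumes n: "filterlim n at_top F" and w: "w \<ge> 0"
  shows "((\<lambda>a. real (nat \<lceil>w * real (n a)\<rceil>) / real (n a)) \<longlongrightarrow> w) F"
proof (rule tendsto_nat_ceiling[OF n tendsto_eventually])
  show "\<forall>\<^sub>F a in F. w * real (n a) / real (n a) = w"
    using ev_n_ge[OF n, of 1] by eventually_elim simp
qed (use w in simp)

lemma eventually_less_of_tendsto:
  fixes f g :: "'a \<Rightarrow> real"
  assumes "(f \<longlongrightarrow> l) F" "(g \<longlongrightarrow> m) F" "l < m"
  shows "\<forall>\<^sub>F a in F. f a < g a"
proof -
  have "\<forall>\<^sub>F a in F. 0 < g a - f a"
    using assms(3) by (intro order_tendstoD(1)[OF tendsto_diff[OF assms(2,1)]]) simp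
  then show ?thesis by eventually_elim simp
qed

text \<open>Vertices are attached one by one; the later ones have even more possible neighbours, so
  each costs at most the same factor.\<close>

lemma pconn_add_ge:
  assumes p: "0 \<le> p" "p \<le> 1" and k: "k \<ge> 1"
  shows "pconn k p * (1 - (1 - p) ^ k) ^ j \<le> pconn (k + j) p"
proof (induction j)
  case (Suc j)
  have b: "0 \<le> 1 - (1 - p) ^ k" using p by (simp add: power_le_one)
  have mono: "1 - (1 - p) ^ k \<le> 1 - (1 - p) ^ (k + j)"
    using p by (simp add: power_decreasing)
  have "pconn k p * (1 - (1 - p) ^ k) ^ Suc j = (pconn k p * (1 - (1 - p) ^ k) ^ j) * (1 - (1 - p) ^ k)"
    by simp
  also have "\<dots> \<le> pconn (k + j) p * (1 - (1 - p) ^ (k + j))"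
    using Suc b mono p pconn_nonneg by (intro mult_mono) auto
  also have "\<dots> \<le> pconn (k + Suc j) p"
    using pconn_Suc_ge[OF p, of "k + j"] k by simp
  finally show ?case .
qed simp

section \<open>Component counts over all sizes, and the lower bound on connection
  probabilities\<close>

context
  fixes F :: "'a filter" and n :: "'a \<Rightarrow> nat" and p :: "'a \<Rightarrow> real" and c :: real
  assumes n: "filterlim n at_top F"
    and pc: "((\<lambda>a. real (n a) * p a) \<longlongrightarrow> c) F" and c: "c > 0"
begin

text \<open>\<open>ncomp_decay\<close> is applied along the pairs of an index and a size with ratio
  tending to \<open>x\<close>, restricted to sizes at most \<open>N\<close>. Compactness then covers
  all of \<open>S\<close>.\<close>

lemma ncomp_uniform:
  assumes N: "((\<lambda>a. real (N a) / real (n a)) \<longlongrightarrow> y) F"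
    and S: "compact S" "\<And>x. x \<in> S \<Longrightarrow> x > 0" "\<And>x. x \<in> S \<Longrightarrow> x \<noteq> y * (1 - exp (- (c * x)))"
    and \<eta>: "\<eta> > 0"
  shows "\<forall>\<^sub>F a in F. \<forall>k. real k / real (n a) \<in> S \<longrightarrow> k \<le> N a \<longrightarrow> (real (n a))\<^sup>2 * ncomp (N a) k (p a) \<le> \<eta>"
proof -
  let ?r = "\<lambda>a k. real k / real (n a)"
  let ?Q = "\<lambda>z. snd z \<le> N (fst z) \<longrightarrow> (real (n (fst z)))\<^sup>2 * ncomp (N (fst z)) (snd z) (p (fst z)) \<le> \<eta>"
  have "eventually ?Q (at_limit F ?r x)" if x: "x \<in> S" for x
  proof -
    define F' where "F' = inf (at_limit F ?r x) (principal {z. snd z \<le> N (fst z)})"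
    have F': "F' \<le> at_limit F ?r x" by (simp add: F'_def)
    have l: "filterlim (\<lambda>z. f (fst z)) G F'" if "filterlim f G F" for f :: "'a \<Rightarrow> 'b" and G
      using filterlim_mono[OF filterlim_at_limit_fst[OF that] order_refl F'] .
    have k: "((\<lambda>z. real (snd z) / real (n (fst z))) \<longlongrightarrow> x) F'"
      using filterlim_mono[OF tendsto_at_limit[of ?r] order_refl F'] .
    have "((\<lambda>z. (real (n (fst z)))\<^sup>2 * ncomp (N (fst z)) (snd z) (p (fst z))) \<longlongrightarrow> 0) F'"
    proof (rule ncomp_decay[OF _ _ c k S(2)[OF x] _ _ S(3)[OF x]])
      show "filterlim (\<lambda>z. n (fst z)) sequentially F'"
        using filterlim_mono[OF filterlim_at_limit_fst[OF n] order_refl F'] .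
      show "((\<lambda>z. real (n (fst z)) * p (fst z)) \<longlongrightarrow> c) F'"
        using filterlim_mono[OF filterlim_at_limit_fst[OF pc] order_refl F'] .
      show "((\<lambda>z. real (N (fst z)) / real (n (fst z))) \<longlongrightarrow> y) F'"
        using filterlim_mono[OF filterlim_at_limit_fst[OF N] order_refl F'] .
      show "\<forall>\<^sub>F z in F'. snd z \<le> N (fst z)"
        unfolding F'_def eventually_inf_principal by simp
    qed
    then have "\<forall>\<^sub>F z in F'. (real (n (fst z)))\<^sup>2 * ncomp (N (fst z)) (snd z) (p (fst z)) < \<eta>"
      using order_tendstoD(2) \<eta> by blast
    then show ?thesis
      unfolding F'_def eventually_inf_principal by eventually_elim auto
  qed
  from eventually_compact[OF S(1) this] show ?thesis by simp
qed

text \<open>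
  On a set of \<open>M\<close> vertices, with \<open>M\<close> slightly above \<open>n (y - v)\<close> (the size of the dual subcritical
  graph), the expected number of components of any small size is not smaller than on the original
  set. There they occupy at most \<open>M\<close> vertices.
\<close>

lemma small_mass:
  assumes N: "((\<lambda>a. real (N a) / real (n a)) \<longlongrightarrow> y) F"
    and v: "v > 0" "v = y * (1 - exp (- (c * v)))" and \<eta>: "0 < \<eta>" "\<eta> < v"
  obtains e where "e > 0"
    "\<forall>\<^sub>F a in F. (\<Sum>k | k \<le> N a \<and> real k \<le> e * real (n a). real k * ncomp (N a) k (p a)) \<le> real (n a) * (y - v + 2 * \<eta>)"
proof -
  \<comment> \<open>Slightly below the root, \<open>exp_below_root\<close> gives a strict
    inequality, which is the room needed for \<open>ncomp_le_ncomp\<close> with \<open>M\<close>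
    about \<open>(y - t) n\<close>.\<close>
  define t where "t = v - \<eta>"
  have t: "0 < t" "t < v" using \<eta> by (auto simp: t_def)
  define w where "w = y - t"
  have y: "y > 0"
    using v c by (metis diff_gt_0_iff_gt exp_less_one_iff mult_pos_pos neg_less_0_iff_less zero_less_mult_pos2)
  have yw: "y * exp (- (c * t)) < w" unfolding w_def by (rule exp_below_root[OF t c v(2)])
  then have w: "w > 0" using y by (smt (verit) exp_gt_zero mult_pos_pos)
  \<comment> \<open>Half of that room. Sizes up to \<open>e n\<close> still leave
    \<open>M - k\<close> above \<open>N * (1 - p) ^ (N - M)\<close>.\<close>
  define e where "e = (w - y * exp (- (c * t))) / 2"
  have e: "e > 0" "y * exp (- (c * t)) < w - e" using yw unfolding e_def by argo+
  define M where "M a = nat \<lceil>w * real (n a)\<rceil>" for a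
  have M: "((\<lambda>a. real (M a) / real (n a)) \<longlongrightarrow> w) F"
    unfolding M_def using w by (intro tendsto_nat_ceiling_mult[OF n]) auto
  have "\<forall>\<^sub>F a in F. real (M a) / real (n a) < y - t / 2" "\<forall>\<^sub>F a in F. y - t / 2 < real (N a) / real (n a)"
    using order_tendstoD(2)[OF M, of "y - t / 2"] order_tendstoD(1)[OF N, of "y - t / 2"] t
    by (auto simp: w_def)
  then have MN: "\<forall>\<^sub>F a in F. M a \<le> N a"
    using ev_n_ge[OF n, of 1]
  proof eventually_elim
    case (elim a)
    then have "real (M a) / real (n a) < real (N a) / real (n a)" by simp
    then show ?case using elim by (simp add: divide_less_cancel)
  qed
  have d: "((\<lambda>a. real (N a - M a) / real (n a)) \<longlongrightarrow> t) F"
  proof (rule Lim_transform_eventually)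
    show "((\<lambda>a. real (N a) / real (n a) - real (M a) / real (n a)) \<longlongrightarrow> t) F"
      using tendsto_diff[OF N M] by (simp add: w_def)
    show "\<forall>\<^sub>F a in F. real (N a) / real (n a) - real (M a) / real (n a) = real (N a - M a) / real (n a)"
      using MN by eventually_elim (simp add: of_nat_diff diff_divide_distrib)
  qed
  have l: "((\<lambda>a. real (N a) / real (n a) * (1 - p a) ^ (N a - M a)) \<longlongrightarrow> y * exp (- (c * t))) F"
    by (intro tendsto_mult N pow_non_edges[OF n pc c d])
  have r: "((\<lambda>a. real (M a) / real (n a) - e) \<longlongrightarrow> w - e) F"
    by (intro tendsto_intros M)
  have "\<forall>\<^sub>F a in F. real (N a) / real (n a) * (1 - p a) ^ (N a - M a) < real (M a) / real (n a) - e"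
    by (rule eventually_less_of_tendsto[OF l r e(2)])
  moreover have "\<forall>\<^sub>F a in F. real (M a) / real (n a) < w + \<eta>"
    using order_tendstoD(2)[OF M, of "w + \<eta>"] \<eta> by simp
  ultimately have "\<forall>\<^sub>F a in F. (\<Sum>k | k \<le> N a \<and> real k \<le> e * real (n a). real k * ncomp (N a) k (p a)) \<le> real (n a) * (y - v + 2 * \<eta>)"
    using MN ev_p_pos[OF n pc c] ev_p_less[OF n pc c zero_less_one] ev_n_ge[OF n, of 1]
  proof eventually_elim
    case (elim a)
    let ?S = "{k. k \<le> N a \<and> real k \<le> e * real (n a)}"
    have *: "real (N a) * (1 - p a) ^ (N a - M a) \<le> real (M a) - e * real (n a)"
      using elim by (simp add: field_simps)
    have "0 \<le> real (N a) * (1 - p a) ^ (N a - M a)" using elim by simp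
    then have sub: "k \<le> M a" if "k \<in> ?S" for k using * that by auto
    have "(\<Sum>k\<in>?S. real k * ncomp (N a) k (p a)) \<le> (\<Sum>k\<in>?S. real k * ncomp (M a) k (p a))"
    proof (intro sum_mono mult_left_mono)
      fix k assume k: "k \<in> ?S"
      then have "real (N a) * (1 - p a) ^ (N a - M a) \<le> real (M a) - real k" using * by auto
      then show "ncomp (N a) k (p a) \<le> ncomp (M a) k (p a)"
        using elim sub[OF k] by (intro ncomp_le_ncomp) auto
    qed auto
    also have "\<dots> \<le> (\<Sum>k\<le>M a. real k * ncomp (M a) k (p a))"
      using sub elim by (intro sum_mono2) (auto simp: ncomp_nonneg)
    also have "\<dots> = real (M a)" using elim by (intro sum_ncomp) auto
    also have "\<dots> \<le> real (n a) * (w + \<eta>)" using elim by (simp add: field_simps)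
    finally show ?case by (simp add: w_def t_def algebra_simps)
  qed
  then show ?thesis using that e(1) by blast
qed

text \<open>The whole mass is about \<open>y n\<close>. Small sizes carry at most about
  \<open>(y - v) n\<close> by \<open>small_mass\<close>, and sizes of order \<open>n\<close> away
  from \<open>v n\<close> are negligible because \<open>v\<close> is the only positive root. The
  rest, about \<open>v n\<close>, must lie near \<open>v n\<close>.\<close>

lemma near_mass:
  assumes N: "((\<lambda>a. real (N a) / real (n a)) \<longlongrightarrow> y) F"
    and v: "v > 0" "v = y * (1 - exp (- (c * v)))" and \<eta>: "0 < \<eta>"
  shows "\<forall>\<^sub>F a in F. real (n a) * (v - \<eta>) \<le>
    (\<Sum>k | k \<le> N a \<and> \<bar>real k / real (n a) - v\<bar> \<le> \<eta>. real k * ncomp (N a) k (p a))"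
proof -
  \<comment> \<open>The losses are \<open>h\<close> from \<open>N\<close>, \<open>2 * h\<close> from
    the small sizes and \<open>h\<close> from the far ones, hence
    \<open>4 * h \<le> \<eta>\<close>.\<close>
  define h where "h = min (\<eta> / 4) (v / 2)"
  have h: "0 < h" "h < v" "4 * h \<le> \<eta>" using v \<eta> by (auto simp: h_def)
  obtain e where e: "e > 0"
    and small: "\<forall>\<^sub>F a in F. (\<Sum>k | k \<le> N a \<and> real k \<le> e * real (n a). real k * ncomp (N a) k (p a)) \<le> real (n a) * (y - v + 2 * h)"
    by (rule small_mass[OF N v h(1,2)])
  define S where "S = {e..y + 1} \<inter> {x. \<eta> \<le> \<bar>x - v\<bar>}"
  have "closed {x. \<eta> \<le> \<bar>x - v\<bar>}"
    by (intro closed_Collect_le continuous_intros)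
  then have S: "compact S" unfolding S_def by (intro compact_Int_closed compact_Icc)
  have Spos: "x > 0" if "x \<in> S" for x using that e by (auto simp: S_def)
  have Sne: "x \<noteq> y * (1 - exp (- (c * x)))" if "x \<in> S" for x
    using root_unique[OF Spos[OF that] v(1) c _ v(2)] that \<eta> by (auto simp: S_def)
  have far: "\<forall>\<^sub>F a in F. \<forall>k. real k / real (n a) \<in> S \<longrightarrow> k \<le> N a \<longrightarrow> (real (n a))\<^sup>2 * ncomp (N a) k (p a) \<le> 1"
    using Spos Sne by (intro ncomp_uniform[OF N S]) auto
  have "((\<lambda>a. (real (N a) / real (n a) + 1 / real (n a)) * (real (N a) / real (n a))) \<longlongrightarrow> (y + 0) * y) F"
    by (intro tendsto_intros N inverse_n[OF n])
  then have "\<forall>\<^sub>F a in F. (real (N a) / real (n a) + 1 / real (n a)) * (real (N a) / real (n a)) < y * y + 1"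
    using order_tendstoD(2)[of _ "(y + 0) * y" F "y * y + 1"] by simp
  moreover have "\<forall>\<^sub>F a in F. y - h < real (N a) / real (n a)" "\<forall>\<^sub>F a in F. real (N a) / real (n a) < y + 1"
    using order_tendstoD[OF N, of "y - h"] order_tendstoD[OF N, of "y + 1"] h by auto
  ultimately show ?thesis
    using small far ev_n_real_ge[OF n, of "(y * y + 1) / h"] ev_n_ge[OF n, of 1]
      ev_p_pos[OF n pc c] ev_p_less[OF n pc c zero_less_one]
  proof eventually_elim
    case (elim a)
    let ?f = "\<lambda>k. real k * ncomp (N a) k (p a)"
    let ?P = "\<lambda>k. real k \<le> e * real (n a)" and ?R = "\<lambda>k. \<bar>real k / real (n a) - v\<bar> \<le> \<eta>"
    let ?W = "\<lambda>k. real k / real (n a) \<in> S"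
    have nonneg: "0 \<le> ?f k" for k using elim by (simp add: ncomp_nonneg)
    have eq: "(\<Sum>k | k \<le> N a \<and> P k. ?f k) = (\<Sum>k\<le>N a. if P k then ?f k else 0)" for P
      using sum.inter_filter[of "{..N a}" ?f P] by simp
    have "real (N a) = (\<Sum>k\<le>N a. ?f k)" using elim by (simp add: sum_ncomp)
    also have "\<dots> \<le> (\<Sum>k\<le>N a. (if ?P k then ?f k else 0) + (if ?R k then ?f k else 0) + (if ?W k then ?f k else 0))"
    proof (intro sum_mono)
      fix k assume k: "k \<in> {..N a}"
      have "?P k \<or> ?R k \<or> ?W k"
      proof (rule ccontr)
        assume "\<not> ?thesis"
        then have "e < real k / real (n a)" "\<eta> < \<bar>real k / real (n a) - v\<bar>" "\<not> ?W k"
          using elim by (auto simp: field_simps)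
        moreover have "real k / real (n a) \<le> real (N a) / real (n a)"
          using k by (intro divide_right_mono) auto
        ultimately show False using elim by (auto simp: S_def)
      qed
      then show "?f k \<le> (if ?P k then ?f k else 0) + (if ?R k then ?f k else 0) + (if ?W k then ?f k else 0)"
        using nonneg[of k] by (auto simp del: of_nat_mult)
    qed
    also have "\<dots> = (\<Sum>k | k \<le> N a \<and> ?P k. ?f k) + (\<Sum>k | k \<le> N a \<and> ?R k. ?f k) + (\<Sum>k | k \<le> N a \<and> ?W k. ?f k)"
      unfolding eq by (simp add: sum.distrib)
    also have "(\<Sum>k | k \<le> N a \<and> ?W k. ?f k) \<le> real (card {k. k \<le> N a \<and> ?W k}) * (real (N a) / (real (n a))\<^sup>2)"
    proof (rule sum_bounded_above)
      fix k assume k: "k \<in> {k. k \<le> N a \<and> ?W k}"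
      then have "(real (n a))\<^sup>2 * ncomp (N a) k (p a) \<le> 1" using elim by blast
      then have "ncomp (N a) k (p a) \<le> 1 / (real (n a))\<^sup>2" using elim by (simp add: field_simps)
      then have "?f k \<le> real (N a) * (1 / (real (n a))\<^sup>2)"
        using k elim by (intro mult_mono) (auto simp: ncomp_nonneg)
      then show "?f k \<le> real (N a) / (real (n a))\<^sup>2" by simp
    qed
    also have "real (card {k. k \<le> N a \<and> ?W k}) * (real (N a) / (real (n a))\<^sup>2) \<le> (real (N a) + 1) * (real (N a) / (real (n a))\<^sup>2)"
    proof -
      have "card {k. k \<le> N a \<and> ?W k} \<le> card {..N a}" by (intro card_mono) auto
      then have "real (card {k. k \<le> N a \<and> ?W k}) \<le> real (N a) + 1" by simp
      then show ?thesis by (intro mult_right_mono) auto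
    qed
    also have "\<dots> = (real (N a) / real (n a) + 1 / real (n a)) * (real (N a) / real (n a))"
      unfolding add_divide_distrib[symmetric] by (simp add: power2_eq_square)
    also have "\<dots> \<le> y * y + 1" using elim by simp
    also have "\<dots> \<le> h * real (n a)" using elim h by (simp add: field_simps)
    finally have "real (N a) \<le> (\<Sum>k | k \<le> N a \<and> ?P k. ?f k) + (\<Sum>k | k \<le> N a \<and> ?R k. ?f k) + h * real (n a)"
      by simp
    moreover have "real (n a) * (y - h) \<le> real (N a)" using elim by (simp add: field_simps)
    ultimately have "real (n a) * (y - h) - real (n a) * (y - v + 2 * h) - h * real (n a) \<le> (\<Sum>k | k \<le> N a \<and> ?R k. ?f k)"
      using elim by linarith
    then have "real (n a) * (v - 4 * h) \<le> (\<Sum>k | k \<le> N a \<and> ?R k. ?f k)"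
      by (simp add: algebra_simps)
    moreover have "real (n a) * (v - \<eta>) \<le> real (n a) * (v - 4 * h)" using h by (intro mult_left_mono) auto
    ultimately show ?case by linarith
  qed
qed

text \<open>
  On \<open>w n\<close> vertices, \<open>w = x / (1 - exp (- (c * x)))\<close>, the giant component has about \<open>x n\<close> vertices,
  so some size \<open>k\<close> near \<open>x n\<close> is attained with a probability that is not exponentially small.
\<close>

lemma pconn_lower_seq:
  assumes x: "x > 0"
  obtains k :: "'a \<Rightarrow> nat" where "((\<lambda>a. real (k a) / real (n a)) \<longlongrightarrow> x) F"
    "\<And>b. b < x * ln (1 - exp (- (c * x))) \<Longrightarrow> \<forall>\<^sub>F a in F. b < ln (pconn (k a) (p a)) / real (n a)"
proof -
  define \<theta> where "\<theta> = 1 - exp (- (c * x))"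
  have th: "0 < \<theta>" "\<theta> < 1" using x c by (auto simp: \<theta>_def)
  define w where "w = x / \<theta>"
  have w: "w > 0" "x = w * (1 - exp (- (c * x)))" using th x by (auto simp: w_def \<theta>_def)
  define N where "N a = nat \<lceil>w * real (n a)\<rceil>" for a
  have N: "((\<lambda>a. real (N a) / real (n a)) \<longlongrightarrow> w) F"
    unfolding N_def using w by (intro tendsto_nat_ceiling_mult[OF n]) auto
  \<comment> \<open>Mass at least \<open>n x / 2\<close> is spread over at most \<open>N + 1\<close>
    sizes. \<open>B\<close> is half of the resulting average, so some size reaches it.\<close>
  define B where "B a = real (n a) * x / (4 * (real (N a) + 1))" for a
  define good where "good a k \<longleftrightarrow> k \<le> N a \<and> \<bar>real k / real (n a) - x\<bar> \<le> x / 2 \<and> B a \<le> real k * ncomp (N a) k (p a)" for a k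
  have "\<forall>\<^sub>F a in F. real (n a) * (x - x / 2) \<le>
    (\<Sum>k | k \<le> N a \<and> \<bar>real k / real (n a) - x\<bar> \<le> x / 2. real k * ncomp (N a) k (p a))"
    by (rule near_mass[OF N x w(2)]) (use x in simp)
  then have "\<forall>\<^sub>F a in F. \<exists>k. good a k"
    using ev_n_ge[OF n, of 1]
  proof eventually_elim
    case (elim a)
    let ?S = "{k. k \<le> N a \<and> \<bar>real k / real (n a) - x\<bar> \<le> x / 2}"
    show ?case
    proof (rule ccontr)
      assume *: "\<not> ?thesis"
      have "(\<Sum>k\<in>?S. real k * ncomp (N a) k (p a)) \<le> real (card ?S) * B a"
      proof (rule sum_bounded_above)
        fix k assume "k \<in> ?S"
        moreover have "\<not> good a k" using * by simp
        ultimately have "\<not> B a \<le> real k * ncomp (N a) k (p a)" by (simp add: good_def)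
        then show "real k * ncomp (N a) k (p a) \<le> B a" by simp
      qed
      also have "\<dots> \<le> (real (N a) + 1) * B a"
      proof -
        have "card ?S \<le> card {..N a}" by (intro card_mono) auto
        then have "real (card ?S) \<le> real (N a) + 1" by simp
        then show ?thesis using x by (intro mult_right_mono) (auto simp: B_def)
      qed
      also have "\<dots> = real (n a) * x / 4"
      proof -
        have "s * (r / (4 * s)) = r / 4" if "s > 0" for s r :: real
          using that by (simp add: field_simps)
        from this[of "real (N a) + 1"] show ?thesis unfolding B_def by (meson add_nonneg_pos of_nat_0_le_iff zero_less_one)
      qed
      also have "\<dots> < real (n a) * (x - x / 2)" using x elim by (simp add: field_simps)
      finally show False using elim by simp
    qed
  qed
  define k where "k a = (SOME k. good a k)" for a
  have good: "\<forall>\<^sub>F a in F. good a (k a)"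
    using \<open>\<forall>\<^sub>F a in F. \<exists>k. good a k\<close> by eventually_elim (auto simp: k_def intro: someI_ex)
  have Nb: "\<forall>\<^sub>F a in F. real (N a) / real (n a) < w + 1"
    using order_tendstoD(2)[OF N, of "w + 1"] by simp
  \<comment> \<open>A good size at distance at least \<open>\<eta>\<close> from \<open>x\<close>
    would have \<open>k * ncomp\<close> of order at most \<open>1 / n\<close> by
    \<open>ncomp_uniform\<close>, whereas \<open>B\<close> stays away from 0.\<close>
  have k: "((\<lambda>a. real (k a) / real (n a)) \<longlongrightarrow> x) F"
  proof (rule tendstoI)
    fix \<eta> :: real assume \<eta>: "\<eta> > 0"
    define S where "S = {x / 2..3 * x / 2} \<inter> {t. \<eta> \<le> \<bar>t - x\<bar>}"
    have "closed {t. \<eta> \<le> \<bar>t - x\<bar>}" by (intro closed_Collect_le continuous_intros)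
    then have S: "compact S" unfolding S_def by (intro compact_Int_closed compact_Icc)
    have Spos: "t > 0" if "t \<in> S" for t using that x by (auto simp: S_def)
    have Sne: "t \<noteq> w * (1 - exp (- (c * t)))" if "t \<in> S" for t
      using root_unique[OF Spos[OF that] x c _ w(2)] that \<eta> by (auto simp: S_def)
    have "\<forall>\<^sub>F a in F. \<forall>k. real k / real (n a) \<in> S \<longrightarrow> k \<le> N a \<longrightarrow> (real (n a))\<^sup>2 * ncomp (N a) k (p a) \<le> 1"
      using Spos Sne by (intro ncomp_uniform[OF N S]) auto
    then show "\<forall>\<^sub>F a in F. dist (real (k a) / real (n a)) x < \<eta>"
      using good Nb ev_n_real_ge[OF n, of "6 * (w + 2) + 1"] ev_n_ge[OF n, of 1]
    proof eventually_elim
      case (elim a)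
      show ?case
      proof (rule ccontr)
        assume "\<not> ?thesis"
        then have "real (k a) / real (n a) \<in> S"
          using elim by (auto simp: S_def good_def dist_real_def abs_if split: if_splits)
        then have ncomp: "(real (n a))\<^sup>2 * ncomp (N a) (k a) (p a) \<le> 1"
          using elim by (auto simp: good_def)
        have kb: "real (k a) \<le> 3 * x / 2 * real (n a)"
        proof -
          have "\<bar>real (k a) / real (n a) - x\<bar> \<le> x / 2" using elim by (simp add: good_def)
          then have "real (k a) / real (n a) \<le> 3 * x / 2" by linarith
          then show ?thesis using elim by (subst (asm) pos_divide_le_eq) auto
        qed
        have "(real (n a))\<^sup>2 * B a \<le> (real (n a))\<^sup>2 * (real (k a) * ncomp (N a) (k a) (p a))"
          using elim by (intro mult_left_mono) (auto simp: good_def)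
        also have "\<dots> = real (k a) * ((real (n a))\<^sup>2 * ncomp (N a) (k a) (p a))" by simp
        also have "\<dots> \<le> real (k a) * 1" using ncomp by (intro mult_left_mono) auto
        also have "\<dots> \<le> 3 * x / 2 * real (n a)" using kb by simp
        finally have "(real (n a) * x) * (real (n a))\<^sup>2 \<le> (real (n a) * x) * (6 * (real (N a) + 1))"
          by (simp add: B_def field_simps)
        then have "(real (n a))\<^sup>2 \<le> 6 * (real (N a) + 1)" using x elim by simp
        also have "\<dots> \<le> 6 * (w + 2) * real (n a)" using elim by (simp add: field_simps)
        also have "\<dots> < real (n a) * real (n a)" using elim by (intro mult_strict_right_mono) auto
        finally show False by (simp add: power2_eq_square)
      qed
    qed
  qed
  show ?thesis
  proof (rule that[OF k])
    fix b assume b: "b < x * ln (1 - exp (- (c * x)))"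
    define D where "D = (\<lambda>a. (ln (real (N a choose k a)) + real (k a) * (real (N a) - real (k a)) * ln (1 - p a)) / real (n a))"
    have kN: "\<forall>\<^sub>F a in F. k a \<le> N a" using good by eventually_elim (simp add: good_def)
    have "((\<lambda>a. ln (x / (4 * (real (N a) / real (n a) + 1 / real (n a)))) * (1 / real (n a)) - ln (real (k a)) / real (n a) - D a)
      \<longlongrightarrow> ln (x / (4 * (w + 0))) * 0 - 0 - (xlog w - xlog x - xlog (w - x) - c * x * (w - x))) F"
      unfolding D_def using x w(1)
      by (intro tendsto_intros N inverse_n[OF n] ln_k_over_n[OF n k] ln_cut_asymp[OF n pc c k N kN]) auto
    also have "ln (x / (4 * (w + 0))) * 0 - 0 - (xlog w - xlog x - xlog (w - x) - c * x * (w - x)) = x * ln \<theta>"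
      using dual_rate[OF x c] by (simp add: w_def \<theta>_def)
    finally have "\<forall>\<^sub>F a in F. b < ln (x / (4 * (real (N a) / real (n a) + 1 / real (n a)))) * (1 / real (n a)) - ln (real (k a)) / real (n a) - D a"
      using order_tendstoD(1) b unfolding \<theta>_def by blast
    then show "\<forall>\<^sub>F a in F. b < ln (pconn (k a) (p a)) / real (n a)"
      using good ev_k_ge[OF n k x] ev_p_pos[OF n pc c] ev_p_less[OF n pc c zero_less_one] ev_n_ge[OF n, of 1]
    proof eventually_elim
      case (elim a)
      have kN: "k a \<le> N a" using elim by (simp add: good_def)
      have pconn: "pconn (k a) (p a) > 0" using elim by (intro pconn_pos) auto
      have C: "real (N a choose k a) > 0" using kN by simp
      have Bpos: "B a > 0" using elim x by (simp add: B_def)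
      have "ln (B a) \<le> ln (real (k a) * ncomp (N a) (k a) (p a))"
        using elim Bpos by (intro ln_mono) (auto simp: good_def)
      also have "ln (real (k a) * ncomp (N a) (k a) (p a)) = ln (real (k a)) + ln (real (N a choose k a)) +
          ln (pconn (k a) (p a)) + real (k a) * (real (N a) - real (k a)) * ln (1 - p a)"
        using elim pconn C kN by (simp add: ncomp_def ln_mult ln_realpow of_nat_diff)
      finally have "ln (B a) - ln (real (k a)) - real (n a) * D a \<le> ln (pconn (k a) (p a))"
        using elim by (simp add: D_def)
      then have "(ln (B a) - ln (real (k a)) - real (n a) * D a) / real (n a) \<le> ln (pconn (k a) (p a)) / real (n a)"
        by (rule divide_right_mono) simp
      moreover have "B a = x / (4 * (real (N a) / real (n a) + 1 / real (n a)))"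
        using elim by (simp add: B_def field_simps)
      ultimately show ?case using elim by (simp add: diff_divide_distrib)
    qed
  qed
qed

text \<open>The size in \<open>pconn_lower_seq\<close> cannot be prescribed. A size near
  \<open>t n\<close>, with \<open>t\<close> slightly below \<open>x\<close>, is enlarged to
  \<open>k\<close> by attaching vertices; each costs a factor tending to
  \<open>1 - exp (- (c * t))\<close>. Both stages together have rate
  \<open>x * ln (1 - exp (- (c * t)))\<close>, close to the claim by continuity.\<close>

lemma pconn_lower:
  assumes k: "((\<lambda>a. real (k a) / real (n a)) \<longlongrightarrow> x) F" and x: "x > 0"
    and b: "b < x * ln (1 - exp (- (c * x)))"
  shows "\<forall>\<^sub>F a in F. b < ln (pconn (k a) (p a)) / real (n a)"
proof -
  have "isCont (\<lambda>t. x * ln (1 - exp (- (c * t)))) x"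
    using x c by (intro continuous_intros) auto
  then have "((\<lambda>t. x * ln (1 - exp (- (c * t)))) \<longlongrightarrow> x * ln (1 - exp (- (c * x)))) (at_left x)"
    unfolding isCont_def by (rule filterlim_mono[OF _ order_refl]) (simp add: at_le)
  then have "\<forall>\<^sub>F t in at_left x. b < x * ln (1 - exp (- (c * t)))" using b by (rule order_tendstoD)
  moreover have "\<forall>\<^sub>F t in at_left x. 0 < t \<and> t < x"
    using x eventually_at_left_real by (metis (mono_tags, lifting) eventually_mono greaterThanLessThan_iff)
  ultimately obtain t where t: "0 < t" "t < x" "b < x * ln (1 - exp (- (c * t)))"
    using eventually_happens'[OF trivial_limit_at_left_real eventually_conj] by blast
  define \<theta> where "\<theta> = 1 - exp (- (c * t))"
  have th: "0 < \<theta>" using t c by (auto simp: \<theta>_def)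
  \<comment> \<open>Half of the slack in the choice of \<open>t\<close>, one half for each
    stage.\<close>
  define d where "d = (x * ln \<theta> - b) / 2"
  have d: "d > 0" using t by (simp add: d_def \<theta>_def)
  obtain j :: "'a \<Rightarrow> nat" where j: "((\<lambda>a. real (j a) / real (n a)) \<longlongrightarrow> t) F"
    and jq: "\<And>b. b < t * ln (1 - exp (- (c * t))) \<Longrightarrow> \<forall>\<^sub>F a in F. b < ln (pconn (j a) (p a)) / real (n a)"
    using pconn_lower_seq[OF t(1)] by blast
  have "\<forall>\<^sub>F a in F. real (j a) / real (n a) < real (k a) / real (n a)"
    by (rule eventually_less_of_tendsto[OF j k t(2)])
  then have jk: "\<forall>\<^sub>F a in F. j a \<le> k a"
    using ev_n_ge[OF n, of 1] by eventually_elim (auto simp: divide_less_cancel)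
  have "((\<lambda>a. (real (k a) / real (n a) - real (j a) / real (n a)) * ln (1 - (1 - p a) ^ j a))
     \<longlongrightarrow> (x - t) * ln (1 - exp (- (c * t)))) F"
    using th by (intro tendsto_intros k j pow_non_edges[OF n pc c j]) (auto simp: \<theta>_def)
  then have "\<forall>\<^sub>F a in F. (x - t) * ln \<theta> - d < (real (k a) / real (n a) - real (j a) / real (n a)) * ln (1 - (1 - p a) ^ j a)"
    using order_tendstoD(1) d by (fastforce simp: \<theta>_def)
  moreover have "\<forall>\<^sub>F a in F. t * ln \<theta> - d < ln (pconn (j a) (p a)) / real (n a)"
    using jq[of "t * ln \<theta> - d"] d by (simp add: \<theta>_def)
  ultimately show ?thesis
    using jk ev_k_ge[OF n j t(1)] ev_p_pos[OF n pc c] ev_p_less[OF n pc c zero_less_one] ev_n_ge[OF n, of 1]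
  proof eventually_elim
    case (elim a)
    have pconn: "pconn (j a) (p a) > 0" using elim by (intro pconn_pos) auto
    have r: "1 - (1 - p a) ^ j a > 0" using elim by (simp add: power_less_one_iff)
    have "ln (pconn (j a) (p a) * (1 - (1 - p a) ^ j a) ^ (k a - j a)) \<le> ln (pconn (k a) (p a))"
      using elim pconn r pconn_add_ge[of "p a" "j a" "k a - j a"] by (intro ln_mono) auto
    moreover have "ln (pconn (j a) (p a) * (1 - (1 - p a) ^ j a) ^ (k a - j a)) =
        ln (pconn (j a) (p a)) + (real (k a) - real (j a)) * ln (1 - (1 - p a) ^ j a)"
      using elim pconn r by (simp add: ln_mult ln_realpow of_nat_diff)
    ultimately have "(ln (pconn (j a) (p a)) + (real (k a) - real (j a)) * ln (1 - (1 - p a) ^ j a)) / real (n a)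
        \<le> ln (pconn (k a) (p a)) / real (n a)"
      by (intro divide_right_mono) auto
    then have le: "ln (pconn (j a) (p a)) / real (n a) + (real (k a) / real (n a) - real (j a) / real (n a)) * ln (1 - (1 - p a) ^ j a)
        \<le> ln (pconn (k a) (p a)) / real (n a)"
      by (simp add: add_divide_distrib diff_divide_distrib left_diff_distrib)
    have "b = (t * ln \<theta> - d) + ((x - t) * ln \<theta> - d)"
      by (simp add: d_def algebra_simps)
    then show ?case using le elim by linarith
  qed
qed

lemma pconn_rate:
  assumes k: "((\<lambda>a. real (k a) / real (n a)) \<longlongrightarrow> x) F" and x: "x > 0"
  shows "((\<lambda>a. ln (pconn (k a) (p a)) / real (n a)) \<longlongrightarrow> x * ln (1 - exp (- (c * x)))) F"
  using pconn_lower[OF k x] pconn_upper[OF n pc c k x] by (intro order_tendstoI) auto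

end

section \<open>Edge counts and small components\<close>

lemma first_moment:
  assumes p: "0 \<le> p" "p \<le> 1" and U: "finite U"
  shows "gex p (edges U) (\<lambda>G. of_bool (\<exists>D\<in>comps U G. P (card D))) \<le> (\<Sum>k | k \<le> card U \<and> P k. ncomp (card U) k p)"
proof -
  let ?S = "{k. k \<le> card U \<and> P k}"
  let ?T = "{V. V \<subseteq> U \<and> card V \<in> ?S}"
  have fin: "finite ?S" "finite ?T" using U by auto
  have "gex p (edges U) (\<lambda>G. of_bool (\<exists>D\<in>comps U G. P (card D))) \<le>
      gex p (edges U) (\<lambda>G. \<Sum>V\<in>?T. of_bool (V \<in> comps U G))"
  proof (rule gex_mono[OF p])
    fix G assume G: "G \<subseteq> edges U"
    show "of_bool (\<exists>D\<in>comps U G. P (card D)) \<le> (\<Sum>V\<in>?T. of_bool (V \<in> comps U G) :: real)"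
    proof (cases "\<exists>D\<in>comps U G. P (card D)")
      case True
      then obtain D where D: "D \<in> comps U G" "P (card D)" by blast
      then have "D \<in> ?T" using comps_subset[OF G D(1)] U card_mono by auto
      then have "of_bool (D \<in> comps U G) \<le> (\<Sum>V\<in>?T. of_bool (V \<in> comps U G) :: real)"
        using fin by (intro member_le_sum) auto
      then show ?thesis using True D by simp
    qed (simp add: sum_nonneg)
  qed
  also have "\<dots> = (\<Sum>V\<in>?T. 1 * gex p (edges U) (\<lambda>G. of_bool (V \<in> comps U G)))"
    by (simp add: gex_sum del: sum_of_bool_eq)
  also have "\<dots> = (\<Sum>k\<in>?S. 1 * ncomp (card U) k p)"
    by (rule sum_comps_rest[OF U fin(1)])
  finally show ?thesis by simp
qed

context
  fixes F :: "'a filter" and n :: "'a \<Rightarrow> nat" and p :: "'a \<Rightarrow> real" and c :: real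
  assumes n: "filterlim n at_top F"
    and pc: "((\<lambda>a. real (n a) * p a) \<longlongrightarrow> c) F" and c: "c > 0"
begin

text \<open>
  Chernoff's bound: by tilting, the exponential moment of the number of edges of a connected graph
  is again a connection probability, for the edge probability \<open>p z / (1 - p + p z)\<close>, and so has a
  known rate. For \<open>z < 1\<close> the logarithm is negative and the lemma bounds the lower tail.
\<close>

lemma edge_count_tail:
  assumes V: "\<forall>\<^sub>F a in F. finite (V a)" and k: "((\<lambda>a. real (card (V a)) / real (n a)) \<longlongrightarrow> x) F"
    and x: "x > 0" and z: "z > 0"
    and neg: "(z - 1) * (c * x\<^sup>2 / 2) + x * ln (1 - exp (- (c * z * x))) - x * ln (1 - exp (- (c * x))) - d * ln z < 0"
  shows "((\<lambda>a. gex (p a) (edges (V a))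
      (\<lambda>H. of_bool (conn (V a) H) * of_bool (d * real (n a) * ln z \<le> real (card H) * ln z)) / pconn (card (V a)) (p a)) \<longlongrightarrow> 0) F"
proof -
  define u where "u a = p a * (z - 1)" for a
  define p' where "p' a = p a * z / (1 + u a)" for a
  define h where "h = (z - 1) * (c * x\<^sup>2 / 2) + x * ln (1 - exp (- (c * z * x))) - x * ln (1 - exp (- (c * x))) - d * ln z"
  have u: "(u \<longlongrightarrow> 0) F"
    unfolding u_def using tendsto_mult[OF p_tendsto_0[OF n pc c] tendsto_const[of "z - 1"]] by simp
  have p'lim: "((\<lambda>a. real (n a) * p' a) \<longlongrightarrow> c * z) F"
  proof -
    have "((\<lambda>a. (real (n a) * p a) * z / (1 + u a)) \<longlongrightarrow> c * z / (1 + 0)) F"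
      by (intro tendsto_intros pc u) auto
    then show ?thesis by (simp add: p'_def mult_ac)
  qed
  have "((\<lambda>a. (real (n a) * p a) * (z - 1) * (real (card (V a)) / real (n a))) \<longlongrightarrow> c * (z - 1) * x) F"
    by (intro tendsto_intros pc k)
  then have "((\<lambda>a. real (card (V a)) * u a) \<longlongrightarrow> c * (z - 1) * x) F"
  proof (rule Lim_transform_eventually)
    show "\<forall>\<^sub>F a in F. (real (n a) * p a) * (z - 1) * (real (card (V a)) / real (n a)) = real (card (V a)) * u a"
      using ev_n_ge[OF n, of 1] by eventually_elim (simp add: u_def)
  qed
  then have ku: "((\<lambda>a. real (card (V a)) * ln (1 + u a)) \<longlongrightarrow> c * (z - 1) * x) F"
    by (rule n_ln_one_plus[OF u])
  \<comment> \<open>The logarithm of Chernoff's bound divided by \<open>n\<close>: the threshold,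
    the normalising constant raised to the number of pairs, and the change of the connection
    probability under tilting.\<close>
  have "((\<lambda>a. - (d * ln z) + 1 / 2 * (real (card (V a)) / real (n a) - 1 / real (n a)) * (real (card (V a)) * ln (1 + u a))
       + ln (pconn (card (V a)) (p' a)) / real (n a) - ln (pconn (card (V a)) (p a)) / real (n a))
     \<longlongrightarrow> - (d * ln z) + 1 / 2 * (x - 0) * (c * (z - 1) * x) + x * ln (1 - exp (- (c * z * x))) - x * ln (1 - exp (- (c * x)))) F"
    using c z by (intro tendsto_intros k ku inverse_n[OF n] pconn_rate[OF n pc c k x] pconn_rate[OF n p'lim _ k x]) auto
  also have "- (d * ln z) + 1 / 2 * (x - 0) * (c * (z - 1) * x) + x * ln (1 - exp (- (c * z * x))) - x * ln (1 - exp (- (c * x))) = h"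
  proof -
    have "1 / 2 * (x - 0) * (c * (z - 1) * x) = (z - 1) * (c * x\<^sup>2 / 2)"
      by (simp add: power2_eq_square)
    then show ?thesis unfolding h_def by linarith
  qed
  finally have "\<forall>\<^sub>F a in F. - (d * ln z) + 1 / 2 * (real (card (V a)) / real (n a) - 1 / real (n a)) * (real (card (V a)) * ln (1 + u a))
       + ln (pconn (card (V a)) (p' a)) / real (n a) - ln (pconn (card (V a)) (p a)) / real (n a) < h / 2"
    by (rule order_tendstoD(2)) (use neg in \<open>simp add: h_def\<close>)
  moreover have "\<forall>\<^sub>F a in F. \<bar>u a\<bar> < 1"
    using tendstoD[OF u, of 1] by simp
  ultimately have up: "\<forall>\<^sub>F a in F. gex (p a) (edges (V a))
      (\<lambda>H. of_bool (conn (V a) H) * of_bool (d * real (n a) * ln z \<le> real (card H) * ln z)) / pconn (card (V a)) (p a)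
      \<le> exp (- (- h / 2 * real (n a)))"
    using V ev_k_ge[OF n k x] ev_n_ge[OF n, of 1] ev_p_pos[OF n pc c] ev_p_less[OF n pc c zero_less_one]
      ev_p_pos[OF n p'lim mult_pos_pos[OF c z]] ev_p_less[OF n p'lim mult_pos_pos[OF c z] zero_less_one]
  proof eventually_elim
    case (elim a)
    let ?k = "card (V a)"
    have pconn: "pconn ?k (p a) > 0" "pconn ?k (p' a) > 0" using elim by (auto intro!: pconn_pos)
    have u1: "1 + u a > 0" using elim by linarith
    have ueq: "1 - p a + p a * z = 1 + u a" by (simp add: u_def algebra_simps)
    have fin: "finite (edges (V a))" using elim finite_edges by blast
    have "gex (p a) (edges (V a)) (\<lambda>H. of_bool (conn (V a) H) * of_bool (d * real (n a) * ln z \<le> real (card H) * ln z))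
       \<le> gex (p a) (edges (V a)) (\<lambda>H. exp (- (d * real (n a) * ln z)) * (z ^ card H * of_bool (conn (V a) H)))"
    proof (rule gex_mono)
      fix H :: "nat set set"
      have "exp (- (d * real (n a) * ln z)) * z ^ card H = exp (real (card H) * ln z - d * real (n a) * ln z)"
      proof -
        have "z ^ card H = exp (real (card H) * ln z)" using z by (simp add: exp_of_nat_mult)
        then show ?thesis by (simp flip: exp_add)
      qed
      moreover have "1 \<le> exp (real (card H) * ln z - d * real (n a) * ln z)" if "d * real (n a) * ln z \<le> real (card H) * ln z"
        using that by simp
      ultimately show "of_bool (conn (V a) H) * of_bool (d * real (n a) * ln z \<le> real (card H) * ln z)
          \<le> exp (- (d * real (n a) * ln z)) * (z ^ card H * of_bool (conn (V a) H))"
        using z by (auto simp: mult.assoc[symmetric])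
    qed (use elim in auto)
    also have "\<dots> = exp (- (d * real (n a) * ln z)) * ((1 + u a) ^ (?k choose 2) * pconn ?k (p' a))"
      using gex_tilt[OF fin, of "p a" z "\<lambda>H. of_bool (conn (V a) H)"] u1 elim
      by (simp add: gex_cmult ueq card_edges gex_conn p'_def)
    also have "\<dots> = exp (- (d * real (n a) * ln z) + real (?k choose 2) * ln (1 + u a) + ln (pconn ?k (p' a)))"
    proof -
      have pw: "(1 + u a) ^ (?k choose 2) = exp (real (?k choose 2) * ln (1 + u a))"
        using u1 by (simp add: exp_of_nat_mult)
      show ?thesis by (simp only: pw exp_add exp_ln[OF pconn(2)] mult.assoc)
    qed
    finally have "gex (p a) (edges (V a)) (\<lambda>H. of_bool (conn (V a) H) * of_bool (d * real (n a) * ln z \<le> real (card H) * ln z)) / pconn ?k (p a)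
       \<le> exp (- (d * real (n a) * ln z) + real (?k choose 2) * ln (1 + u a) + ln (pconn ?k (p' a))) / pconn ?k (p a)"
      using pconn by (intro divide_right_mono) auto
    also have "\<dots> = exp (- (d * real (n a) * ln z) + real (?k choose 2) * ln (1 + u a) + ln (pconn ?k (p' a)) - ln (pconn ?k (p a)))"
      using pconn by (simp add: exp_diff)
    also have "- (d * real (n a) * ln z) + real (?k choose 2) * ln (1 + u a) + ln (pconn ?k (p' a)) - ln (pconn ?k (p a))
       = real (n a) * (- (d * ln z) + 1 / 2 * (real ?k / real (n a) - 1 / real (n a)) * (real ?k * ln (1 + u a))
       + ln (pconn ?k (p' a)) / real (n a) - ln (pconn ?k (p a)) / real (n a))"
    proof -
      have C: "real (?k choose 2) = 1 / 2 * (real ?k - 1) * real ?k"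
        using choose_two_real[of ?k] by (simp add: power2_eq_square algebra_simps)
      have "- (d * N * l) + 1 / 2 * (K - 1) * K * L' + A - B =
          N * (- (d * l) + 1 / 2 * (K / N - 1 / N) * (K * L') + A / N - B / N)"
        if "N \<noteq> 0" for N l K L' A B :: real
        using that by (simp add: field_simps)
      then show ?thesis unfolding C using elim by simp
    qed
    also have "exp (real (n a) * (- (d * ln z) + 1 / 2 * (real ?k / real (n a) - 1 / real (n a)) * (real ?k * ln (1 + u a))
       + ln (pconn ?k (p' a)) / real (n a) - ln (pconn ?k (p a)) / real (n a))) \<le> exp (real (n a) * (h / 2))"
      using elim by (intro exp_mono mult_left_mono) auto
    finally show ?case by (simp add: mult_ac)
  qed
  have lo: "\<forall>\<^sub>F a in F. 0 \<le> gex (p a) (edges (V a))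
      (\<lambda>H. of_bool (conn (V a) H) * of_bool (d * real (n a) * ln z \<le> real (card H) * ln z)) / pconn (card (V a)) (p a)"
    using ev_p_pos[OF n pc c] ev_p_less[OF n pc c zero_less_one]
    by eventually_elim (auto intro!: divide_nonneg_nonneg gex_nonneg pconn_nonneg)
  show ?thesis
    by (rule tendsto_sandwich[OF lo up tendsto_const exp_decay[OF n]]) (use neg in \<open>simp add: h_def\<close>)
qed

text \<open>The exponent \<open>h d z\<close> of \<open>edge_count_tail\<close> vanishes at
  \<open>z = 1\<close> with derivative \<open>e - d\<close>. For \<open>d = e + \<epsilon>\<close>
  it is therefore negative for some \<open>z > 1\<close>, and for \<open>d = e - \<epsilon>\<close>
  for some \<open>z < 1\<close>; these bound the upper and the lower tail.\<close>

lemma edge_count_concentration: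
  assumes V: "\<forall>\<^sub>F a in F. finite (V a)" and k: "((\<lambda>a. real (card (V a)) / real (n a)) \<longlongrightarrow> x) F"
    and x: "x > 0" and \<epsilon>: "\<epsilon> > 0"
  defines "e \<equiv> c * x\<^sup>2 / (1 - exp (- (c * x))) - c * x\<^sup>2 / 2"
  shows "((\<lambda>a. gex (p a) (edges (V a))
      (\<lambda>H. of_bool (conn (V a) H) * of_bool (\<epsilon> * real (n a) \<le> \<bar>real (card H) - real (n a) * e\<bar>)) / pconn (card (V a)) (p a)) \<longlongrightarrow> 0) F"
proof -
  define \<theta> where "\<theta> = 1 - exp (- (c * x))"
  have th: "\<theta> > 0" using x c by (simp add: \<theta>_def)
  define h where "h d z = (z - 1) * (c * x\<^sup>2 / 2) + x * ln (1 - exp (- (c * z * x))) - x * ln (1 - exp (- (c * x))) - d * ln z" for d z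
  have h1: "h d 1 = 0" for d by (simp add: h_def)
  have "(h d has_real_derivative c * x\<^sup>2 / 2 + x * (inverse \<theta> * (c * x * exp (- (c * x)))) - d) (at 1)" for d
  proof -
    have "((\<lambda>z. - (c * z * x)) has_real_derivative - (c * x)) (at 1)"
      by (auto intro!: derivative_eq_intros)
    from DERIV_diff[OF DERIV_const DERIV_fun_exp[OF this], of 1]
    have "((\<lambda>z. 1 - exp (- (c * z * x))) has_real_derivative c * x * exp (- (c * x))) (at 1)"
      by (simp add: mult_ac)
    then have ln: "((\<lambda>z. ln (1 - exp (- (c * z * x)))) has_real_derivative inverse \<theta> * (c * x * exp (- (c * x)))) (at 1)"
      using DERIV_ln[OF th] by (intro DERIV_chain2[where f = ln]) (simp_all add: \<theta>_def)
    have lin: "((\<lambda>z. (z - 1) * (c * x\<^sup>2 / 2)) has_real_derivative c * x\<^sup>2 / 2) (at 1)"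
      by (auto intro!: derivative_eq_intros)
    show ?thesis
      unfolding h_def
      using DERIV_diff[OF DERIV_diff[OF DERIV_add[OF lin DERIV_cmult[OF ln]] DERIV_const] DERIV_cmult[OF DERIV_ln[OF zero_less_one]]]
      by simp
  qed
  moreover have "c * x\<^sup>2 / 2 + x * (inverse \<theta> * (c * x * exp (- (c * x)))) = e"
  proof -
    have E: "exp (- (c * x)) = 1 - \<theta>" by (simp add: \<theta>_def)
    have "c * x\<^sup>2 / 2 + x * (inverse \<theta> * (c * x * (1 - \<theta>))) = c * x\<^sup>2 / \<theta> - c * x\<^sup>2 / 2"
      using th by (simp add: field_simps power2_eq_square)
    then show ?thesis unfolding e_def E by simp
  qed
  ultimately have deriv: "(h d has_real_derivative e - d) (at 1)" for d by simp
  obtain s where s: "s > 0" "\<And>t. t > 0 \<Longrightarrow> t < s \<Longrightarrow> h (e + \<epsilon>) (1 + t) < 0"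
    using DERIV_neg_dec_right[OF deriv[of "e + \<epsilon>"]] \<epsilon> h1 by auto
  obtain s' where s': "s' > 0" "\<And>t. t > 0 \<Longrightarrow> t < s' \<Longrightarrow> h (e - \<epsilon>) (1 - t) < 0"
    using DERIV_pos_inc_left[OF deriv[of "e - \<epsilon>"]] \<epsilon> h1 by auto
  define z where "z = 1 + s / 2"
  define z' where "z' = 1 - min (s' / 2) (1 / 2)"
  have z: "z > 1" "h (e + \<epsilon>) z < 0" unfolding z_def using s by auto
  have z': "0 < z'" "z' < 1" "h (e - \<epsilon>) z' < 0" unfolding z'_def using s' by auto
  let ?g = "\<lambda>d z a. gex (p a) (edges (V a))
      (\<lambda>H. of_bool (conn (V a) H) * of_bool (d * real (n a) * ln z \<le> real (card H) * ln z)) / pconn (card (V a)) (p a)"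
  have up: "((\<lambda>a. ?g (e + \<epsilon>) z a) \<longlongrightarrow> 0) F"
    by (rule edge_count_tail[OF V k x]) (use z in \<open>auto simp: h_def\<close>)
  have down: "((\<lambda>a. ?g (e - \<epsilon>) z' a) \<longlongrightarrow> 0) F"
    by (rule edge_count_tail[OF V k x]) (use z' in \<open>auto simp: h_def\<close>)
  from tendsto_add[OF up down] have lim: "((\<lambda>a. ?g (e + \<epsilon>) z a + ?g (e - \<epsilon>) z' a) \<longlongrightarrow> 0) F" by simp
  show ?thesis
  proof (rule tendsto_sandwich[OF _ _ tendsto_const lim])
    show "\<forall>\<^sub>F a in F. 0 \<le> gex (p a) (edges (V a))
      (\<lambda>H. of_bool (conn (V a) H) * of_bool (\<epsilon> * real (n a) \<le> \<bar>real (card H) - real (n a) * e\<bar>)) / pconn (card (V a)) (p a)"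
      using ev_p_pos[OF n pc c] ev_p_less[OF n pc c zero_less_one]
      by eventually_elim (auto intro!: divide_nonneg_nonneg gex_nonneg pconn_nonneg)
    show "\<forall>\<^sub>F a in F. gex (p a) (edges (V a))
      (\<lambda>H. of_bool (conn (V a) H) * of_bool (\<epsilon> * real (n a) \<le> \<bar>real (card H) - real (n a) * e\<bar>)) / pconn (card (V a)) (p a)
      \<le> ?g (e + \<epsilon>) z a + ?g (e - \<epsilon>) z' a"
      using ev_p_pos[OF n pc c] ev_p_less[OF n pc c zero_less_one]
    proof eventually_elim
      case (elim a)
      have "gex (p a) (edges (V a)) (\<lambda>H. of_bool (conn (V a) H) * of_bool (\<epsilon> * real (n a) \<le> \<bar>real (card H) - real (n a) * e\<bar>))
        \<le> gex (p a) (edges (V a)) (\<lambda>H. of_bool (conn (V a) H) * of_bool ((e + \<epsilon>) * real (n a) * ln z \<le> real (card H) * ln z)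
          + of_bool (conn (V a) H) * of_bool ((e - \<epsilon>) * real (n a) * ln z' \<le> real (card H) * ln z'))"
      proof (rule gex_mono)
        fix H :: "nat set set"
        have "(e + \<epsilon>) * real (n a) * ln z \<le> real (card H) * ln z \<or> (e - \<epsilon>) * real (n a) * ln z' \<le> real (card H) * ln z'"
          if "\<epsilon> * real (n a) \<le> \<bar>real (card H) - real (n a) * e\<bar>"
        proof -
          have "(e + \<epsilon>) * real (n a) \<le> real (card H) \<or> real (card H) \<le> (e - \<epsilon>) * real (n a)"
            using that by (auto simp: abs_if algebra_simps split: if_splits)
          then show ?thesis using z z' by (auto intro: mult_right_mono mult_right_mono_neg)
        qed
        then show "of_bool (conn (V a) H) * of_bool (\<epsilon> * real (n a) \<le> \<bar>real (card H) - real (n a) * e\<bar>)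
          \<le> (of_bool (conn (V a) H) * of_bool ((e + \<epsilon>) * real (n a) * ln z \<le> real (card H) * ln z)
          + of_bool (conn (V a) H) * of_bool ((e - \<epsilon>) * real (n a) * ln z' \<le> real (card H) * ln z') :: real)"
          by auto
      qed (use elim in auto)
      then show ?case
        using elim unfolding gex_add add_divide_distrib[symmetric]
        by (intro divide_right_mono) (auto simp: pconn_nonneg)
    qed
  qed
qed

text \<open>For \<open>c * y \<le> 1\<close>, the critical value included,
  \<open>y * (1 - exp (- (c * x))) < x\<close> for all \<open>x > 0\<close>. No size of order
  \<open>n\<close> is exempt from the decay, and a union bound over these sizes gives
  \<open>O(1 / n)\<close>.\<close>

lemma no_big_comp:
  assumes U: "\<forall>\<^sub>F a in F. finite (U a)" and N: "((\<lambda>a. real (card (U a)) / real (n a)) \<longlongrightarrow> y) F"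
    and y: "c * y \<le> 1" and \<epsilon>: "\<epsilon> > 0"
  shows "((\<lambda>a. gex (p a) (edges (U a)) (\<lambda>G. of_bool (\<exists>D\<in>comps (U a) G. \<epsilon> * real (n a) \<le> real (card D)))) \<longlongrightarrow> 0) F"
proof (cases "F = bot")
  case False
  have y0: "y \<ge> 0" by (rule tendsto_lowerbound[OF N _ False]) simp
  have ne: "x \<noteq> y * (1 - exp (- (c * x)))" if "x > 0" for x
  proof -
    have lt: "1 - exp (- (c * x)) < c * x" using exp_gt_one_plus[of "- (c * x)"] that c by simp
    show ?thesis
    proof (cases "y = 0")
      case False
      then have "y * (1 - exp (- (c * x))) < y * (c * x)" using y0 lt by simp
      also have "y * (c * x) \<le> x" using mult_right_mono[OF y, of x] \<open>x > 0\<close> by (simp add: mult_ac)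
      finally show ?thesis by simp
    qed (use \<open>x > 0\<close> in simp)
  qed
  have "\<forall>\<^sub>F a in F. \<forall>k. real k / real (n a) \<in> {\<epsilon>..y + 1} \<longrightarrow> k \<le> card (U a) \<longrightarrow> (real (n a))\<^sup>2 * ncomp (card (U a)) k (p a) \<le> 1"
    using \<epsilon> by (intro ncomp_uniform[OF n pc c N] compact_Icc ne) auto
  then have up: "\<forall>\<^sub>F a in F. gex (p a) (edges (U a)) (\<lambda>G. of_bool (\<exists>D\<in>comps (U a) G. \<epsilon> * real (n a) \<le> real (card D)))
      \<le> (real (card (U a)) / real (n a) + 1 / real (n a)) * (1 / real (n a))"
    using U order_tendstoD(2)[OF N less_add_one] ev_n_ge[OF n, of 1] ev_p_pos[OF n pc c] ev_p_less[OF n pc c zero_less_one]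
  proof eventually_elim
    case (elim a)
    let ?N = "card (U a)"
    let ?S = "{k. k \<le> ?N \<and> \<epsilon> * real (n a) \<le> real k}"
    have "gex (p a) (edges (U a)) (\<lambda>G. of_bool (\<exists>D\<in>comps (U a) G. \<epsilon> * real (n a) \<le> real (card D))) \<le> (\<Sum>k\<in>?S. ncomp ?N k (p a))"
      using elim by (intro first_moment) auto
    also have "\<dots> \<le> real (card ?S) * (1 / (real (n a))\<^sup>2)"
    proof (rule sum_bounded_above)
      fix k assume k: "k \<in> ?S"
      have "real k / real (n a) \<le> real ?N / real (n a)" using k by (intro divide_right_mono) auto
      moreover have "\<epsilon> \<le> real k / real (n a)" using k elim by (simp add: field_simps)
      ultimately have "real k / real (n a) \<in> {\<epsilon>..y + 1}" using elim by auto
      then have "(real (n a))\<^sup>2 * ncomp ?N k (p a) \<le> 1" using elim k by blast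
      then show "ncomp ?N k (p a) \<le> 1 / (real (n a))\<^sup>2" using elim by (simp add: field_simps)
    qed
    also have "\<dots> \<le> (real ?N + 1) * (1 / (real (n a))\<^sup>2)"
    proof -
      have "card ?S \<le> card {..?N}" by (intro card_mono) auto
      then have "real (card ?S) \<le> real ?N + 1" by simp
      then show ?thesis by (intro mult_right_mono) auto
    qed
    finally show ?case unfolding add_divide_distrib[symmetric] by (simp add: power2_eq_square)
  qed
  have "((\<lambda>a. (real (card (U a)) / real (n a) + 1 / real (n a)) * (1 / real (n a))) \<longlongrightarrow> (y + 0) * 0) F"
    by (intro tendsto_intros N inverse_n[OF n])
  then have lim: "((\<lambda>a. (real (card (U a)) / real (n a) + 1 / real (n a)) * (1 / real (n a))) \<longlongrightarrow> 0) F" by simp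
  have lo: "\<forall>\<^sub>F a in F. 0 \<le> gex (p a) (edges (U a)) (\<lambda>G. of_bool (\<exists>D\<in>comps (U a) G. \<epsilon> * real (n a) \<le> real (card D)))"
    using ev_p_pos[OF n pc c] ev_p_less[OF n pc c zero_less_one]
    by eventually_elim (auto intro!: gex_nonneg)
  show ?thesis by (rule tendsto_sandwich[OF lo up tendsto_const lim])
qed simp

end

section \<open>The giant component\<close>

text \<open>The requirements of case (ii) on the components other than the \<open>m\<close> chosen
  ones, stated for the graph on the remaining vertices.\<close>

definition giant :: "nat set \<Rightarrow> nat \<Rightarrow> real \<Rightarrow> real \<Rightarrow> real \<Rightarrow> nat set set \<Rightarrow> bool" where
  "giant U n \<epsilon> v r G \<longleftrightarrow> (\<exists>B\<in>comps U G. \<bar>real (card B) - real n * v\<bar> < real n * \<epsilon> \<and>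
     \<bar>excess G B - real n * r\<bar> < real n * \<epsilon> \<and> (\<forall>D\<in>comps U G - {B}. real (card D) < real n * \<epsilon>))"

lemma excess_eq:
  assumes "G \<subseteq> edges U"
  shows "excess G V = real (card (G \<inter> edges V)) - (real (card V) - 1)"
proof -
  have "{e \<in> G. e \<subseteq> V} = G \<inter> edges V" using assms by (auto simp: edges_def)
  then show ?thesis by (simp add: excess_def)
qed

text \<open>
  Unless no component has nearly \<open>v n\<close> vertices or one of those that do is exceptional, the
  components with nearly \<open>v n\<close> vertices reduce to a single one and have at most \<open>(v + \<eta>) n\<close> vertices
  in total. As this total is at least \<open>(v - \<eta>) n\<close> on average, the former event is rare.
\<close>

lemma giant_bound:
  fixes U :: "nat set" and n :: nat
  assumes p: "0 \<le> p" "p \<le> 1" and U: "finite U" and n: "n \<ge> 1" and v: "v > 0"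
    and \<eta>: "0 < \<eta>" "\<eta> \<le> v / 2" "\<eta> \<le> \<epsilon> / 4" and \<epsilon>n: "1 \<le> \<epsilon> / 4 * real n" and \<delta>: "\<delta> > 0"
    and N: "real (card U) \<le> y * real n"
  defines "T \<equiv> {V. V \<subseteq> U \<and> \<bar>real (card V) / real n - v\<bar> \<le> \<eta>}"
  assumes exc: "\<And>V. V \<in> T \<Longrightarrow> gex p (edges V)
      (\<lambda>H. of_bool (conn V H) * of_bool (\<epsilon> / 4 * real n \<le> \<bar>real (card H) - real n * e\<bar>)) \<le> \<delta> * pconn (card V) p"
    and big: "\<And>V. V \<in> T \<Longrightarrow> gex p (edges (U - V))
      (\<lambda>G. of_bool (\<exists>D\<in>comps (U - V) G. min \<epsilon> (v / 2) * real n \<le> real (card D))) \<le> \<delta>"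
    and mass: "real n * (v - \<eta>) \<le> (\<Sum>k | k \<le> card U \<and> \<bar>real k / real n - v\<bar> \<le> \<eta>. real k * ncomp (card U) k p)"
  shows "gex p (edges U) (\<lambda>G. of_bool (\<not> giant U n \<epsilon> v (e - v) G)) \<le>
    (2 * \<eta> + 4 * y\<^sup>2 / v * \<delta>) / v + 4 * y / v * \<delta>"
proof -
  define S where "S = {k. k \<le> card U \<and> \<bar>real k / real n - v\<bar> \<le> \<eta>}"
  have finS: "finite S" by (simp add: S_def)
  have T: "T = {V. V \<subseteq> U \<and> card V \<in> S}"
    using card_mono[OF U] by (auto simp: T_def S_def)
  have finT: "finite T" using U by (simp add: T)
  have y: "y \<ge> 0" using N n by (metis mult_le_cancel_right of_nat_0_le_iff of_nat_0_less_iff order.trans mult_zero_left less_le_trans zero_less_one not_less)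
  let ?P = "\<lambda>V. gex p (edges U) (\<lambda>G. of_bool (V \<in> comps U G))"
  define E where "E V G = (of_bool (\<epsilon> / 4 * real n \<le> \<bar>real (card (G \<inter> edges V)) - real n * e\<bar>) :: real)" for V G
  define B where "B V G = (of_bool (\<exists>D\<in>comps (U - V) (G \<inter> edges (U - V)). min \<epsilon> (v / 2) * real n \<le> real (card D)) :: real)" for V G
  \<comment> \<open>\<open>Z\<close> counts the exceptional components: \<open>E\<close> marks a
    wrong number of edges, \<open>B\<close> a further big component. As a count, it is below 1 only
    if nothing is exceptional.\<close>
  define Z where "Z G = (\<Sum>V\<in>T. of_bool (V \<in> comps U G) * E V G + of_bool (V \<in> comps U G) * B V G)" for G
  define none where "none G = (of_bool (\<forall>V\<in>T. V \<notin> comps U G) :: real)" for G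
  have Z0: "Z G \<ge> 0" for G by (auto simp: Z_def E_def B_def intro!: sum_nonneg)
  have finV: "finite V" if "V \<in> T" for V using that U finite_subset by (auto simp: T_def)
  have Pq: "?P V = pconn (card V) p * (1 - p) ^ (card V * (card U - card V))" if "V \<in> T" for V
    using gex_comp[OF U, of V p "\<lambda>_. 1" "\<lambda>_. 1"] that finV[OF that] U
    by (simp add: T_def gex_conn gex_const finite_edges)
  have EV: "gex p (edges U) (\<lambda>G. of_bool (V \<in> comps U G) * E V G) \<le> \<delta> * ?P V" if "V \<in> T" for V
  proof -
    have VU: "V \<subseteq> U" using that by (simp add: T_def)
    have "gex p (edges U) (\<lambda>G. of_bool (V \<in> comps U G) * E V G) =
      gex p (edges V) (\<lambda>H. of_bool (conn V H) * of_bool (\<epsilon> / 4 * real n \<le> \<bar>real (card H) - real n * e\<bar>)) *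
      (1 - p) ^ (card V * (card U - card V))"
      using gex_comp[OF U VU, of p "\<lambda>H. of_bool (\<epsilon> / 4 * real n \<le> \<bar>real (card H) - real n * e\<bar>)" "\<lambda>_. 1"] U
      by (simp add: E_def gex_const finite_edges)
    also have "\<dots> \<le> (\<delta> * pconn (card V) p) * (1 - p) ^ (card V * (card U - card V))"
      using exc[OF that] p by (intro mult_right_mono) auto
    finally show ?thesis using Pq[OF that] by simp
  qed
  have BV: "gex p (edges U) (\<lambda>G. of_bool (V \<in> comps U G) * B V G) \<le> \<delta> * ?P V" if "V \<in> T" for V
  proof -
    have VU: "V \<subseteq> U" using that by (simp add: T_def)
    have "gex p (edges U) (\<lambda>G. of_bool (V \<in> comps U G) * B V G) = ?P V *
      gex p (edges (U - V)) (\<lambda>G. of_bool (\<exists>D\<in>comps (U - V) G. min \<epsilon> (v / 2) * real n \<le> real (card D)))"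
      using gex_comp[OF U VU, of p "\<lambda>_. 1" "\<lambda>G. of_bool (\<exists>D\<in>comps (U - V) G. min \<epsilon> (v / 2) * real n \<le> real (card D))"]
        Pq[OF that] finV[OF that]
      by (simp add: B_def gex_conn)
    also have "\<dots> \<le> ?P V * \<delta>"
      using big[OF that] p by (intro mult_left_mono gex_nonneg) auto
    finally show ?thesis by (simp add: mult_ac)
  qed
  \<comment> \<open>Members of \<open>T\<close> have at least \<open>v n / 2\<close> vertices, and
    all components together at most \<open>y n\<close>.\<close>
  have sumP: "(\<Sum>V\<in>T. ?P V) \<le> 2 * y / v"
  proof -
    have "(\<Sum>V\<in>T. ?P V) = (\<Sum>k\<in>S. ncomp (card U) k p)"
      using sum_comps_rest[OF U finS, of "\<lambda>_. 1" p] by (simp add: T)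
    also have "\<dots> \<le> (\<Sum>k\<in>S. 2 / (real n * v) * (real k * ncomp (card U) k p))"
    proof (rule sum_mono)
      fix k assume "k \<in> S"
      then have "v - \<eta> \<le> real k / real n" by (auto simp: S_def)
      then have "v / 2 \<le> real k / real n" using \<eta> by linarith
      then have "1 \<le> 2 / (real n * v) * real k" using n v by (simp add: field_simps)
      then have "1 * ncomp (card U) k p \<le> (2 / (real n * v) * real k) * ncomp (card U) k p"
        using p by (intro mult_right_mono ncomp_nonneg)
      then show "ncomp (card U) k p \<le> 2 / (real n * v) * (real k * ncomp (card U) k p)" by (simp add: mult_ac)
    qed
    also have "\<dots> = 2 / (real n * v) * (\<Sum>k\<in>S. real k * ncomp (card U) k p)"
      by (simp add: sum_distrib_left)
    also have "\<dots> \<le> 2 / (real n * v) * (\<Sum>k\<le>card U. real k * ncomp (card U) k p)"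
      using n v p by (intro mult_left_mono sum_mono2) (auto simp: S_def ncomp_nonneg)
    also have "\<dots> = 2 / (real n * v) * real (card U)" using p by (simp add: sum_ncomp)
    also have "\<dots> \<le> 2 / (real n * v) * (y * real n)" using n v N by (intro mult_left_mono) auto
    also have "\<dots> = 2 * y / v" using n v by simp
    finally show ?thesis .
  qed
  have EZ: "gex p (edges U) Z \<le> 4 * y / v * \<delta>"
  proof -
    have "gex p (edges U) Z = (\<Sum>V\<in>T. gex p (edges U) (\<lambda>G. of_bool (V \<in> comps U G) * E V G) +
        gex p (edges U) (\<lambda>G. of_bool (V \<in> comps U G) * B V G))"
      unfolding Z_def by (simp only: gex_sum gex_add)
    also have "\<dots> \<le> (\<Sum>V\<in>T. 2 * \<delta> * ?P V)"
      using EV BV by (intro sum_mono) (fastforce simp: mult.assoc)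
    also have "\<dots> = 2 * \<delta> * (\<Sum>V\<in>T. ?P V)" by (simp add: sum_distrib_left)
    also have "\<dots> \<le> 2 * \<delta> * (2 * y / v)" using sumP \<delta> by (intro mult_left_mono) auto
    finally show ?thesis by (simp add: mult_ac)
  qed
  have cards: "v * real n / 2 \<le> real (card V)" "real (card V) \<le> (v + \<eta>) * real n"
    "\<bar>real (card V) - real n * v\<bar> \<le> \<epsilon> / 4 * real n" if "V \<in> T" for V
  proof -
    have "\<bar>real (card V) / real n - v\<bar> \<le> \<eta>" using that by (simp add: T_def)
    then have "\<bar>real (card V) / real n - v\<bar> * real n \<le> \<eta> * real n" by (intro mult_right_mono) auto
    then have *: "\<bar>real (card V) - real n * v\<bar> \<le> \<eta> * real n"
    proof -
      have "real (card V) - real n * v = (real (card V) / real n - v) * real n"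
        using n by (simp add: field_simps)
      then show ?thesis using \<open>\<bar>real (card V) / real n - v\<bar> * real n \<le> \<eta> * real n\<close>
        by (simp add: abs_mult)
    qed
    have h: "\<eta> * real n \<le> v / 2 * real n" "\<eta> * real n \<le> \<epsilon> / 4 * real n"
      using mult_right_mono[OF \<eta>(2), of "real n"] mult_right_mono[OF \<eta>(3), of "real n"] by simp_all
    show "\<bar>real (card V) - real n * v\<bar> \<le> \<epsilon> / 4 * real n" using * h(2) by linarith
    show "v * real n / 2 \<le> real (card V)" "real (card V) \<le> (v + \<eta>) * real n"
      using * h(1) by (simp_all add: abs_le_iff algebra_simps)
  qed
  \<comment> \<open>The bound \<open>v / 2\<close> in the threshold rules out a second component
    from \<open>T\<close>; the bound \<open>\<epsilon>\<close> is the one required by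
    \<open>giant\<close>.\<close>
  have others: "real (card D) < min \<epsilon> (v / 2) * real n"
    if "V \<in> comps U G" "V \<in> T" "D \<in> comps U G" "D \<noteq> V" "B V G = 0" "G \<subseteq> edges U" for V D G
  proof -
    have "D \<in> comps (U - V) (G \<inter> edges (U - V))"
      using comps_rest[of G U "{()}" "\<lambda>_. V"] that by auto
    then show ?thesis using that(5) by (auto simp: B_def not_le)
  qed
  have pos_small: "E V G = 0 \<and> B V G = 0" if "V \<in> comps U G" "V \<in> T" "Z G < 1" for V G
  proof -
    have "of_bool (V \<in> comps U G) * E V G + of_bool (V \<in> comps U G) * B V G \<le> Z G"
      unfolding Z_def using finT that by (intro member_le_sum) (auto simp: E_def B_def)
    then have "E V G + B V G \<le> Z G" using that(1) by simp
    moreover have "E V G = 0 \<or> E V G = 1" "B V G = 0 \<or> B V G = 1" by (auto simp: E_def B_def)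
    ultimately show ?thesis using that(3) by auto
  qed
  have pw1: "of_bool (\<not> giant U n \<epsilon> v (e - v) G) \<le> none G + Z G" if G: "G \<subseteq> edges U" for G
  proof (cases "none G = 1 \<or> Z G \<ge> 1")
    case True
    then show ?thesis using Z0[of G] by (auto simp: none_def)
  next
    case False
    then obtain V where V: "V \<in> T" "V \<in> comps U G" by (auto simp: none_def split: if_splits)
    then have EB: "E V G = 0" "B V G = 0" using pos_small False by auto
    have "giant U n \<epsilon> v (e - v) G"
      unfolding giant_def
    proof (intro bexI[OF _ V(2)] conjI ballI)
      show "\<bar>real (card V) - real n * v\<bar> < real n * \<epsilon>"
        using cards(3)[OF V(1)] \<epsilon>n by (simp add: mult.commute)
      have "\<bar>real (card (G \<inter> edges V)) - real n * e\<bar> < \<epsilon> / 4 * real n" using EB(1) by (auto simp: E_def not_le)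
      \<comment> \<open>The error in the excess is that of the edges plus that of the size plus the
        constant 1, each at most a quarter of \<open>\<epsilon> n\<close>.\<close>
      moreover have "\<bar>a - (k - 1) - (b - d)\<bar> < 4 * m"
        if "\<bar>a - b\<bar> < m" "\<bar>k - d\<bar> \<le> m" "1 \<le> m" for a b k d m :: real
        using that by linarith
      ultimately have "\<bar>real (card (G \<inter> edges V)) - (real (card V) - 1) - (real n * e - real n * v)\<bar>
          < 4 * (\<epsilon> / 4 * real n)"
        using cards(3)[OF V(1)] \<epsilon>n by blast
      then show "\<bar>excess G V - real n * (e - v)\<bar> < real n * \<epsilon>"
        unfolding excess_eq[OF G] by (simp add: right_diff_distrib mult.commute)
      fix D assume "D \<in> comps U G - {V}"
      then have "real (card D) < min \<epsilon> (v / 2) * real n" using others[OF V(2,1) _ _ EB(2) G] by auto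
      also have "\<dots> \<le> \<epsilon> * real n" by (intro mult_right_mono) auto
      finally show "real (card D) < real n * \<epsilon>" by (simp add: mult.commute)
    qed
    then show ?thesis using Z0[of G] by (simp add: none_def)
  qed
  \<comment> \<open>The left side is 0 if no member of \<open>T\<close> is a component and at most
    \<open>card U\<close> always. If one is and nothing is exceptional, it is the size of a single
    component.\<close>
  have pw2: "(\<Sum>V\<in>T. real (card V) * of_bool (V \<in> comps U G)) \<le> (v + \<eta>) * real n * (1 - none G) + real (card U) * Z G"
    if G: "G \<subseteq> edges U" for G
  proof -
    have le_card: "(\<Sum>V\<in>T. real (card V) * of_bool (V \<in> comps U G)) \<le> real (card U)"
    proof -
      have "(\<Sum>V\<in>T. real (card V) * of_bool (V \<in> comps U G)) = (\<Sum>V\<in>T \<inter> comps U G. real (card V))"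
        using finT by (intro sum.mono_neutral_cong_right) auto
      also have "\<dots> \<le> (\<Sum>V\<in>comps U G. real (card V))"
        using finite_comps[OF U] by (intro sum_mono2) auto
      also have "\<dots> = real (card U)" using sum_card_comps[OF U G] by (simp flip: of_nat_sum)
      finally show ?thesis .
    qed
    consider "none G = 1" | "Z G \<ge> 1" | "none G \<noteq> 1" "Z G < 1" by linarith
    then show ?thesis
    proof cases
      case 1
      then have "\<forall>V\<in>T. V \<notin> comps U G" by (auto simp: none_def split: if_splits)
      then have "(\<Sum>V\<in>T. real (card V) * of_bool (V \<in> comps U G)) = 0" by (intro sum.neutral) auto
      then show ?thesis using 1 Z0[of G] by simp
    next
      case 2
      have "real (card U) * 1 \<le> real (card U) * Z G" using 2 by (intro mult_left_mono) auto
      moreover have "0 \<le> (v + \<eta>) * real n * (1 - none G)" using v \<eta> by (auto simp: none_def)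
      ultimately show ?thesis using le_card by linarith
    next
      case 3
      then obtain V where V: "V \<in> T" "V \<in> comps U G" by (auto simp: none_def split: if_splits)
      then have EB: "B V G = 0" using pos_small 3 by auto
      have "D = V" if "D \<in> T" "D \<in> comps U G" for D
      proof (rule ccontr)
        assume "D \<noteq> V"
        then have "real (card D) < min \<epsilon> (v / 2) * real n" using others[OF V(2,1) that(2) _ EB G] by auto
        also have "\<dots> \<le> v / 2 * real n" by (intro mult_right_mono) auto
        finally show False using cards(1)[OF that(1)] by simp
      qed
      then have uniq: "D \<notin> comps U G" if "D \<in> T - {V}" for D using that by blast
      have "(\<Sum>V\<in>T. real (card V) * of_bool (V \<in> comps U G)) = (\<Sum>D\<in>{V}. real (card D) * of_bool (D \<in> comps U G))"
      proof (rule sum.mono_neutral_right[OF finT])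
        show "\<forall>D\<in>T - {V}. real (card D) * of_bool (D \<in> comps U G) = 0" using uniq by simp
      qed (use V in simp)
      also have "\<dots> \<le> (v + \<eta>) * real n" using V cards(2)[OF V(1)] by simp
      also have "\<dots> \<le> (v + \<eta>) * real n * (1 - none G) + real (card U) * Z G"
      proof -
        have "none G = 0" using V by (auto simp: none_def)
        then show ?thesis using Z0[of G] by simp
      qed
      finally show ?thesis .
    qed
  qed
  define P0 where "P0 = gex p (edges U) none"
  have fE: "finite (edges U)" by (rule finite_edges[OF U])
  \<comment> \<open>Taking expectations in \<open>pw2\<close>: the average is at least
    \<open>(v - \<eta>) n\<close>, but at most \<open>(v + \<eta>) n (1 - P0)\<close> plus a small
    term. This bounds \<open>P0\<close> by a multiple of \<open>\<eta>\<close> and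
    \<open>\<delta>\<close>.\<close>
  have "real n * (v - \<eta>) \<le> (\<Sum>k\<in>S. real k * ncomp (card U) k p)" using mass by (simp add: S_def)
  also have "\<dots> = (\<Sum>V\<in>T. real (card V) * ?P V)" using sum_comps_rest[OF U finS, of real p] by (simp add: T)
  also have "\<dots> = gex p (edges U) (\<lambda>G. \<Sum>V\<in>T. real (card V) * of_bool (V \<in> comps U G))"
    by (simp only: gex_sum gex_cmult)
  also have "\<dots> \<le> gex p (edges U) (\<lambda>G. (v + \<eta>) * real n * (1 - none G) + real (card U) * Z G)"
    by (rule gex_mono[OF p pw2])
  also have "\<dots> = (v + \<eta>) * real n * (1 - P0) + real (card U) * gex p (edges U) Z"
    by (simp add: gex_add gex_cmult gex_diff gex_const[OF fE] P0_def)
  also have "\<dots> \<le> (v + \<eta>) * real n * (1 - P0) + (y * real n) * (4 * y / v * \<delta>)"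
    using y by (intro add_left_mono mult_mono[OF N EZ] gex_nonneg[OF p Z0]) simp
  finally have "real n * ((v + \<eta>) * P0) \<le> real n * (2 * \<eta> + 4 * y\<^sup>2 / v * \<delta>)"
    by (simp add: algebra_simps power2_eq_square)
  then have "(v + \<eta>) * P0 \<le> 2 * \<eta> + 4 * y\<^sup>2 / v * \<delta>" using n by simp
  moreover have "v * P0 \<le> (v + \<eta>) * P0"
  proof (rule mult_right_mono)
    show "0 \<le> P0" unfolding P0_def by (rule gex_nonneg[OF p]) (simp add: none_def)
  qed (use \<eta>(1) in simp)
  ultimately have "v * P0 \<le> 2 * \<eta> + 4 * y\<^sup>2 / v * \<delta>" by linarith
  then have P0: "P0 \<le> (2 * \<eta> + 4 * y\<^sup>2 / v * \<delta>) / v" using v by (simp add: field_simps)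
  have "gex p (edges U) (\<lambda>G. of_bool (\<not> giant U n \<epsilon> v (e - v) G)) \<le> gex p (edges U) (\<lambda>G. none G + Z G)"
    by (rule gex_mono[OF p pw1])
  also have "\<dots> = P0 + gex p (edges U) Z" by (simp add: gex_add P0_def)
  finally show ?thesis using P0 EZ by linarith
qed

context
  fixes F :: "'a filter" and n :: "'a \<Rightarrow> nat" and p :: "'a \<Rightarrow> real" and c :: real
  assumes n: "filterlim n at_top F"
    and pc: "((\<lambda>a. real (n a) * p a) \<longlongrightarrow> c) F" and c: "c > 0"
begin

text \<open>\<open>giant_bound\<close> needs its two conditional estimates for all sets
  \<open>V\<close> of nearly \<open>v n\<close> vertices at once. They come from
  \<open>edge_count_concentration\<close> and \<open>no_big_comp\<close> along the filter of pairs
  of an index and such a set.\<close>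

lemma giant_whp:
  assumes U: "\<And>a. finite (U a)" and N: "((\<lambda>a. real (card (U a)) / real (n a)) \<longlongrightarrow> y) F"
    and v: "v > 0" "v = y * (1 - exp (- (c * v)))" and \<epsilon>: "\<epsilon> > 0"
  defines "e \<equiv> c * v\<^sup>2 / (1 - exp (- (c * v))) - c * v\<^sup>2 / 2"
  shows "((\<lambda>a. gex (p a) (edges (U a)) (\<lambda>G. of_bool (\<not> giant (U a) (n a) \<epsilon> v (e - v) G))) \<longlongrightarrow> 0) F"
proof (rule tendstoI)
  fix h :: real assume h: "h > 0"
  have th: "1 - exp (- (c * v)) > 0" using c v by simp
  have y: "y > 0" using v th by (metis zero_less_mult_pos2)
  \<comment> \<open>The bound of \<open>giant_bound\<close> with \<open>y + 1\<close> for
    \<open>y\<close> is at most \<open>\<delta> * C\<close> once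
    \<open>\<eta> \<le> \<delta>\<close>.\<close>
  define C where "C = (2 + 4 * (y + 1)\<^sup>2 / v) / v + 4 * (y + 1) / v"
  have C: "C > 0" unfolding C_def using y v by (intro add_pos_pos divide_pos_pos) auto
  define \<delta> where "\<delta> = h / (2 * C)"
  have \<delta>: "\<delta> > 0" "\<delta> * C < h" using h C by (auto simp: \<delta>_def)
  \<comment> \<open>The graph left after removing the giant component is not supercritical. With
    \<open>E = exp (- (c * v))\<close> one has \<open>y - v = y * E\<close>, and
    \<open>1 + c * v \<le> exp (c * v)\<close> yields \<open>c * y * E \<le> 1\<close>.\<close>
  have sub: "c * (y - v) \<le> 1"
  proof -
    have "1 + c * v \<le> exp (c * v)" by (rule exp_ge_add_one_self)
    then have "exp (- (c * v)) * (1 + c * v) \<le> exp (- (c * v)) * exp (c * v)" by (intro mult_left_mono) auto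
    then have le: "exp (- (c * v)) * (c * v) \<le> 1 - exp (- (c * v))" by (simp add: algebra_simps flip: exp_add)
    define E where "E = exp (- (c * v))"
    have vE: "v = y * (1 - E)" using v(2) by (simp add: E_def)
    have "E * (c * v) \<le> 1 - E" using le by (simp add: E_def)
    then have "(E * c * y) * (1 - E) \<le> 1 * (1 - E)" unfolding vE by (simp add: mult_ac)
    then have "E * c * y \<le> 1" using th by (simp add: E_def)
    moreover have "y - v = y * E" using vE by (simp add: algebra_simps)
    ultimately show ?thesis by (simp add: mult_ac)
  qed
  let ?r = "\<lambda>a V. real (card V) / real (n a)"
  let ?E = "\<lambda>a V. gex (p a) (edges V)
      (\<lambda>H. of_bool (conn V H) * of_bool (\<epsilon> / 4 * real (n a) \<le> \<bar>real (card H) - real (n a) * e\<bar>))"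
  let ?B = "\<lambda>a V. gex (p a) (edges (U a - V))
      (\<lambda>G. of_bool (\<exists>D\<in>comps (U a - V) G. min \<epsilon> (v / 2) * real (n a) \<le> real (card D)))"
  define F' where "F' = inf (at_limit F ?r v) (principal {z. snd z \<subseteq> U (fst z)})"
  have F': "F' \<le> at_limit F ?r v" by (simp add: F'_def)
  have sn: "\<forall>\<^sub>F z in F'. snd z \<subseteq> U (fst z)" unfolding F'_def eventually_inf_principal by simp
  then have fin: "\<forall>\<^sub>F z in F'. finite (snd z)" by eventually_elim (use U finite_subset in blast)
  have n': "filterlim (\<lambda>z. n (fst z)) sequentially F'"
    using filterlim_mono[OF filterlim_at_limit_fst[OF n] order_refl F'] .
  have pc': "((\<lambda>z. real (n (fst z)) * p (fst z)) \<longlongrightarrow> c) F'"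
    using filterlim_mono[OF filterlim_at_limit_fst[OF pc] order_refl F'] .
  have N': "((\<lambda>z. real (card (U (fst z))) / real (n (fst z))) \<longlongrightarrow> y) F'"
    using filterlim_mono[OF filterlim_at_limit_fst[OF N] order_refl F'] .
  have k': "((\<lambda>z. real (card (snd z)) / real (n (fst z))) \<longlongrightarrow> v) F'"
    using filterlim_mono[OF tendsto_at_limit[of ?r] order_refl F'] .
  have R': "((\<lambda>z. real (card (U (fst z) - snd z)) / real (n (fst z))) \<longlongrightarrow> y - v) F'"
  proof (rule Lim_transform_eventually[OF tendsto_diff[OF N' k']])
    show "\<forall>\<^sub>F z in F'. real (card (U (fst z))) / real (n (fst z)) - real (card (snd z)) / real (n (fst z))
        = real (card (U (fst z) - snd z)) / real (n (fst z))"
      using sn fin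
    proof eventually_elim
      case (elim z)
      then have "card (U (fst z) - snd z) = card (U (fst z)) - card (snd z)" "card (snd z) \<le> card (U (fst z))"
        using U by (auto intro: card_Diff_subset card_mono)
      then show ?case by (simp add: of_nat_diff diff_divide_distrib)
    qed
  qed
  have "((\<lambda>z. ?E (fst z) (snd z) / pconn (card (snd z)) (p (fst z))) \<longlongrightarrow> 0) F'"
    unfolding e_def using \<epsilon> by (intro edge_count_concentration[OF n' pc' c fin k' v(1)]) simp
  then have "\<forall>\<^sub>F z in F'. ?E (fst z) (snd z) / pconn (card (snd z)) (p (fst z)) < \<delta>"
    using order_tendstoD(2) \<delta>(1) by blast
  moreover have "((\<lambda>z. ?B (fst z) (snd z)) \<longlongrightarrow> 0) F'"
    using \<epsilon> v U by (intro no_big_comp[OF n' pc' c _ R' sub]) auto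
  then have "\<forall>\<^sub>F z in F'. ?B (fst z) (snd z) < \<delta>"
    using order_tendstoD(2) \<delta>(1) by blast
  ultimately have "\<forall>\<^sub>F z in F'. ?E (fst z) (snd z) \<le> \<delta> * pconn (card (snd z)) (p (fst z)) \<and> ?B (fst z) (snd z) \<le> \<delta>"
    using ev_k_ge[OF n' k' v(1)] ev_p_pos[OF n' pc' c] ev_p_less[OF n' pc' c zero_less_one]
  proof eventually_elim
    case (elim z)
    have "pconn (card (snd z)) (p (fst z)) > 0" using elim by (intro pconn_pos) auto
    then show ?case using elim by (simp add: pos_divide_less_eq)
  qed
  then have "\<forall>\<^sub>F z in at_limit F ?r v. snd z \<subseteq> U (fst z) \<longrightarrow>
      ?E (fst z) (snd z) \<le> \<delta> * pconn (card (snd z)) (p (fst z)) \<and> ?B (fst z) (snd z) \<le> \<delta>"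
    unfolding F'_def eventually_inf_principal by simp
  then obtain s where s: "s > 0"
    and good: "\<forall>\<^sub>F a in F. \<forall>V. \<bar>real (card V) / real (n a) - v\<bar> \<le> s \<longrightarrow> V \<subseteq> U a \<longrightarrow>
      ?E a V \<le> \<delta> * pconn (card V) (p a) \<and> ?B a V \<le> \<delta>"
    by (rule eventually_at_limitD) auto
  define \<eta> where "\<eta> = min (min s \<delta>) (min (v / 2) (\<epsilon> / 4))"
  have \<eta>: "0 < \<eta>" "\<eta> \<le> s" "\<eta> \<le> \<delta>" "\<eta> \<le> v / 2" "\<eta> \<le> \<epsilon> / 4"
    using s \<delta> v \<epsilon> by (auto simp: \<eta>_def)
  have "\<forall>\<^sub>F a in F. real (n a) * (v - \<eta>) \<le>
    (\<Sum>k | k \<le> card (U a) \<and> \<bar>real k / real (n a) - v\<bar> \<le> \<eta>. real k * ncomp (card (U a)) k (p a))"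
    by (rule near_mass[OF n pc c N v \<eta>(1)])
  then show "\<forall>\<^sub>F a in F. dist (gex (p a) (edges (U a)) (\<lambda>G. of_bool (\<not> giant (U a) (n a) \<epsilon> v (e - v) G))) 0 < h"
    using good order_tendstoD(2)[OF N less_add_one] ev_n_ge[OF n, of 1] ev_n_real_ge[OF n, of "4 / \<epsilon>"]
      ev_p_pos[OF n pc c] ev_p_less[OF n pc c zero_less_one]
  proof eventually_elim
    case (elim a)
    let ?g = "gex (p a) (edges (U a)) (\<lambda>G. of_bool (\<not> giant (U a) (n a) \<epsilon> v (e - v) G))"
    have p: "0 \<le> p a" "p a \<le> 1" using elim by auto
    have "?g \<le> (2 * \<eta> + 4 * (y + 1)\<^sup>2 / v * \<delta>) / v + 4 * (y + 1) / v * \<delta>"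
    proof (rule giant_bound[OF p U _ v(1) \<eta>(1,4,5) _ \<delta>(1)])
      show "1 \<le> n a" using elim by simp
      show "1 \<le> \<epsilon> / 4 * real (n a)" using elim \<epsilon> by (simp add: field_simps)
      show "real (card (U a)) \<le> (y + 1) * real (n a)" using elim by (simp add: field_simps)
    next
      fix V assume "V \<in> {V. V \<subseteq> U a \<and> \<bar>real (card V) / real (n a) - v\<bar> \<le> \<eta>}"
      then have "V \<subseteq> U a" "\<bar>real (card V) / real (n a) - v\<bar> \<le> s" using \<eta>(2) by auto
      then show "?E a V \<le> \<delta> * pconn (card V) (p a)" "?B a V \<le> \<delta>" using elim by blast+
    next
      show "real (n a) * (v - \<eta>) \<le>
        (\<Sum>k | k \<le> card (U a) \<and> \<bar>real k / real (n a) - v\<bar> \<le> \<eta>. real k * ncomp (card (U a)) k (p a))"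
        using elim by blast
    qed
    also have "\<dots> \<le> (2 * \<delta> + 4 * (y + 1)\<^sup>2 / v * \<delta>) / v + 4 * (y + 1) / v * \<delta>"
      using \<eta>(3) v by (intro add_right_mono divide_right_mono) auto
    also have "\<dots> = \<delta> * C" by (simp add: C_def add_divide_distrib algebra_simps)
    also have "\<dots> < h" by (rule \<delta>(2))
    finally have "?g < h" .
    moreover have "0 \<le> ?g" using p by (intro gex_nonneg) auto
    ultimately show ?case by simp
  qed
qed

end

section \<open>Tuples of components\<close>

definition tuples :: "'i set \<Rightarrow> nat set \<Rightarrow> ('i \<Rightarrow> nat set) set" where
  "tuples I U = {V \<in> I \<rightarrow>\<^sub>E Pow U. disjoint_family_on V I}"

definition profile_tuples :: "'i set \<Rightarrow> nat set \<Rightarrow> ('i \<Rightarrow> nat) \<Rightarrow> ('i \<Rightarrow> nat set) set" where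
  "profile_tuples I U k = {V \<in> tuples I U. \<forall>i\<in>I. card (V i) = k i}"

text \<open>The probability that all \<open>V i\<close> are components, by
  \<open>gex_all_comps\<close>; it depends only on their sizes, by
  \<open>comps_prob_cong\<close>.\<close>

definition comps_prob :: "real \<Rightarrow> nat set \<Rightarrow> 'i set \<Rightarrow> ('i \<Rightarrow> nat set) \<Rightarrow> real" where
  "comps_prob p U I V = (\<Prod>i\<in>I. pconn (card (V i)) p) * (1 - p) ^ card (cross_pairs U I V)"

lemma finite_tuples: "finite I \<Longrightarrow> finite U \<Longrightarrow> finite (tuples I U)"
  unfolding tuples_def by (intro finite_Collect_conjI disjI1) (simp add: finite_PiE)

lemma tuplesD:
  assumes "V \<in> tuples I U"
  shows "\<And>i. i \<in> I \<Longrightarrow> V i \<subseteq> U" "disjoint_family_on V I"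
  using assms by (auto simp: tuples_def PiE_def Pi_def)

lemma mem_profile_tuples:
  "V \<in> profile_tuples I U k \<longleftrightarrow> (\<forall>i\<in>I. V i \<subseteq> U \<and> card (V i) = k i) \<and>
    (\<forall>i. i \<notin> I \<longrightarrow> V i = undefined) \<and> (\<forall>i\<in>I. \<forall>j\<in>I. i \<noteq> j \<longrightarrow> V i \<inter> V j = {})"
  by (auto simp: profile_tuples_def tuples_def disjoint_family_on_def PiE_iff extensional_def)

text \<open>The multinomial coefficient, in product form to avoid division. In the induction the set
  \<open>V i\<close> is chosen first, and the other sets form a tuple in its complement.\<close>

lemma card_profile_tuples:
  assumes "finite I" "finite U" "(\<Sum>i\<in>I. k i) \<le> card U"
  shows "card (profile_tuples I U k) * (\<Prod>i\<in>I. fact (k i)) * fact (card U - (\<Sum>i\<in>I. k i)) = (fact (card U) :: nat)"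
  using assms
proof (induction I arbitrary: U rule: finite_induct)
  case empty
  have "profile_tuples {} U k = {\<lambda>_. undefined}"
    by (auto simp: profile_tuples_def tuples_def disjoint_family_on_def)
  then show ?case by simp
next
  case (insert i I)
  let ?A = "{A. A \<subseteq> U \<and> card A = k i}"
  have ki: "k i \<le> card U" using insert.prems insert.hyps by simp
  have finT: "finite (profile_tuples I (U - A) k)" for A
    using finite_tuples[OF insert.hyps(1), of "U - A"] insert.prems(1) by (simp add: profile_tuples_def)
  \<comment> \<open>Resetting the entry at \<open>i\<close> to \<open>undefined\<close> keeps the
    remaining tuple extensional on the smaller index set.\<close>
  have "bij_betw (\<lambda>V. (V i, V(i := undefined))) (profile_tuples (insert i I) U k)
      (SIGMA A:?A. profile_tuples I (U - A) k)"
  proof (rule bij_betw_byWitness[where f' = "\<lambda>(A, V). V(i := A)"])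
    show "(\<lambda>V. (V i, V(i := undefined))) ` profile_tuples (insert i I) U k \<subseteq> (SIGMA A:?A. profile_tuples I (U - A) k)"
    proof (rule image_subsetI)
      fix V assume V: "V \<in> profile_tuples (insert i I) U k"
      note V = V[unfolded mem_profile_tuples]
      have sub: "\<forall>j\<in>insert i I. V j \<subseteq> U \<and> card (V j) = k j" by (rule conjunct1[OF V])
      have ext: "\<forall>j. j \<notin> insert i I \<longrightarrow> V j = undefined" by (rule conjunct1[OF conjunct2[OF V]])
      have disj: "\<forall>j\<in>insert i I. \<forall>l\<in>insert i I. j \<noteq> l \<longrightarrow> V j \<inter> V l = {}"
        by (rule conjunct2[OF conjunct2[OF V]])
      have "V j \<subseteq> U - V i" if "j \<in> I" for j
      proof -
        have "j \<noteq> i" using that insert.hyps(2) by auto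
        then have "V j \<inter> V i = {}" using disj[rule_format, of j i] that by simp
        moreover have "V j \<subseteq> U" using sub[rule_format, of j] that by simp
        ultimately show ?thesis by blast
      qed
      then have "V(i := undefined) \<in> profile_tuples I (U - V i) k"
        unfolding mem_profile_tuples using sub ext disj insert.hyps(2) by simp
      then show "(V i, V(i := undefined)) \<in> (SIGMA A:?A. profile_tuples I (U - A) k)"
        using sub by simp
    qed
    show "(\<lambda>(A, V). V(i := A)) ` (SIGMA A:?A. profile_tuples I (U - A) k) \<subseteq> profile_tuples (insert i I) U k"
    proof (rule image_subsetI, clarify)
      fix A V assume A: "A \<subseteq> U" "card A = k i" and V: "V \<in> profile_tuples I (U - A) k"
      note V = V[unfolded mem_profile_tuples]
      have sub: "\<forall>j\<in>I. V j \<subseteq> U - A \<and> card (V j) = k j" by (rule conjunct1[OF V])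
      have ext: "\<forall>j. j \<notin> I \<longrightarrow> V j = undefined" by (rule conjunct1[OF conjunct2[OF V]])
      have disj: "\<forall>j\<in>I. \<forall>l\<in>I. j \<noteq> l \<longrightarrow> V j \<inter> V l = {}"
        by (rule conjunct2[OF conjunct2[OF V]])
      have "V j \<inter> A = {}" "A \<inter> V j = {}" "V j \<subseteq> U" if "j \<in> I" for j
        using sub[rule_format, OF that] by auto
      then show "V(i := A) \<in> profile_tuples (insert i I) U k"
        unfolding mem_profile_tuples using A sub ext disj insert.hyps(2) by simp
    qed
    show "\<forall>V\<in>profile_tuples (insert i I) U k. (case (V i, V(i := undefined)) of (A, V) \<Rightarrow> V(i := A)) = V"
      by simp
    show "\<forall>z\<in>SIGMA A:?A. profile_tuples I (U - A) k.
        ((case z of (A, V) \<Rightarrow> V(i := A)) i, (case z of (A, V) \<Rightarrow> V(i := A))(i := undefined)) = z"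
    proof
      fix z assume "z \<in> (SIGMA A:?A. profile_tuples I (U - A) k)"
      then obtain A V where z: "z = (A, V)" and V: "V \<in> profile_tuples I (U - A) k" by auto
      then have "V i = undefined" using insert.hyps(2) by (simp add: mem_profile_tuples)
      then have "V(i := undefined) = V" by (metis fun_upd_triv)
      then show "((case z of (A, V) \<Rightarrow> V(i := A)) i, (case z of (A, V) \<Rightarrow> V(i := A))(i := undefined)) = z"
        by (simp add: z)
    qed
  qed
  then have "card (profile_tuples (insert i I) U k) = card (SIGMA A:?A. profile_tuples I (U - A) k)"
    by (rule bij_betw_same_card)
  also have "\<dots> = (\<Sum>A\<in>?A. card (profile_tuples I (U - A) k))"
    using insert.prems(1) finT by (intro card_SigmaI) auto
  finally have "card (profile_tuples (insert i I) U k) * (\<Prod>j\<in>I. fact (k j)) * fact (card U - k i - (\<Sum>j\<in>I. k j)) =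
      (\<Sum>A\<in>?A. card (profile_tuples I (U - A) k) * (\<Prod>j\<in>I. fact (k j)) * fact (card U - k i - (\<Sum>j\<in>I. k j)))"
    by (simp add: sum_distrib_right)
  also have "\<dots> = (\<Sum>A\<in>?A. fact (card U - k i))"
  proof (rule sum.cong[OF refl])
    fix A assume A: "A \<in> ?A"
    then have c: "card (U - A) = card U - k i"
      using insert.prems(1) card_Diff_subset[of A U] finite_subset[of A U] by simp
    have "(\<Sum>j\<in>I. k j) \<le> card (U - A)" using insert by (simp add: c)
    from insert.IH[OF _ this] insert.prems(1)
    show "card (profile_tuples I (U - A) k) * (\<Prod>j\<in>I. fact (k j)) * fact (card U - k i - (\<Sum>j\<in>I. k j)) = fact (card U - k i)"
      by (simp add: c)
  qed
  also have "\<dots> = (card U choose k i) * fact (card U - k i)"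
    using n_subsets[OF insert.prems(1), of "k i"] by simp
  finally have *: "card (profile_tuples (insert i I) U k) * (\<Prod>j\<in>I. fact (k j)) * fact (card U - k i - (\<Sum>j\<in>I. k j)) =
      (card U choose k i) * fact (card U - k i)" .
  have "card (profile_tuples (insert i I) U k) * (\<Prod>j\<in>insert i I. fact (k j)) * fact (card U - (\<Sum>j\<in>insert i I. k j)) =
      fact (k i) * (card (profile_tuples (insert i I) U k) * (\<Prod>j\<in>I. fact (k j)) * fact (card U - k i - (\<Sum>j\<in>I. k j)))"
    using insert.hyps by (simp add: mult_ac)
  also have "\<dots> = fact (card U)"
    unfolding * using binomial_fact_lemma[OF ki] by (simp add: mult_ac)
  finally show ?case .
qed

lemma gex_all_comps:
  assumes "finite U" "finite I" "V \<in> tuples I U"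
  shows "gex p (edges U) (\<lambda>G. of_bool (\<forall>i\<in>I. V i \<in> comps U G)) = comps_prob p U I V"
proof -
  have fV: "finite (V i)" if "i \<in> I" for i using tuplesD(1)[OF assms(3) that] assms(1) finite_subset by blast
  have "gex p (edges U) (\<lambda>G. of_bool (\<forall>i\<in>I. V i \<in> comps U G) * (\<Prod>i\<in>I. 1) * 1) =
    (\<Prod>i\<in>I. gex p (edges (V i)) (\<lambda>H. of_bool (conn (V i) H) * 1)) *
    (1 - p) ^ card (cross_pairs U I V) * gex p (edges (U - (\<Union>i\<in>I. V i))) (\<lambda>_. 1)"
    by (rule gex_comps[OF assms(1,2) tuplesD[OF assms(3)], of p "\<lambda>_ _. 1" "\<lambda>_. 1"])
  then show ?thesis
    using assms(1) fV by (simp add: comps_prob_def gex_conn gex_const finite_edges)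
qed

text \<open>Only the factor of \<open>V j\<close> in \<open>gex_comps\<close> changes, so a bound
  given that \<open>V j\<close> is connected holds unchanged given that all \<open>V i\<close> are
  components.\<close>

lemma gex_all_comps_edge_count:
  assumes p: "0 \<le> p" "p \<le> 1" and U: "finite U" and I: "finite I" and V: "V \<in> tuples I U" and j: "j \<in> I"
    and le: "gex p (edges (V j)) (\<lambda>H. of_bool (conn (V j) H) * f H) \<le> h * pconn (card (V j)) p"
  shows "gex p (edges U) (\<lambda>G. of_bool (\<forall>i\<in>I. V i \<in> comps U G) * f (G \<inter> edges (V j))) \<le> h * comps_prob p U I V"
proof -
  let ?f = "\<lambda>i H. if i = j then f H else 1"
  have fV: "finite (V i)" if "i \<in> I" for i using tuplesD(1)[OF V that] U finite_subset by blast
  have "gex p (edges U) (\<lambda>G. of_bool (\<forall>i\<in>I. V i \<in> comps U G) * f (G \<inter> edges (V j))) =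
     gex p (edges U) (\<lambda>G. of_bool (\<forall>i\<in>I. V i \<in> comps U G) * (\<Prod>i\<in>I. ?f i (G \<inter> edges (V i))) * 1)"
    using I j by (simp add: prod.delta cong: if_cong)
  also have "\<dots> = (\<Prod>i\<in>I. gex p (edges (V i)) (\<lambda>H. of_bool (conn (V i) H) * ?f i H)) *
    (1 - p) ^ card (cross_pairs U I V) * gex p (edges (U - (\<Union>i\<in>I. V i))) (\<lambda>_. 1)"
    by (rule gex_comps[OF U I tuplesD[OF V], of p ?f "\<lambda>_. 1"])
  also have "(\<Prod>i\<in>I. gex p (edges (V i)) (\<lambda>H. of_bool (conn (V i) H) * ?f i H)) =
      gex p (edges (V j)) (\<lambda>H. of_bool (conn (V j) H) * f H) * (\<Prod>i\<in>I - {j}. pconn (card (V i)) p)"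
    using I j fV by (subst prod.remove[OF I j]) (auto intro!: arg_cong2[where f = "(*)"] prod.cong simp: gex_conn)
  also have "\<dots> \<le> (h * pconn (card (V j)) p) * (\<Prod>i\<in>I - {j}. pconn (card (V i)) p)"
    using p by (intro mult_right_mono[OF le] prod_nonneg) (simp add: pconn_nonneg)
  also have "\<dots> = h * (\<Prod>i\<in>I. pconn (card (V i)) p)"
    using prod.remove[OF I j, of "\<lambda>i. pconn (card (V i)) p"] by simp
  finally show ?thesis
    using p U by (simp add: comps_prob_def gex_const finite_edges mult_right_mono mult.assoc)
qed

text \<open>The rest is independent of the event that the \<open>V i\<close> are components.\<close>

lemma gex_all_comps_rest:
  assumes p: "0 \<le> p" "p \<le> 1" and U: "finite U" and I: "finite I" and V: "V \<in> tuples I U"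
    and le: "gex p (edges (U - (\<Union>i\<in>I. V i))) g \<le> h"
  shows "gex p (edges U) (\<lambda>G. of_bool (\<forall>i\<in>I. V i \<in> comps U G) * g (G \<inter> edges (U - (\<Union>i\<in>I. V i)))) \<le> h * comps_prob p U I V"
proof -
  have fV: "finite (V i)" if "i \<in> I" for i using tuplesD(1)[OF V that] U finite_subset by blast
  have "gex p (edges U) (\<lambda>G. of_bool (\<forall>i\<in>I. V i \<in> comps U G) * g (G \<inter> edges (U - (\<Union>i\<in>I. V i)))) =
    (\<Prod>i\<in>I. gex p (edges (V i)) (\<lambda>H. of_bool (conn (V i) H) * 1)) *
    (1 - p) ^ card (cross_pairs U I V) * gex p (edges (U - (\<Union>i\<in>I. V i))) g"
    using gex_comps[OF U I tuplesD[OF V], of p "\<lambda>_ _. 1" g] by simp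
  also have "\<dots> = comps_prob p U I V * gex p (edges (U - (\<Union>i\<in>I. V i))) g"
    using fV by (simp add: comps_prob_def gex_conn)
  also have "\<dots> \<le> comps_prob p U I V * h"
    using p le by (intro mult_left_mono) (auto simp: comps_prob_def intro!: mult_nonneg_nonneg prod_nonneg pconn_nonneg)
  finally show ?thesis by (simp add: mult.commute)
qed

lemma comps_prob_cong:
  assumes U: "finite U" and I: "finite I" and V: "V \<in> tuples I U" "V' \<in> tuples I U"
    and eq: "\<And>i. i \<in> I \<Longrightarrow> card (V i) = card (V' i)"
  shows "comps_prob p U I V = comps_prob p U I V'"
proof -
  note 1 = card_cross_pairs[OF U I tuplesD[OF V(1)]] and 2 = card_cross_pairs[OF U I tuplesD[OF V(2)]]
  have "card (U - (\<Union>i\<in>I. V i)) = card (U - (\<Union>i\<in>I. V' i))"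
    using 1(1) 2(1) sum.cong[OF refl eq, of I] by simp
  then have "2 * real (card (cross_pairs U I V)) = 2 * real (card (cross_pairs U I V'))"
    using 1(2) 2(2) eq by simp
  then show ?thesis using eq by (simp add: comps_prob_def)
qed

context
  fixes F :: "'a filter" and n :: "'a \<Rightarrow> nat" and p :: "'a \<Rightarrow> real" and c :: real
    and I :: "'i set" and V :: "'a \<Rightarrow> 'i \<Rightarrow> nat set" and u :: "'i \<Rightarrow> real"
  assumes n: "filterlim n at_top F"
    and pc: "((\<lambda>a. real (n a) * p a) \<longlongrightarrow> c) F" and c: "c > 0"
    and I: "finite I" and V: "\<forall>\<^sub>F a in F. V a \<in> tuples I {..<n a}"
    and u: "\<And>i. i \<in> I \<Longrightarrow> u i > 0"
    and k: "\<And>i. i \<in> I \<Longrightarrow> ((\<lambda>a. real (card (V a i)) / real (n a)) \<longlongrightarrow> u i) F"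
begin

lemma rest_asymp:
  "((\<lambda>a. real (card ({..<n a} - (\<Union>i\<in>I. V a i))) / real (n a)) \<longlongrightarrow> 1 - (\<Sum>i\<in>I. u i)) F"
proof (rule Lim_transform_eventually)
  show "((\<lambda>a. 1 - (\<Sum>i\<in>I. real (card (V a i)) / real (n a))) \<longlongrightarrow> 1 - (\<Sum>i\<in>I. u i)) F"
    by (intro tendsto_intros k)
  show "\<forall>\<^sub>F a in F. 1 - (\<Sum>i\<in>I. real (card (V a i)) / real (n a)) =
      real (card ({..<n a} - (\<Union>i\<in>I. V a i))) / real (n a)"
    using V ev_n_ge[OF n, of 1]
  proof eventually_elim
    case (elim a)
    have "card ({..<n a} - (\<Union>i\<in>I. V a i)) + (\<Sum>i\<in>I. card (V a i)) = n a"
      using card_cross_pairs(1)[OF _ I tuplesD[OF elim(1)]] by simp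
    then have "real (card ({..<n a} - (\<Union>i\<in>I. V a i))) = real (n a) - (\<Sum>i\<in>I. real (card (V a i)))"
      by (metis add_diff_cancel_right' of_nat_add of_nat_sum)
    then show ?case using elim by (simp add: diff_divide_distrib sum_divide_distrib)
  qed
qed

text \<open>Three contributions add up: the multinomial coefficient, the connection rates
  \<open>u i * ln (1 - exp (- (c * u i)))\<close>, and \<open>- c / 2\<close> times
  \<open>1 - (\<Sum>i\<in>I. (u i)\<^sup>2) - (1 - s)\<^sup>2\<close> for the absent cross pairs,
  where \<open>s\<close> is the total of the \<open>u i\<close>.\<close>

lemma tuples_rate:
  "((\<lambda>a. ln (real (card (profile_tuples I {..<n a} (\<lambda>i. card (V a i)))) * comps_prob (p a) {..<n a} I (V a)) / real (n a))
    \<longlongrightarrow> - ((\<Sum>i\<in>I. K c (u i)) + L c (\<Sum>i\<in>I. u i))) F"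
proof -
  define s where "s = (\<Sum>i\<in>I. u i)"
  define N where "N a = card ({..<n a} - (\<Union>i\<in>I. V a i))" for a
  have N: "((\<lambda>a. real (N a) / real (n a)) \<longlongrightarrow> 1 - s) F"
    unfolding N_def s_def by (rule rest_asymp)
  define f where "f j a = ln (fact (j a)) / real (n a) - real (j a) / real (n a) * ln (real (n a))"
    for j and a :: 'a
  have n1: "((\<lambda>a. real (n a) / real (n a)) \<longlongrightarrow> 1) F"
  proof (rule tendsto_eventually)
    show "\<forall>\<^sub>F a in F. real (n a) / real (n a) = 1" using ev_n_ge[OF n, of 1] by eventually_elim simp
  qed
  have "((\<lambda>a. f n a - (\<Sum>i\<in>I. f (\<lambda>a. card (V a i)) a) - f N a
      + (\<Sum>i\<in>I. ln (pconn (card (V a i)) (p a)) / real (n a))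
      + 1 / 2 * (1 - (\<Sum>i\<in>I. (real (card (V a i)) / real (n a))\<^sup>2) - (real (N a) / real (n a))\<^sup>2) * (real (n a) * ln (1 - p a)))
     \<longlongrightarrow> (xlog 1 - 1) - (\<Sum>i\<in>I. xlog (u i) - u i) - (xlog (1 - s) - (1 - s))
      + (\<Sum>i\<in>I. u i * ln (1 - exp (- (c * u i))))
      + 1 / 2 * (1 - (\<Sum>i\<in>I. (u i)\<^sup>2) - (1 - s)\<^sup>2) * (- c)) F"
    unfolding f_def
    by (intro tendsto_add tendsto_diff tendsto_sum tendsto_mult tendsto_power tendsto_const
        ln_fact_asymp[OF n] n1 N k pconn_rate[OF n pc c] ln_one_minus_p[OF n pc c] u)
  also have "(xlog 1 - 1) - (\<Sum>i\<in>I. xlog (u i) - u i) - (xlog (1 - s) - (1 - s))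
      + (\<Sum>i\<in>I. u i * ln (1 - exp (- (c * u i))))
      + 1 / 2 * (1 - (\<Sum>i\<in>I. (u i)\<^sup>2) - (1 - s)\<^sup>2) * (- c) = - ((\<Sum>i\<in>I. K c (u i)) + L c s)"
  proof -
    \<comment> \<open>The terms \<open>u i * ln c\<close> add up to \<open>s * ln c\<close>, which
      cancels the same term in \<open>L\<close>.\<close>
    have "K c (u i) = xlog (u i) + u i * ln c - u i * ln (1 - exp (- (c * u i))) - c * (u i)\<^sup>2 / 2" if "i \<in> I" for i
    proof -
      have "1 - exp (- (c * u i)) > 0" using u[OF that] c by simp
      then show ?thesis using u[OF that] c by (simp add: K_def xlog_def ln_div ln_mult algebra_simps)
    qed
    then have "(\<Sum>i\<in>I. K c (u i)) = (\<Sum>i\<in>I. xlog (u i) + u i * ln c - u i * ln (1 - exp (- (c * u i))) - c * (u i)\<^sup>2 / 2)"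
      by (intro sum.cong) auto
    also have "\<dots> = (\<Sum>i\<in>I. xlog (u i)) + s * ln c - (\<Sum>i\<in>I. u i * ln (1 - exp (- (c * u i)))) - c * (\<Sum>i\<in>I. (u i)\<^sup>2) / 2"
      by (simp add: sum.distrib sum_subtractf s_def sum_distrib_right sum_distrib_left sum_divide_distrib)
    finally show ?thesis
      by (simp add: L_def xlog_def sum_subtractf s_def[symmetric] power2_eq_square algebra_simps)
  qed
  finally show ?thesis
    unfolding s_def
  proof (rule Lim_transform_eventually)
    have kpos: "\<forall>\<^sub>F a in F. \<forall>i\<in>I. card (V a i) \<ge> 1"
      using I k u by (intro eventually_ball_finite ballI ev_k_ge[OF n]) auto
    show "\<forall>\<^sub>F a in F. f n a - (\<Sum>i\<in>I. f (\<lambda>a. card (V a i)) a) - f N a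
      + (\<Sum>i\<in>I. ln (pconn (card (V a i)) (p a)) / real (n a))
      + 1 / 2 * (1 - (\<Sum>i\<in>I. (real (card (V a i)) / real (n a))\<^sup>2) - (real (N a) / real (n a))\<^sup>2) * (real (n a) * ln (1 - p a))
      = ln (real (card (profile_tuples I {..<n a} (\<lambda>i. card (V a i)))) * comps_prob (p a) {..<n a} I (V a)) / real (n a)"
      using V kpos ev_n_ge[OF n, of 1] ev_p_pos[OF n pc c] ev_p_less[OF n pc c zero_less_one]
    proof eventually_elim
      case (elim a)
      let ?k = "\<lambda>i. card (V a i)" and ?X = "card (cross_pairs {..<n a} I (V a))"
      let ?M = "card (profile_tuples I {..<n a} ?k)"
      have qpos: "pconn (?k i) (p a) > 0" if "i \<in> I" for i using elim that by (intro pconn_pos) auto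
      have sumk: "N a + (\<Sum>i\<in>I. ?k i) = n a"
        and X: "2 * real ?X = (real (n a))\<^sup>2 - (\<Sum>i\<in>I. (real (?k i))\<^sup>2) - (real (N a))\<^sup>2"
        using card_cross_pairs[OF _ I tuplesD[OF elim(1)]] by (auto simp: N_def)
      have "?M * (\<Prod>i\<in>I. fact (?k i)) * fact (n a - (\<Sum>i\<in>I. ?k i)) = (fact (n a) :: nat)"
        using card_profile_tuples[OF I, of "{..<n a}" ?k] sumk by simp
      also have "n a - (\<Sum>i\<in>I. ?k i) = N a" using sumk by simp
      finally have M: "?M * (\<Prod>i\<in>I. fact (?k i)) * fact (N a) = (fact (n a) :: nat)" .
      then have Mpos: "?M > 0" by (metis fact_nonzero mult_is_0 not_gr_zero)
      have "real ?M * (\<Prod>i\<in>I. fact (?k i)) * fact (N a) = fact (n a)"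
        using arg_cong[OF M, of real] by simp
      then have "ln (real ?M * (\<Prod>i\<in>I. fact (?k i)) * fact (N a)) = ln (fact (n a))" by simp
      then have lnM: "ln (real ?M) = ln (fact (n a)) - (\<Sum>i\<in>I. ln (fact (?k i))) - ln (fact (N a))"
        using Mpos I by (simp add: ln_mult ln_prod)
      have "ln (comps_prob (p a) {..<n a} I (V a)) = (\<Sum>i\<in>I. ln (pconn (?k i) (p a))) + real ?X * ln (1 - p a)"
      proof -
        have "(\<Prod>i\<in>I. pconn (?k i) (p a)) > 0" using qpos by (intro prod_pos)
        moreover have "pconn (?k i) (p a) \<noteq> 0" if "i \<in> I" for i using qpos[OF that] by simp
        ultimately show ?thesis using I qpos elim by (simp add: comps_prob_def ln_mult ln_realpow ln_prod)
      qed
      moreover have "comps_prob (p a) {..<n a} I (V a) > 0"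
        unfolding comps_prob_def using qpos elim by (intro mult_pos_pos prod_pos) auto
      ultimately have 1: "ln (real ?M * comps_prob (p a) {..<n a} I (V a)) =
          ln (fact (n a)) - (\<Sum>i\<in>I. ln (fact (?k i))) - ln (fact (N a)) + (\<Sum>i\<in>I. ln (pconn (?k i) (p a))) + real ?X * ln (1 - p a)"
        using Mpos lnM by (simp add: ln_mult)
      have nn: "real (n a) = real (N a) + (\<Sum>i\<in>I. real (?k i))"
        using sumk by (simp flip: of_nat_sum of_nat_add)
      \<comment> \<open>The multiples of \<open>ln n\<close> cancel because all sizes, with the
        rest, add up to \<open>n\<close>.\<close>
      have 2: "f n a - (\<Sum>i\<in>I. f (\<lambda>a. card (V a i)) a) - f N a =
          (ln (fact (n a)) - (\<Sum>i\<in>I. ln (fact (?k i))) - ln (fact (N a))) / real (n a)"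
      proof -
        have "f n a - (\<Sum>i\<in>I. f (\<lambda>a. card (V a i)) a) - f N a =
          (ln (fact (n a)) - (\<Sum>i\<in>I. ln (fact (?k i))) - ln (fact (N a))) / real (n a)
          - (real (n a) - (\<Sum>i\<in>I. real (?k i)) - real (N a)) / real (n a) * ln (real (n a))"
          unfolding f_def
          by (simp add: sum_subtractf sum_divide_distrib sum_distrib_right diff_divide_distrib left_diff_distrib)
        also have "real (n a) - (\<Sum>i\<in>I. real (?k i)) - real (N a) = 0" using nn by simp
        finally show ?thesis by simp
      qed
      have 3: "1 / 2 * (1 - (\<Sum>i\<in>I. (real (?k i) / real (n a))\<^sup>2) - (real (N a) / real (n a))\<^sup>2) * (real (n a) * ln (1 - p a))
          = real ?X * ln (1 - p a) / real (n a)"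
      proof -
        have "1 - (\<Sum>i\<in>I. (real (?k i) / real (n a))\<^sup>2) - (real (N a) / real (n a))\<^sup>2 = 2 * real ?X / (real (n a))\<^sup>2"
          unfolding X using elim by (simp add: power_divide diff_divide_distrib sum_divide_distrib)
        then show ?thesis using elim by (simp add: power2_eq_square)
      qed
      show ?case unfolding 1 2 3 by (simp add: add_divide_distrib sum_divide_distrib)
    qed
  qed
qed

end

section \<open>The component events\<close>

text \<open>Extensional tuples replace the choice functions of \<open>selects\<close>, so that union
  bounds run over a finite set.\<close>

definition window :: "real \<Rightarrow> nat \<Rightarrow> nat \<Rightarrow> (nat \<Rightarrow> real) \<Rightarrow> (nat \<Rightarrow> nat set) set" where
  "window \<delta> n m u = {V \<in> tuples {1..m} {..<n}.
     \<forall>i\<in>{1..m}. real (card (V i)) \<in> {real n * (u i - \<delta>)..real n * (u i + \<delta>)}}"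

lemma finite_window: "finite (window \<delta> n m u)"
  using finite_tuples[of "{1..m}" "{..<n}"] by (simp add: window_def)

lemma window_mono:
  assumes "\<delta> \<le> \<delta>'"
  shows "window \<delta> n m u \<subseteq> window \<delta>' n m u"
proof
  fix V assume V: "V \<in> window \<delta> n m u"
  have "real n * \<delta> \<le> real n * \<delta>'" using assms by (intro mult_left_mono) auto
  then show "V \<in> window \<delta>' n m u" using V by (fastforce simp: window_def algebra_simps)
qed

lemma selects_window:
  assumes V: "V \<in> window \<delta> n m u" and comps: "\<forall>i\<in>{1..m}. V i \<in> comps {..<n} G"
  shows "selects n \<delta> m u G V"
proof -
  have disj: "disjoint_family_on V {1..m}" using V tuplesD(2) by (auto simp: window_def)
  have "inj_on V {1..m}"
  proof (rule inj_onI, rule ccontr)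
    fix i j assume ij: "i \<in> {1..m}" "j \<in> {1..m}" "V i = V j" "i \<noteq> j"
    then have "V i \<inter> V j = {}"
      using disj[unfolded disjoint_family_on_def, rule_format, OF ij(1,2,4)] by simp
    moreover have "V j \<noteq> {}" using comps comps_nonempty ij(2) by blast
    ultimately show False using ij(3) by simp
  qed
  then show ?thesis using V comps by (simp add: selects_def window_def components_eq_comps)
qed

text \<open>Distinct components are disjoint, so a choice \<open>C\<close>, restricted to the
  indices, is a tuple; conversely disjoint nonempty sets are distinct.\<close>

lemma A_event_iff:
  assumes G: "G \<subseteq> edges {..<n}"
  shows "G \<in> A_event n \<delta> m u \<longleftrightarrow> (\<exists>V\<in>window \<delta> n m u. \<forall>i\<in>{1..m}. V i \<in> comps {..<n} G)"
proof
  assume "G \<in> A_event n \<delta> m u"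
  then obtain C where C: "selects n \<delta> m u G C" by (auto simp: A_event_def)
  then have inj: "inj_on C {1..m}" and comp: "\<And>i. i \<in> {1..m} \<Longrightarrow> C i \<in> comps {..<n} G"
    and cd: "\<And>i. i \<in> {1..m} \<Longrightarrow> real (card (C i)) \<in> {real n * (u i - \<delta>)..real n * (u i + \<delta>)}"
    by (auto simp: selects_def components_eq_comps)
  define V where "V = restrict C {1..m}"
  have VC: "V i = C i" if "i \<in> {1..m}" for i using that by (simp add: V_def)
  have "C i \<inter> C j = {}" if "i \<in> {1..m}" "j \<in> {1..m}" "i \<noteq> j" for i j
    using comps_eqI[OF comp[OF that(1)] comp[OF that(2)]] inj_onD[OF inj _ that(1,2)] that(3) by blast
  then have "disjoint_family_on V {1..m}" by (simp add: disjoint_family_on_def VC)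
  moreover have "V \<in> {1..m} \<rightarrow>\<^sub>E Pow {..<n}"
    using comps_subset[OF G comp] by (auto simp: V_def)
  ultimately have "V \<in> window \<delta> n m u" using cd by (simp add: window_def tuples_def VC)
  then show "\<exists>V\<in>window \<delta> n m u. \<forall>i\<in>{1..m}. V i \<in> comps {..<n} G"
    using comp VC by (intro bexI[of _ V]) auto
next
  assume "\<exists>V\<in>window \<delta> n m u. \<forall>i\<in>{1..m}. V i \<in> comps {..<n} G"
  then show "G \<in> A_event n \<delta> m u" using selects_window unfolding A_event_def by blast
qed

lemma comps_prob_nonneg: "0 \<le> p \<Longrightarrow> p \<le> 1 \<Longrightarrow> 0 \<le> comps_prob p U I V"
  unfolding comps_prob_def by (intro mult_nonneg_nonneg prod_nonneg) (auto simp: pconn_nonneg)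

lemma window_tuples: "V \<in> window \<delta> n m u \<Longrightarrow> V \<in> tuples {1..m} {..<n}"
  by (simp add: window_def)

lemma A_event_le:
  assumes p: "0 \<le> p" "p \<le> 1"
  shows "gex p (edges {..<n}) (\<lambda>G. of_bool (G \<in> A_event n \<delta> m u))
    \<le> (\<Sum>V\<in>window \<delta> n m u. comps_prob p {..<n} {1..m} V)"
proof -
  let ?c = "\<lambda>V G. \<forall>i\<in>{1..m}. V i \<in> comps {..<n} G"
  have "gex p (edges {..<n}) (\<lambda>G. of_bool (G \<in> A_event n \<delta> m u))
     \<le> gex p (edges {..<n}) (\<lambda>G. \<Sum>V\<in>window \<delta> n m u. of_bool (?c V G))"
  proof (rule gex_mono[OF p])
    fix G assume G: "G \<subseteq> edges {..<n}"
    show "of_bool (G \<in> A_event n \<delta> m u) \<le> (\<Sum>V\<in>window \<delta> n m u. of_bool (?c V G) :: real)"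
    proof (cases "G \<in> A_event n \<delta> m u")
      case True
      then obtain V where V: "V \<in> window \<delta> n m u" "?c V G" using A_event_iff[OF G] by blast
      have "of_bool (?c V G) \<le> (\<Sum>V\<in>window \<delta> n m u. of_bool (?c V G) :: real)"
        by (rule member_le_sum[OF V(1) _ finite_window]) simp
      then show ?thesis using True V(2) by simp
    qed (simp add: sum_nonneg)
  qed
  also have "\<dots> = (\<Sum>V\<in>window \<delta> n m u. gex p (edges {..<n}) (\<lambda>G. of_bool (?c V G)))"
    by (simp only: gex_sum)
  also have "\<dots> = (\<Sum>V\<in>window \<delta> n m u. comps_prob p {..<n} {1..m} V)"
    using window_tuples by (intro sum.cong refl gex_all_comps) auto
  finally show ?thesis .
qed

text \<open>
  A graph has at most \<open>1 / b\<close> components with \<open>b n\<close> or more vertices, so a union bound over the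
  tuples loses only a constant factor.
\<close>

lemma A_event_ge:
  assumes p: "0 \<le> p" "p \<le> 1" and n: "n \<ge> 1" and b: "b > 0" "\<And>i. i \<in> {1..m} \<Longrightarrow> b \<le> u i - \<delta>"
  shows "(\<Sum>V\<in>window \<delta> n m u. comps_prob p {..<n} {1..m} V)
    \<le> (1 / b) ^ m * gex p (edges {..<n}) (\<lambda>G. of_bool (G \<in> A_event n \<delta> m u))"
proof -
  let ?c = "\<lambda>V G. \<forall>i\<in>{1..m}. V i \<in> comps {..<n} G"
  have "(\<Sum>V\<in>window \<delta> n m u. comps_prob p {..<n} {1..m} V)
      = (\<Sum>V\<in>window \<delta> n m u. gex p (edges {..<n}) (\<lambda>G. of_bool (?c V G)))"
    using window_tuples by (intro sum.cong refl gex_all_comps[symmetric]) auto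
  also have "\<dots> = gex p (edges {..<n}) (\<lambda>G. \<Sum>V\<in>window \<delta> n m u. of_bool (?c V G))"
    by (simp only: gex_sum)
  also have "\<dots> \<le> gex p (edges {..<n}) (\<lambda>G. (1 / b) ^ m * of_bool (G \<in> A_event n \<delta> m u))"
  proof (rule gex_mono[OF p])
    fix G assume G: "G \<subseteq> edges {..<n}"
    let ?W = "{V \<in> window \<delta> n m u. ?c V G}"
    let ?B = "{D \<in> comps {..<n} G. b * real n \<le> real (card D)}"
    have sum: "(\<Sum>V\<in>window \<delta> n m u. of_bool (?c V G) :: real) = real (card ?W)"
      using finite_window by (simp add: sum.If_cases Collect_conj_eq)
    have finC: "finite (comps {..<n} G)" by (simp add: finite_comps)
    have "real (card ?B) * (b * real n) \<le> (\<Sum>D\<in>?B. real (card D))"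
      using finC by (intro sum_bounded_below) auto
    also have "\<dots> \<le> (\<Sum>D\<in>comps {..<n} G. real (card D))" using finC by (intro sum_mono2) auto
    also have "\<dots> = real n" using sum_card_comps[OF _ G] by (simp flip: of_nat_sum)
    finally have B: "real (card ?B) \<le> 1 / b" using n b by (simp add: field_simps)
    have "?W \<subseteq> {1..m} \<rightarrow>\<^sub>E ?B"
    proof
      fix V assume V: "V \<in> ?W"
      have "b * real n \<le> real (card (V i))" if i: "i \<in> {1..m}" for i
      proof -
        have "b * real n \<le> (u i - \<delta>) * real n" using b(2)[OF i] by (intro mult_right_mono) auto
        also have "\<dots> \<le> real (card (V i))" using V i by (simp add: window_def mult.commute)
        finally show ?thesis .
      qed
      then show "V \<in> {1..m} \<rightarrow>\<^sub>E ?B" using V by (auto simp: window_def tuples_def PiE_iff)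
    qed
    then have "card ?W \<le> card ({1..m} \<rightarrow>\<^sub>E ?B)" using finC by (intro card_mono finite_PiE) auto
    also have "\<dots> = card ?B ^ m" by (simp add: card_PiE)
    finally have "real (card ?W) \<le> real (card ?B ^ m)" by (simp only: of_nat_le_iff)
    also have "\<dots> = real (card ?B) ^ m" by (rule of_nat_power)
    also have "\<dots> \<le> (1 / b) ^ m" using B by (intro power_mono) auto
    finally have le: "real (card ?W) \<le> (1 / b) ^ m" .
    show "(\<Sum>V\<in>window \<delta> n m u. of_bool (?c V G) :: real) \<le> (1 / b) ^ m * of_bool (G \<in> A_event n \<delta> m u)"
    proof (cases "G \<in> A_event n \<delta> m u")
      case False
      then have "\<not> (\<exists>V\<in>window \<delta> n m u. ?c V G)" using A_event_iff[OF G] by simp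
      then have "?W = {}" by blast
      then have "real (card ?W) = 0" by (simp only: card.empty of_nat_0)
      then show ?thesis using False unfolding sum by simp
    qed (use le sum in simp)
  qed
  finally show ?thesis by (simp add: gex_cmult)
qed

text \<open>A graph in the difference has a tuple of components, and each such tuple has
  \<open>bad\<close> at least 1. The sum of \<open>bad\<close> over these tuples therefore dominates
  the indicator.\<close>

lemma A_event_diff_le:
  assumes p: "0 \<le> p" "p \<le> 1"
    and bad: "\<And>V. V \<in> window \<delta> n m u \<Longrightarrow>
      gex p (edges {..<n}) (\<lambda>G. of_bool (\<forall>i\<in>{1..m}. V i \<in> comps {..<n} G) * bad V G) \<le> h * comps_prob p {..<n} {1..m} V"
    and bad_nonneg: "\<And>V G. 0 \<le> bad V G"
    and good: "\<And>V G. G \<subseteq> edges {..<n} \<Longrightarrow> V \<in> window \<delta> n m u \<Longrightarrow>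
      \<forall>i\<in>{1..m}. V i \<in> comps {..<n} G \<Longrightarrow> bad V G < 1 \<Longrightarrow> G \<in> X"
  shows "gex p (edges {..<n}) (\<lambda>G. of_bool (G \<in> A_event n \<delta> m u \<and> G \<notin> X))
    \<le> h * (\<Sum>V\<in>window \<delta> n m u. comps_prob p {..<n} {1..m} V)"
proof -
  let ?c = "\<lambda>V G. \<forall>i\<in>{1..m}. V i \<in> comps {..<n} G"
  have "gex p (edges {..<n}) (\<lambda>G. of_bool (G \<in> A_event n \<delta> m u \<and> G \<notin> X))
     \<le> gex p (edges {..<n}) (\<lambda>G. \<Sum>V\<in>window \<delta> n m u. of_bool (?c V G) * bad V G)"
  proof (rule gex_mono[OF p])
    fix G assume G: "G \<subseteq> edges {..<n}"
    show "of_bool (G \<in> A_event n \<delta> m u \<and> G \<notin> X) \<le> (\<Sum>V\<in>window \<delta> n m u. of_bool (?c V G) * bad V G)"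
    proof (cases "G \<in> A_event n \<delta> m u \<and> G \<notin> X")
      case True
      then obtain V where V: "V \<in> window \<delta> n m u" "?c V G" using A_event_iff[OF G] by blast
      have "\<not> bad V G < 1" using good[OF G V] True by blast
      then have "1 \<le> of_bool (?c V G) * bad V G" using V(2) by simp
      also have "\<dots> \<le> (\<Sum>V\<in>window \<delta> n m u. of_bool (?c V G) * bad V G)"
        using bad_nonneg by (intro member_le_sum[OF V(1) _ finite_window]) simp
      finally show ?thesis by simp
    next
      case False
      then have z: "of_bool (G \<in> A_event n \<delta> m u \<and> G \<notin> X) = (0 :: real)" by (simp only: of_bool_eq)
      show ?thesis unfolding z by (intro sum_nonneg) (simp add: bad_nonneg)
    qed
  qed
  also have "\<dots> = (\<Sum>V\<in>window \<delta> n m u. gex p (edges {..<n}) (\<lambda>G. of_bool (?c V G) * bad V G))"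
    by (simp only: gex_sum)
  also have "\<dots> \<le> (\<Sum>V\<in>window \<delta> n m u. h * comps_prob p {..<n} {1..m} V)"
    by (intro sum_mono bad)
  finally show ?thesis by (simp add: sum_distrib_left)
qed

text \<open>Along this filter \<open>n\<close> tends to infinity and the relative sizes of a tuple
  tend to the \<open>u i\<close>. The deviations are summed because \<open>at_limit\<close> follows
  a single real quantity.\<close>

definition window_filter :: "nat \<Rightarrow> (nat \<Rightarrow> real) \<Rightarrow> (nat \<times> (nat \<Rightarrow> nat set)) filter" where
  "window_filter m u = inf (at_limit sequentially (\<lambda>n V. \<Sum>i\<in>{1..m}. \<bar>real (card (V i)) / real n - u i\<bar>) 0)
     (principal {z. snd z \<in> tuples {1..m} {..<fst z}})"

lemma window_filter_le:
  "window_filter m u \<le> at_limit sequentially (\<lambda>n V. \<Sum>i\<in>{1..m}. \<bar>real (card (V i)) / real n - u i\<bar>) 0"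
  by (simp add: window_filter_def)

lemma filterlim_window_filter: "filterlim f G sequentially \<Longrightarrow> filterlim (\<lambda>z. f (fst z)) G (window_filter m u)"
  by (rule filterlim_mono[OF filterlim_at_limit_fst order_refl window_filter_le])

lemma window_filter_tuples: "\<forall>\<^sub>F z in window_filter m u. snd z \<in> tuples {1..m} {..<fst z}"
  unfolding window_filter_def eventually_inf_principal by simp

lemma window_filter_card:
  assumes "i \<in> {1..m}"
  shows "((\<lambda>z. real (card (snd z i)) / real (fst z)) \<longlongrightarrow> u i) (window_filter m u)"
proof -
  let ?r = "\<lambda>n V. \<Sum>i\<in>{1..m}. \<bar>real (card (V i)) / real n - u i\<bar>"
  have lim: "((\<lambda>z. ?r (fst z) (snd z)) \<longlongrightarrow> 0) (window_filter m u)"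
    by (rule filterlim_mono[OF tendsto_at_limit[of ?r] order_refl window_filter_le])
  have "\<bar>real (card (snd z i)) / real (fst z) - u i\<bar> \<le> ?r (fst z) (snd z)" for z
    using assms by (intro member_le_sum[where f = "\<lambda>i. \<bar>real (card (snd z i)) / real (fst z) - u i\<bar>"]) auto
  then have "((\<lambda>z. real (card (snd z i)) / real (fst z) - u i) \<longlongrightarrow> 0) (window_filter m u)"
    by (intro Lim_null_comparison[OF _ lim] always_eventually allI) (simp only: real_norm_def)
  then show ?thesis by (rule LIM_zero_cancel)
qed

lemma window_filterD:
  assumes "eventually Q (window_filter m u)"
  obtains \<delta> where "\<delta> > 0" "\<forall>\<^sub>F n in sequentially. \<forall>V\<in>window \<delta> n m u. Q (n, V)"
proof -
  let ?r = "\<lambda>n V. \<Sum>i\<in>{1..m}. \<bar>real (card (V i)) / real n - u i\<bar>"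
  have "\<forall>\<^sub>F z in at_limit sequentially ?r 0. snd z \<in> tuples {1..m} {..<fst z} \<longrightarrow> Q z"
    using assms unfolding window_filter_def eventually_inf_principal by simp
  then obtain \<eta> where \<eta>: "\<eta> > 0" and ev: "\<forall>\<^sub>F n in sequentially. \<forall>V. \<bar>?r n V - 0\<bar> \<le> \<eta> \<longrightarrow> V \<in> tuples {1..m} {..<n} \<longrightarrow> Q (n, V)"
    by (rule eventually_at_limitD) auto
  show ?thesis
  proof
    \<comment> \<open>With this \<open>\<delta>\<close>, \<open>m\<close> deviations of at most
      \<open>\<delta>\<close> add up to at most \<open>\<eta>\<close>; the summand 1 keeps the
      quotient positive also for \<open>m = 0\<close>.\<close>
    show "\<eta> / (real m + 1) > 0" using \<eta> by simp
    show "\<forall>\<^sub>F n in sequentially. \<forall>V\<in>window (\<eta> / (real m + 1)) n m u. Q (n, V)"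
      using ev eventually_ge_at_top[of 1]
    proof eventually_elim
      case (elim n)
      show ?case
      proof
        fix V assume V: "V \<in> window (\<eta> / (real m + 1)) n m u"
        have "\<bar>real (card (V i)) / real n - u i\<bar> \<le> \<eta> / (real m + 1)" if "i \<in> {1..m}" for i
        proof -
          have "real n * (u i - \<eta> / (real m + 1)) \<le> real (card (V i))" "real (card (V i)) \<le> real n * (u i + \<eta> / (real m + 1))"
            using V that by (auto simp: window_def)
          then have "u i - \<eta> / (real m + 1) \<le> real (card (V i)) / real n" "real (card (V i)) / real n \<le> u i + \<eta> / (real m + 1)"
            using elim by (simp_all add: pos_le_divide_eq pos_divide_le_eq mult.commute)
          then show ?thesis by (auto simp: abs_le_iff)
        qed
        then have "?r n V \<le> real (card {1..m}) * (\<eta> / (real m + 1))" by (intro sum_bounded_above)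
        also have "\<dots> \<le> \<eta>" using \<eta> by (simp add: field_simps)
        finally have "\<bar>?r n V - 0\<bar> \<le> \<eta>" by (simp add: sum_nonneg)
        then show "Q (n, V)" using elim(1) window_tuples[OF V] by blast
      qed
    qed
  qed
qed

text \<open>With \<open>y = 1 - s\<close>, the function \<open>v - y * (1 - exp (- (c * v)))\<close>
  is 0 at 0 with derivative \<open>1 - c * y < 0\<close>, hence negative just after 0, and it is
  nonnegative at \<open>y\<close>. The intermediate value theorem gives a root;
  \<open>root_unique\<close> justifies the definite description.\<close>

lemma u_star_root:
  assumes c: "c > 0" and s: "s < 1 - 1 / c"
  shows "u_star c s > 0" "u_star c s = (1 - s) * (1 - exp (- (c * u_star c s)))"
proof -
  define y where "y = 1 - s"
  have y: "1 < c * y" "y > 0"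
  proof -
    have "1 / c < y" using s by (simp add: y_def)
    then show "1 < c * y" using c by (simp add: field_simps)
    then show "y > 0" using c by (metis less_trans zero_less_mult_pos zero_less_one)
  qed
  define f where "f v = v - y * (1 - exp (- (c * v)))" for v
  have "(f has_real_derivative 1 - y * (c * exp (- (c * 0)))) (at 0)"
    unfolding f_def by (auto intro!: derivative_eq_intros)
  then have "(f has_real_derivative 1 - c * y) (at 0)" by (simp add: mult.commute)
  from DERIV_neg_dec_right[OF this] y obtain d where d: "d > 0" "\<And>h. h > 0 \<Longrightarrow> h < d \<Longrightarrow> f h < 0"
    by (auto simp: f_def)
  define a where "a = min (d / 2) y"
  have a: "0 < a" "a \<le> y" using d y by (auto simp: a_def)
  have "f a \<le> 0" using d a by (intro less_imp_le d(2)) (auto simp: a_def)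
  moreover have "0 \<le> f y" using y by (simp add: f_def algebra_simps)
  moreover have "continuous_on {a..y} f" unfolding f_def by (intro continuous_intros)
  ultimately obtain v where v: "a \<le> v" "v \<le> y" "f v = 0" using IVT'[of f a 0 y] a by auto
  then have vpos: "v > 0" and root: "v = y * (1 - exp (- (c * v)))" using a by (auto simp: f_def)
  have iff: "w > 0 \<and> w / (1 - exp (- c * w)) = 1 - s \<longleftrightarrow> w > 0 \<and> w = y * (1 - exp (- (c * w)))" for w
  proof (cases "w > 0")
    case True
    then have "1 - exp (- (c * w)) > 0" using c by simp
    then have "1 - exp (- c * w) \<noteq> 0" using True c by simp
    then show ?thesis by (simp add: y_def nonzero_divide_eq_eq)
  qed simp
  have "u_star c s = v"
    unfolding u_star_def iff
  proof (rule the_equality)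
    show "v > 0 \<and> v = y * (1 - exp (- (c * v)))" using vpos root by blast
  qed (use root_unique[OF _ vpos c _ root] in blast)
  then show "u_star c s > 0" "u_star c s = (1 - s) * (1 - exp (- (c * u_star c s)))"
    using vpos root by (simp_all add: y_def)
qed

text \<open>Both cases of the refined event as one condition on the graph outside the chosen
  components.\<close>

definition rest_good :: "real \<Rightarrow> real \<Rightarrow> nat \<Rightarrow> real \<Rightarrow> nat set \<Rightarrow> nat set set \<Rightarrow> bool" where
  "rest_good c s n \<epsilon> R H \<longleftrightarrow> (if s \<ge> 1 - 1 / c then \<forall>D\<in>comps R H. real (card D) < \<epsilon> * real n
     else giant R n \<epsilon> (u_star c s) (r_star c (u_star c s)) H)"

text \<open>Purely deterministic: \<open>V\<close> itself is the required choice, and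
  \<open>comps_rest\<close> identifies the other components with those of the rest.\<close>

lemma A_tilde_eventI:
  assumes G: "G \<subseteq> edges {..<n}" and V: "V \<in> window \<delta> n m u" and comps: "\<forall>i\<in>{1..m}. V i \<in> comps {..<n} G"
    and exc: "\<And>i. i \<in> {1..m} \<Longrightarrow> \<bar>real (card (G \<inter> edges (V i))) - real n * (r_star c (u i) + u i)\<bar> < \<epsilon> / 4 * real n"
    and rest: "rest_good c (\<Sum>i=1..m. u i) n \<epsilon> ({..<n} - (\<Union>i\<in>{1..m}. V i)) (G \<inter> edges ({..<n} - (\<Union>i\<in>{1..m}. V i)))"
    and \<delta>: "\<delta> \<le> \<epsilon> / 4" and n\<epsilon>: "1 \<le> \<epsilon> / 4 * real n"
  shows "G \<in> A_tilde_event c n \<delta> \<epsilon> m u"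
proof -
  let ?R = "{..<n} - (\<Union>i\<in>{1..m}. V i)" and ?s = "\<Sum>i=1..m. u i"
  let ?near = "\<lambda>x y. x \<in> {real n * (y - \<epsilon>) <..< real n * (y + \<epsilon>)}"
  have near: "?near x y \<longleftrightarrow> \<bar>x - real n * y\<bar> < real n * \<epsilon>" for x y
    by (auto simp: abs_less_iff algebra_simps)
  have sel: "selects n \<delta> m u G V" by (rule selects_window[OF V comps])
  have excV: "?near (excess G (V i)) (r_star c (u i))" if i: "i \<in> {1..m}" for i
  proof -
    have "real n * \<delta> \<le> real n * (\<epsilon> / 4)" using \<delta> by (intro mult_left_mono) auto
    moreover have "real n * (u i - \<delta>) \<le> real (card (V i))" "real (card (V i)) \<le> real n * (u i + \<delta>)"
      using V i by (auto simp: window_def)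
    ultimately have cd: "\<bar>real (card (V i)) - real n * u i\<bar> \<le> \<epsilon> / 4 * real n"
      unfolding right_diff_distrib distrib_left abs_le_iff by (simp_all add: mult.commute)
    \<comment> \<open>As for the giant component, edges, size and the constant 1 each use at most a
      quarter of \<open>\<epsilon> n\<close>.\<close>
    have "\<bar>a - (k - 1) - (b - d)\<bar> < 4 * t"
      if "\<bar>a - b\<bar> < t" "\<bar>k - d\<bar> \<le> t" "1 \<le> t" for a b k d t :: real
      using that by linarith
    from this[OF exc[OF i] cd n\<epsilon>] show ?thesis
      unfolding near excess_eq[OF G] by (simp add: distrib_left mult.commute)
  qed
  have rest_comps: "components n G - V ` {1..m} = comps ?R (G \<inter> edges ?R)"
    unfolding components_eq_comps using comps by (intro comps_rest[OF G]) auto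
  show ?thesis
  proof (cases "?s \<ge> 1 - 1 / c")
    case True
    then have "\<forall>D\<in>components n G - V ` {1..m}. real (card D) < real n * \<epsilon>"
      using rest unfolding rest_comps by (simp add: rest_good_def mult.commute)
    then show ?thesis using True sel excV by (auto simp: A_tilde_event_def)
  next
    case False
    let ?v = "u_star c ?s"
    have "giant ?R n \<epsilon> ?v (r_star c ?v) (G \<inter> edges ?R)" using rest False by (simp add: rest_good_def)
    then obtain B where B: "B \<in> comps ?R (G \<inter> edges ?R)" "\<bar>real (card B) - real n * ?v\<bar> < real n * \<epsilon>"
      "\<bar>excess (G \<inter> edges ?R) B - real n * r_star c ?v\<bar> < real n * \<epsilon>"
      "\<forall>D\<in>comps ?R (G \<inter> edges ?R) - {B}. real (card D) < real n * \<epsilon>"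
      unfolding giant_def by blast
    have "B \<subseteq> ?R" using comps_subset[OF _ B(1)] by blast
    then have "G \<inter> edges ?R \<inter> edges B = G \<inter> edges B" using edges_mono[of B ?R] by blast
    then have "excess (G \<inter> edges ?R) B = excess G B"
      using excess_eq[OF G, of B] excess_eq[of "G \<inter> edges ?R" ?R B] by simp
    then have nearB: "?near (real (card B)) ?v" "?near (excess G B) (r_star c ?v)"
      using B(2,3) unfolding near by simp_all
    have BC: "B \<in> components n G - V ` {1..m}" unfolding rest_comps by (rule B(1))
    have "components n G - insert B (V ` {1..m}) = comps ?R (G \<inter> edges ?R) - {B}"
      unfolding rest_comps[symmetric] by blast
    then have small: "\<forall>D\<in>components n G - insert B (V ` {1..m}). real (card D) < real n * \<epsilon>"
      using B(4) by simp
    have "\<exists>C. selects n \<delta> m u G C \<and> (\<forall>i\<in>{1..m}. ?near (excess G (C i)) (r_star c (u i))) \<and>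
      (\<exists>B\<in>components n G - C ` {1..m}. ?near (real (card B)) ?v \<and> ?near (excess G B) (r_star c ?v) \<and>
       (\<forall>D\<in>components n G - insert B (C ` {1..m}). real (card D) < real n * \<epsilon>))"
      by (intro exI[of _ V] conjI bexI[OF _ BC] sel ballI[OF excV] nearB small)
    then show ?thesis using False by (simp add: A_tilde_event_def Let_def)
  qed
qed

lemma selects_mono:
  assumes "selects n \<delta> m u G C" "\<delta> \<le> \<delta>'"
  shows "selects n \<delta>' m u G C"
proof -
  have "real n * \<delta> \<le> real n * \<delta>'" using assms by (intro mult_left_mono) auto
  then show ?thesis using assms(1) by (fastforce simp: selects_def algebra_simps)
qed

lemma A_event_mono:
  assumes "\<delta> \<le> \<delta>'"
  shows "A_event n \<delta> m u \<subseteq> A_event n \<delta>' m u"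
  unfolding A_event_def using selects_mono[OF _ assms] by blast

lemma A_tilde_event_mono:
  assumes "\<delta> \<le> \<delta>'"
  shows "A_tilde_event c n \<delta> \<epsilon> m u \<subseteq> A_tilde_event c n \<delta>' \<epsilon> m u"
proof -
  have *: "{G. \<exists>C. selects n \<delta> m u G C \<and> R G C} \<subseteq> {G. \<exists>C. selects n \<delta>' m u G C \<and> R G C}" for R
    using selects_mono[OF _ assms] by blast
  show ?thesis
    unfolding A_tilde_event_def Let_def
    by (cases "(\<Sum>i=1..m. u i) \<ge> 1 - 1 / c") (simp_all only: if_True if_False *)
qed

lemma A_tilde_event_subset: "A_tilde_event c n \<delta> \<epsilon> m u \<subseteq> A_event n \<delta> m u"
proof -
  have *: "{G. \<exists>C. selects n \<delta> m u G C \<and> R G C} \<subseteq> {G. \<exists>C. selects n \<delta> m u G C}" for R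
    by blast
  show ?thesis
    unfolding A_tilde_event_def A_event_def Let_def
    by (cases "(\<Sum>i=1..m. u i) \<ge> 1 - 1 / c") (simp_all only: if_True if_False *)
qed

section \<open>Large deviations\<close>

lemma tendsto_real_mult_divide:
  fixes cs :: "nat \<Rightarrow> real"
  assumes "cs \<longlonglongrightarrow> c"
  shows "(\<lambda>n. real n * (cs n / real n)) \<longlonglongrightarrow> c"
proof (rule Lim_transform_eventually[OF assms])
  show "\<forall>\<^sub>F n in sequentially. cs n = real n * (cs n / real n)"
    using eventually_ge_at_top[of 1] by eventually_elim simp
qed

context
  fixes c :: real and cs :: "nat \<Rightarrow> real" and m :: nat and u :: "nat \<Rightarrow> real"
  assumes cs: "cs \<longlonglongrightarrow> c" and c: "c > 0" and u: "\<forall>i\<in>{1..m}. u i > 0"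
begin

lemma u_pos: "i \<in> {1..m} \<Longrightarrow> u i > 0"
  using u by simp

lemma ev_p: "\<forall>\<^sub>F n in sequentially. 0 < cs n / real n \<and> cs n / real n < 1"
  using ev_p_pos[OF filterlim_ident tendsto_real_mult_divide[OF cs] c]
    ev_p_less[OF filterlim_ident tendsto_real_mult_divide[OF cs] c zero_less_one]
  by eventually_elim simp

text \<open>Tuples with the same sizes are equally likely, so each size profile contributes at most
  the quantity of \<open>tuples_rate\<close>, uniformly along \<open>window_filter\<close>. There
  are at most \<open>(n + 1) ^ m\<close> profiles.\<close>

lemma window_sum_upper:
  assumes \<eta>: "\<eta> > 0"
  obtains \<delta> where "\<delta> > 0" "\<forall>\<^sub>F n in sequentially.
    (\<Sum>V\<in>window \<delta> n m u. comps_prob (cs n / real n) {..<n} {1..m} V)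
      \<le> exp (real n * (- ((\<Sum>i=1..m. K c (u i)) + L c (\<Sum>i=1..m. u i)) + \<eta>))"
proof -
  define J where "J = (\<Sum>i=1..m. K c (u i)) + L c (\<Sum>i=1..m. u i)"
  let ?M = "\<lambda>n V. real (card (profile_tuples {1..m} {..<n} (\<lambda>i. card (V i)))) * comps_prob (cs n / real n) {..<n} {1..m} V"
  have "((\<lambda>z. ln (?M (fst z) (snd z)) / real (fst z)) \<longlongrightarrow> - J) (window_filter m u)"
    unfolding J_def
    by (rule tuples_rate[OF filterlim_window_filter[OF filterlim_ident]
          filterlim_window_filter[OF tendsto_real_mult_divide[OF cs]] c _ window_filter_tuples u_pos window_filter_card])
      auto
  then have "\<forall>\<^sub>F z in window_filter m u. ln (?M (fst z) (snd z)) / real (fst z) < - J + \<eta> / 2"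
    using \<eta> by (intro order_tendstoD(2)) auto
  then obtain \<delta> where \<delta>: "\<delta> > 0"
    and ev: "\<forall>\<^sub>F n in sequentially. \<forall>V\<in>window \<delta> n m u. ln (?M n V) / real n < - J + \<eta> / 2"
    by (rule window_filterD) auto
  \<comment> \<open>The bracket is \<open>ln (n + 1) / n\<close>, written so that its limit is
    immediate; the number of profiles uses up one half of \<open>\<eta>\<close>.\<close>
  have "(\<lambda>n. real m * (ln (1 + 1 / real n) * (1 / real n) + ln (real n) / real n)) \<longlonglongrightarrow> real m * (ln (1 + 0) * 0 + 0)"
    by (intro tendsto_intros inverse_n[OF filterlim_ident] lim_ln_over_n) auto
  then have poly: "\<forall>\<^sub>F n in sequentially. real m * (ln (1 + 1 / real n) * (1 / real n) + ln (real n) / real n) < \<eta> / 2"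
    using \<eta> by (intro order_tendstoD(2)[where y = "real m * (ln (1 + 0) * 0 + 0)"]) auto
  have "\<forall>\<^sub>F n in sequentially. (\<Sum>V\<in>window \<delta> n m u. comps_prob (cs n / real n) {..<n} {1..m} V)
      \<le> exp (real n * (- J + \<eta>))"
    using ev poly ev_p eventually_ge_at_top[of 1]
  proof eventually_elim
    case (elim n)
    let ?W = "window \<delta> n m u" and ?P = "comps_prob (cs n / real n) {..<n} {1..m}"
    let ?prof = "\<lambda>V. restrict (\<lambda>i. card (V i)) {1..m}"
    let ?T = "{1..m} \<rightarrow>\<^sub>E {..n}"
    have p: "0 \<le> cs n / real n" "cs n / real n \<le> 1" using elim by auto
    have profT: "?prof ` ?W \<subseteq> ?T"
    proof (rule image_subsetI)
      fix V assume V: "V \<in> ?W"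
      have "card (V i) \<le> n" if "i \<in> {1..m}" for i
        using card_mono[OF _ tuplesD(1)[OF window_tuples[OF V] that]] by simp
      then show "?prof V \<in> ?T" by auto
    qed
    have "(\<Sum>V\<in>?W. ?P V) = (\<Sum>k\<in>?T. \<Sum>V | V \<in> ?W \<and> ?prof V = k. ?P V)"
      using profT by (intro sum.group[symmetric] finite_window finite_PiE) auto
    also have "\<dots> \<le> (\<Sum>k\<in>?T. exp (real n * (- J + \<eta> / 2)))"
    proof (rule sum_mono)
      fix k assume "k \<in> ?T"
      show "(\<Sum>V | V \<in> ?W \<and> ?prof V = k. ?P V) \<le> exp (real n * (- J + \<eta> / 2))"
      proof (cases "\<exists>V\<in>?W. ?prof V = k")
        case True
        then obtain V where V: "V \<in> ?W" "?prof V = k" by blast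
        have kV: "card (V' i) = card (V i)" if "?prof V' = k" "i \<in> {1..m}" for V' i
          using that V(2) by (metis restrict_apply')
        have sub: "{V' \<in> ?W. ?prof V' = k} \<subseteq> profile_tuples {1..m} {..<n} (\<lambda>i. card (V i))"
        proof
          fix V' assume "V' \<in> {V' \<in> ?W. ?prof V' = k}"
          then have "V' \<in> ?W" "?prof V' = k" by simp_all
          then show "V' \<in> profile_tuples {1..m} {..<n} (\<lambda>i. card (V i))"
            using kV[of V'] window_tuples[of V'] unfolding profile_tuples_def by blast
        qed
        have fin: "finite (profile_tuples {1..m} {..<n} (\<lambda>i. card (V i)))"
          using finite_tuples[of "{1..m}" "{..<n}"] by (simp add: profile_tuples_def)
        have "(\<Sum>V' | V' \<in> ?W \<and> ?prof V' = k. ?P V') = (\<Sum>V' | V' \<in> ?W \<and> ?prof V' = k. ?P V)"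
          using V(1) kV window_tuples by (intro sum.cong refl comps_prob_cong) auto
        also have "\<dots> = real (card {V' \<in> ?W. ?prof V' = k}) * ?P V" by simp
        also have "\<dots> \<le> ?M n V"
          using card_mono[OF fin sub] p by (intro mult_right_mono comps_prob_nonneg) auto
        also have "\<dots> \<le> exp (real n * (- J + \<eta> / 2))"
        proof (cases "?M n V > 0")
          case True
          have "ln (?M n V) / real n < - J + \<eta> / 2" using elim V(1) by blast
          then have "ln (?M n V) \<le> real n * (- J + \<eta> / 2)"
            using elim by (simp add: pos_divide_less_eq mult.commute)
          then have "exp (ln (?M n V)) \<le> exp (real n * (- J + \<eta> / 2))" by (simp only: exp_le_cancel_iff)
          then show ?thesis unfolding exp_ln[OF True] .
        next
          case False
          then show ?thesis using exp_ge_zero[of "real n * (- J + \<eta> / 2)"] by linarith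
        qed
        finally show ?thesis .
      next
        case False
        then have "{V \<in> ?W. ?prof V = k} = {}" by blast
        then show ?thesis by (simp only: sum.empty exp_ge_zero)
      qed
    qed
    also have "\<dots> = (real n + 1) ^ m * exp (real n * (- J + \<eta> / 2))"
      by (simp add: card_PiE add.commute)
    also have "(real n + 1) ^ m \<le> exp (real n * (\<eta> / 2))"
    proof -
      have "ln (1 + 1 / real n) + ln (real n) = ln (real n + 1)"
      proof -
        have "1 + 1 / real n > 0" by (simp add: add_pos_nonneg)
        then have "ln (1 + 1 / real n) + ln (real n) = ln ((1 + 1 / real n) * real n)"
          using elim by (subst ln_mult_pos) auto
        also have "(1 + 1 / real n) * real n = real n + 1" using elim by (simp add: field_simps)
        finally show ?thesis .
      qed
      then have "real m * (ln (real n + 1) / real n) < \<eta> / 2"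
        using elim by (simp add: add_divide_distrib[symmetric])
      then have "real m * ln (real n + 1) \<le> real n * (\<eta> / 2)"
        using elim by (simp add: field_simps)
      then have "exp (real m * ln (real n + 1)) \<le> exp (real n * (\<eta> / 2))" by simp
      then show ?thesis by (simp add: exp_of_nat_mult)
    qed
    also have "exp (real n * (\<eta> / 2)) * exp (real n * (- J + \<eta> / 2)) = exp (real n * (- J + \<eta>))"
      by (simp add: algebra_simps flip: exp_add)
    finally show ?case by simp
  qed
  then show ?thesis using that \<delta> unfolding J_def by blast
qed

text \<open>A single profile suffices, with sizes \<open>u i * n\<close> rounded down: this keeps
  their sum at most \<open>n\<close> even if the \<open>u i\<close> add up to 1.\<close>

lemma window_sum_lower:
  assumes s: "(\<Sum>i=1..m. u i) \<le> 1" and \<eta>: "\<eta> > 0" and \<delta>: "\<delta> > 0"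
  shows "\<forall>\<^sub>F n in sequentially.
    exp (real n * (- ((\<Sum>i=1..m. K c (u i)) + L c (\<Sum>i=1..m. u i)) - \<eta>))
      \<le> (\<Sum>V\<in>window \<delta> n m u. comps_prob (cs n / real n) {..<n} {1..m} V)"
proof -
  define J where "J = (\<Sum>i=1..m. K c (u i)) + L c (\<Sum>i=1..m. u i)"
  define k where "k n i = nat \<lfloor>u i * real n\<rfloor>" for n i
  have kb: "u i * real n - 1 < real (k n i)" "real (k n i) \<le> u i * real n" if "i \<in> {1..m}" for n i
  proof -
    have "0 \<le> u i * real n" using u_pos[OF that] by simp
    then show "u i * real n - 1 < real (k n i)" "real (k n i) \<le> u i * real n"
      unfolding k_def by linarith+
  qed
  have ksum: "(\<Sum>i\<in>{1..m}. k n i) \<le> n" for n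
  proof -
    have "(\<Sum>i\<in>{1..m}. real (k n i)) \<le> (\<Sum>i\<in>{1..m}. u i * real n)" by (intro sum_mono kb)
    also have "\<dots> = (\<Sum>i\<in>{1..m}. u i) * real n" by (simp add: sum_distrib_right)
    also have "\<dots> \<le> 1 * real n" using s by (intro mult_right_mono) auto
    finally show ?thesis by (simp flip: of_nat_sum)
  qed
  define V where "V n = (SOME V. V \<in> profile_tuples {1..m} {..<n} (k n))" for n
  have V: "V n \<in> profile_tuples {1..m} {..<n} (k n)" for n
  proof -
    have "card (profile_tuples {1..m} {..<n} (k n)) * (\<Prod>i\<in>{1..m}. fact (k n i)) * fact (n - (\<Sum>i\<in>{1..m}. k n i)) = (fact n :: nat)"
      using card_profile_tuples[of "{1..m}" "{..<n}" "k n"] ksum[of n] by simp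
    then have "card (profile_tuples {1..m} {..<n} (k n)) \<noteq> 0"
      by (metis fact_nonzero mult_is_0)
    then have "profile_tuples {1..m} {..<n} (k n) \<noteq> {}" by (metis card.empty)
    then show ?thesis unfolding V_def by (simp add: some_in_eq)
  qed
  have Vt: "V n \<in> tuples {1..m} {..<n}" and Vk: "i \<in> {1..m} \<Longrightarrow> card (V n i) = k n i" for n i
    using V[of n] by (auto simp: profile_tuples_def)
  have klim: "(\<lambda>n. real (card (V n i)) / real n) \<longlonglongrightarrow> u i" if i: "i \<in> {1..m}" for i
  proof (rule tendsto_sandwich)
    show "\<forall>\<^sub>F n in sequentially. u i - 1 / real n \<le> real (card (V n i)) / real n"
      using eventually_ge_at_top[of 1]
    proof eventually_elim
      case (elim n)
      have "(u i * real n - 1) / real n \<le> real (k n i) / real n"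
        using kb(1)[OF i, of n] by (intro divide_right_mono) auto
      then show ?case using elim unfolding Vk[OF i] by (simp add: diff_divide_distrib)
    qed
    show "\<forall>\<^sub>F n in sequentially. real (card (V n i)) / real n \<le> u i"
      using eventually_ge_at_top[of 1]
    proof eventually_elim
      case (elim n)
      then show ?case using kb(2)[OF i, of n] unfolding Vk[OF i] by (simp add: field_simps)
    qed
    show "(\<lambda>n. u i - 1 / real n) \<longlonglongrightarrow> u i"
      using tendsto_diff[OF tendsto_const inverse_n[OF filterlim_ident], of "u i"] by simp
  qed simp
  let ?M = "\<lambda>n. real (card (profile_tuples {1..m} {..<n} (\<lambda>i. card (V n i)))) * comps_prob (cs n / real n) {..<n} {1..m} (V n)"
  have "(\<lambda>n. ln (?M n) / real n) \<longlonglongrightarrow> - J"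
    unfolding J_def
    by (rule tuples_rate[OF filterlim_ident tendsto_real_mult_divide[OF cs] c _ always_eventually[OF allI[OF Vt]] u_pos klim])
      auto
  then have "\<forall>\<^sub>F n in sequentially. - J - \<eta> < ln (?M n) / real n"
    using \<eta> by (intro order_tendstoD(1)) auto
  moreover have "\<forall>\<^sub>F n in sequentially. \<forall>i\<in>{1..m}. card (V n i) \<ge> 1"
    using u_pos klim by (intro eventually_ball_finite ballI ev_k_ge[OF filterlim_ident]) auto
  ultimately have "\<forall>\<^sub>F n in sequentially. exp (real n * (- J - \<eta>))
      \<le> (\<Sum>V\<in>window \<delta> n m u. comps_prob (cs n / real n) {..<n} {1..m} V)"
    using ev_p eventually_ge_at_top[of 1] ev_n_real_ge[OF filterlim_ident, of "1 / \<delta>"]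
  proof eventually_elim
    case (elim n)
    let ?P = "comps_prob (cs n / real n) {..<n} {1..m}" and ?T = "profile_tuples {1..m} {..<n} (k n)"
    have p: "0 \<le> cs n / real n" "cs n / real n \<le> 1" using elim by auto
    have prof: "profile_tuples {1..m} {..<n} (\<lambda>i. card (V n i)) = ?T"
      using Vk by (auto simp: profile_tuples_def)
    have "?T \<subseteq> window \<delta> n m u"
    proof
      fix V' assume V': "V' \<in> ?T"
      have "real n * (u i - \<delta>) \<le> real (k n i)" "real (k n i) \<le> real n * (u i + \<delta>)" if i: "i \<in> {1..m}" for i
      proof -
        have "1 \<le> \<delta> * real n" using elim \<delta> by (simp add: field_simps)
        then show "real n * (u i - \<delta>) \<le> real (k n i)" "real (k n i) \<le> real n * (u i + \<delta>)"
          using kb[OF i, of n] by (simp_all add: algebra_simps)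
      qed
      then show "V' \<in> window \<delta> n m u" using V' by (simp add: window_def profile_tuples_def)
    qed
    then have "(\<Sum>V'\<in>?T. ?P V') \<le> (\<Sum>V\<in>window \<delta> n m u. ?P V)"
      using p by (intro sum_mono2 finite_window comps_prob_nonneg)
    moreover have "(\<Sum>V'\<in>?T. ?P V') = (\<Sum>V'\<in>?T. ?P (V n))"
      using Vk Vt by (intro sum.cong refl comps_prob_cong) (auto simp: profile_tuples_def)
    ultimately have le: "?M n \<le> (\<Sum>V\<in>window \<delta> n m u. ?P V)" unfolding prof by simp
    have "?P (V n) > 0"
      unfolding comps_prob_def using elim by (intro mult_pos_pos prod_pos zero_less_power pconn_pos) auto
    moreover have "card ?T > 0"
    proof -
      have "finite ?T" using finite_tuples[of "{1..m}" "{..<n}"] by (simp add: profile_tuples_def)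
      then show ?thesis using V[of n] card_gt_0_iff by blast
    qed
    ultimately have pos: "?M n > 0" unfolding prof by simp
    have "real n * (- J - \<eta>) \<le> ln (?M n)" using elim by (simp add: field_simps)
    then have "exp (real n * (- J - \<eta>)) \<le> exp (ln (?M n))" by (simp only: exp_le_cancel_iff)
    then show ?case using le exp_ln[OF pos] by linarith
  qed
  then show ?thesis unfolding J_def .
qed

text \<open>The number of violated requirements. A count has an additive expectation, and being
  below 1 means that all hold. The edge target \<open>r_star c (u i) + u i\<close> is the excess
  target plus the relative size.\<close>

definition bad_count :: "real \<Rightarrow> nat \<Rightarrow> (nat \<Rightarrow> nat set) \<Rightarrow> nat set set \<Rightarrow> real" where
  "bad_count \<epsilon> n V G =
     (\<Sum>i\<in>{1..m}. of_bool (\<epsilon> / 4 * real n \<le> \<bar>real (card (G \<inter> edges (V i))) - real n * (r_star c (u i) + u i)\<bar>))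
     + of_bool (\<not> rest_good c (\<Sum>i=1..m. u i) n \<epsilon> ({..<n} - (\<Union>i\<in>{1..m}. V i)) (G \<inter> edges ({..<n} - (\<Union>i\<in>{1..m}. V i))))"

text \<open>Given the tuple, each of the \<open>m + 1\<close> requirements fails with probability at
  most \<open>g = h / (m + 1)\<close>, uniformly along \<open>window_filter\<close>.\<close>

lemma bad_rare:
  assumes \<epsilon>: "\<epsilon> > 0" and h: "h > 0"
  obtains \<delta> where "\<delta> > 0" "\<forall>\<^sub>F n in sequentially. \<forall>V\<in>window \<delta> n m u.
    gex (cs n / real n) (edges {..<n}) (\<lambda>G. of_bool (\<forall>i\<in>{1..m}. V i \<in> comps {..<n} G) * bad_count \<epsilon> n V G)
      \<le> h * comps_prob (cs n / real n) {..<n} {1..m} V"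
proof -
  define s where "s = (\<Sum>i=1..m. u i)"
  define g where "g = h / (real m + 1)"
  have g: "g > 0" using h by (simp add: g_def)
  let ?p = "\<lambda>n. cs n / real n"
  let ?W = "window_filter m u"
  have n': "filterlim (\<lambda>z. fst z) sequentially ?W" by (rule filterlim_window_filter[OF filterlim_ident])
  have pc': "((\<lambda>z. real (fst z) * ?p (fst z)) \<longlongrightarrow> c) ?W"
    by (rule filterlim_window_filter[OF tendsto_real_mult_divide[OF cs]])
  let ?R = "\<lambda>n V. {..<n} - (\<Union>i\<in>{1..m}. V i)"
  have R: "((\<lambda>z. real (card (?R (fst z) (snd z))) / real (fst z)) \<longlongrightarrow> 1 - s) ?W"
    unfolding s_def
    by (rule rest_asymp[OF n' pc' c _ window_filter_tuples u_pos window_filter_card]) auto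
  have "((\<lambda>z. gex (?p (fst z)) (edges (?R (fst z) (snd z)))
      (\<lambda>H. of_bool (\<not> rest_good c s (fst z) \<epsilon> (?R (fst z) (snd z)) H))) \<longlongrightarrow> 0) ?W"
  \<comment> \<open>The case split is \<open>c * (1 - s) \<le> 1\<close>: the rest has relative size
    \<open>1 - s\<close>, and is either not supercritical or has a giant component.\<close>
  proof (cases "s \<ge> 1 - 1 / c")
    case True
    then have "c * (1 - s) \<le> 1" using c by (simp add: field_simps)
    from no_big_comp[OF n' pc' c _ R this \<epsilon>] show ?thesis
      using True by (simp add: rest_good_def not_less)
  next
    case False
    then have v: "u_star c s > 0" "u_star c s = (1 - s) * (1 - exp (- (c * u_star c s)))"
      using u_star_root[OF c, of s] by auto
    have "r_star c (u_star c s) = c * (u_star c s)\<^sup>2 / (1 - exp (- (c * u_star c s))) - c * (u_star c s)\<^sup>2 / 2 - u_star c s"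
      by (simp add: r_star_def)
    then show ?thesis
      using False giant_whp[OF n' pc' c _ R v \<epsilon>] by (simp add: rest_good_def)
  qed
  then have ev_rest: "\<forall>\<^sub>F z in ?W. gex (?p (fst z)) (edges (?R (fst z) (snd z)))
      (\<lambda>H. of_bool (\<not> rest_good c s (fst z) \<epsilon> (?R (fst z) (snd z)) H)) < g"
    using g by (rule order_tendstoD(2))
  let ?f = "\<lambda>n i H. of_bool (\<epsilon> / 4 * real n \<le> \<bar>real (card H) - real n * (r_star c (u i) + u i)\<bar>)"
  have fin: "\<forall>\<^sub>F z in ?W. finite (snd z i)" if "i \<in> {1..m}" for i
    using window_filter_tuples
  proof eventually_elim
    case (elim z)
    then show ?case using tuplesD(1)[OF elim that] finite_subset by blast
  qed
  have "\<forall>\<^sub>F z in ?W. gex (?p (fst z)) (edges (snd z i)) (\<lambda>H. of_bool (conn (snd z i) H) * ?f (fst z) i H)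
      \<le> g * pconn (card (snd z i)) (?p (fst z))" if i: "i \<in> {1..m}" for i
  proof -
    have e: "r_star c (u i) + u i = c * (u i)\<^sup>2 / (1 - exp (- (c * u i))) - c * (u i)\<^sup>2 / 2"
      by (simp add: r_star_def)
    have "((\<lambda>z. gex (?p (fst z)) (edges (snd z i)) (\<lambda>H. of_bool (conn (snd z i) H) * ?f (fst z) i H)
      / pconn (card (snd z i)) (?p (fst z))) \<longlongrightarrow> 0) ?W"
      unfolding e using \<epsilon>
      by (intro edge_count_concentration[OF n' pc' c fin[OF i] window_filter_card[OF i] u_pos[OF i]]) simp
    then have "\<forall>\<^sub>F z in ?W. gex (?p (fst z)) (edges (snd z i)) (\<lambda>H. of_bool (conn (snd z i) H) * ?f (fst z) i H)
      / pconn (card (snd z i)) (?p (fst z)) < g"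
      using g by (rule order_tendstoD(2))
    then show ?thesis
      using ev_k_ge[OF n' window_filter_card[OF i] u_pos[OF i]] ev_p_pos[OF n' pc' c] ev_p_less[OF n' pc' c zero_less_one]
    proof eventually_elim
      case (elim z)
      have "pconn (card (snd z i)) (?p (fst z)) > 0" using elim by (intro pconn_pos) auto
      then show ?case using elim by (simp add: pos_divide_less_eq)
    qed
  qed
  then have "\<forall>\<^sub>F z in ?W. \<forall>i\<in>{1..m}. gex (?p (fst z)) (edges (snd z i)) (\<lambda>H. of_bool (conn (snd z i) H) * ?f (fst z) i H)
      \<le> g * pconn (card (snd z i)) (?p (fst z))"
    by (intro eventually_ball_finite) auto
  then have "\<forall>\<^sub>F z in ?W.
    gex (?p (fst z)) (edges {..<fst z}) (\<lambda>G. of_bool (\<forall>i\<in>{1..m}. snd z i \<in> comps {..<fst z} G) * bad_count \<epsilon> (fst z) (snd z) G)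
      \<le> h * comps_prob (?p (fst z)) {..<fst z} {1..m} (snd z)"
    using ev_rest window_filter_tuples ev_p_pos[OF n' pc' c] ev_p_less[OF n' pc' c zero_less_one]
  proof eventually_elim
    case (elim z)
    obtain n V where z: "z = (n, V)" by (cases z)
    have p: "0 \<le> ?p n" "?p n \<le> 1" using elim by (auto simp: z)
    have V: "V \<in> tuples {1..m} {..<n}" using elim by (simp add: z)
    let ?c = "\<lambda>G. of_bool (\<forall>i\<in>{1..m}. V i \<in> comps {..<n} G) :: real"
    let ?P = "comps_prob (?p n) {..<n} {1..m} V"
    have "gex (?p n) (edges {..<n}) (\<lambda>G. ?c G * bad_count \<epsilon> n V G) =
        (\<Sum>i\<in>{1..m}. gex (?p n) (edges {..<n}) (\<lambda>G. ?c G * ?f n i (G \<inter> edges (V i)))) +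
        gex (?p n) (edges {..<n}) (\<lambda>G. ?c G * of_bool (\<not> rest_good c s n \<epsilon> (?R n V) (G \<inter> edges (?R n V))))"
      unfolding bad_count_def s_def[symmetric] distrib_left sum_distrib_left
      by (simp only: gex_add gex_sum)
    also have "\<dots> \<le> (\<Sum>i\<in>{1..m}. g * ?P) + g * ?P"
    proof (intro add_mono sum_mono)
      fix i assume i: "i \<in> {1..m}"
      show "gex (?p n) (edges {..<n}) (\<lambda>G. ?c G * ?f n i (G \<inter> edges (V i))) \<le> g * ?P"
        using elim(1) i by (intro gex_all_comps_edge_count[OF p _ _ V i]) (auto simp: z)
    next
      show "gex (?p n) (edges {..<n}) (\<lambda>G. ?c G * of_bool (\<not> rest_good c s n \<epsilon> (?R n V) (G \<inter> edges (?R n V)))) \<le> g * ?P"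
        using elim(2) by (intro gex_all_comps_rest[OF p _ _ V]) (auto simp: z)
    qed
    also have "\<dots> = (real m + 1) * g * ?P" by (simp add: algebra_simps)
    also have "\<dots> = h * ?P" by (simp add: g_def)
    finally show ?case by (simp add: z)
  qed
  then obtain \<delta> where "\<delta> > 0" "\<forall>\<^sub>F n in sequentially. \<forall>V\<in>window \<delta> n m u.
    gex (?p n) (edges {..<n}) (\<lambda>G. of_bool (\<forall>i\<in>{1..m}. V i \<in> comps {..<n} G) * bad_count \<epsilon> n V G)
      \<le> h * comps_prob (?p n) {..<n} {1..m} V"
    by (rule window_filterD) auto
  then show ?thesis using that by blast
qed

lemma bad_count_nonneg: "0 \<le> bad_count \<epsilon> n V G"
  unfolding bad_count_def by (intro add_nonneg_nonneg sum_nonneg) auto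

lemma bad_count_less_1D:
  assumes "bad_count \<epsilon> n V G < 1"
  shows "\<And>i. i \<in> {1..m} \<Longrightarrow> \<bar>real (card (G \<inter> edges (V i))) - real n * (r_star c (u i) + u i)\<bar> < \<epsilon> / 4 * real n"
    and "rest_good c (\<Sum>i=1..m. u i) n \<epsilon> ({..<n} - (\<Union>i\<in>{1..m}. V i)) (G \<inter> edges ({..<n} - (\<Union>i\<in>{1..m}. V i)))"
proof -
  let ?f = "\<lambda>i. of_bool (\<epsilon> / 4 * real n \<le> \<bar>real (card (G \<inter> edges (V i))) - real n * (r_star c (u i) + u i)\<bar>) :: real"
  let ?g = "of_bool (\<not> rest_good c (\<Sum>i=1..m. u i) n \<epsilon> ({..<n} - (\<Union>i\<in>{1..m}. V i)) (G \<inter> edges ({..<n} - (\<Union>i\<in>{1..m}. V i)))) :: real"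
  have sum: "sum ?f {1..m} + ?g < 1" using assms by (simp only: bad_count_def)
  have f0: "0 \<le> sum ?f {1..m}" by (intro sum_nonneg) simp
  have g0: "0 \<le> ?g" by simp
  have "?g < 1" using sum f0 by linarith
  then show "rest_good c (\<Sum>i=1..m. u i) n \<epsilon> ({..<n} - (\<Union>i\<in>{1..m}. V i)) (G \<inter> edges ({..<n} - (\<Union>i\<in>{1..m}. V i)))"
    by (rule contrapos_pp) simp
  fix i assume i: "i \<in> {1..m}"
  have "?f i \<le> sum ?f {1..m}" by (rule member_le_sum[OF i]) simp_all
  then have "?f i < 1" using sum g0 by linarith
  then have "\<not> \<epsilon> / 4 * real n \<le> \<bar>real (card (G \<inter> edges (V i))) - real n * (r_star c (u i) + u i)\<bar>"
    by (rule contrapos_pn) simp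
  then show "\<bar>real (card (G \<inter> edges (V i))) - real n * (r_star c (u i) + u i)\<bar> < \<epsilon> / 4 * real n" by simp
qed

end

section \<open>From exponential bounds to limits in the extended reals\<close>

lemma log_prob_ge:
  assumes n: "n \<ge> 1" and P: "exp (real n * a) \<le> P"
  shows "ereal a \<le> ereal (1 / real n) * log_prob P"
proof -
  have pos: "P > 0" using P exp_gt_zero[of "real n * a"] by linarith
  have "real n * a \<le> ln P" using P pos by (simp add: ln_ge_iff)
  then have "a \<le> 1 / real n * ln P" using n by (simp add: field_simps)
  then show ?thesis using pos by (simp add: log_prob_def)
qed

lemma log_prob_le:
  assumes n: "n \<ge> 1" and P: "P \<le> exp (real n * b)" "0 \<le> P"
  shows "ereal (1 / real n) * log_prob P \<le> ereal b"
proof (cases "P = 0")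
  case True
  then show ?thesis using n by (simp add: log_prob_def)
next
  case False
  then have pos: "P > 0" using P by simp
  have "ln P \<le> ln (exp (real n * b))" using P pos by (intro ln_mono) auto
  then have "1 / real n * ln P \<le> b" using n by (simp add: field_simps)
  then show ?thesis using pos by (simp add: log_prob_def)
qed

lemma tendsto_ereal_interval:
  fixes f :: "'a \<Rightarrow> ereal"
  assumes "\<And>\<eta>. \<eta> > 0 \<Longrightarrow> \<forall>\<^sub>F x in F. ereal (l - \<eta>) \<le> f x \<and> f x \<le> ereal (l + \<eta>)"
  shows "(f \<longlongrightarrow> ereal l) F"
proof (rule order_tendstoI)
  fix a assume "a < ereal l"
  then obtain r where r: "a < ereal r" "r < l"
    using ereal_dense2[of a "ereal l"] by (metis ereal_less_ereal_Ex less_ereal.simps(1))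
  have "\<forall>\<^sub>F x in F. ereal (l - (l - r)) \<le> f x \<and> f x \<le> ereal (l + (l - r))"
    using r by (intro assms) simp
  then show "\<forall>\<^sub>F x in F. a < f x"
    by eventually_elim (use r in \<open>auto intro: less_le_trans\<close>)
next
  fix a assume "ereal l < a"
  then obtain r where r: "ereal r < a" "l < r"
    using ereal_dense2[of "ereal l" a] by (metis less_ereal.simps(1))
  have "\<forall>\<^sub>F x in F. ereal (l - (r - l)) \<le> f x \<and> f x \<le> ereal (l + (r - l))"
    using r by (intro assms) simp
  then show "\<forall>\<^sub>F x in F. f x < a"
    by eventually_elim (use r in \<open>auto intro: le_less_trans\<close>)
qed

lemma rate_limits:
  fixes PA :: "nat \<Rightarrow> real"
  assumes "\<forall>\<^sub>F n in sequentially. exp (real n * a) \<le> PA n"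
    and "\<forall>\<^sub>F n in sequentially. PA n \<le> exp (real n * b)"
  shows "ereal a \<le> liminf (\<lambda>n. ereal (1 / real n) * log_prob (PA n))"
    and "limsup (\<lambda>n. ereal (1 / real n) * log_prob (PA n)) \<le> ereal b"
    and "liminf (\<lambda>n. ereal (1 / real n) * log_prob (PA n)) \<le> limsup (\<lambda>n. ereal (1 / real n) * log_prob (PA n))"
proof -
  let ?r = "\<lambda>n. ereal (1 / real n) * log_prob (PA n)"
  have "\<forall>\<^sub>F n in sequentially. ereal a \<le> ereal (1 / real n) * log_prob (PA n)"
    using assms(1) eventually_ge_at_top[of 1] by eventually_elim (rule log_prob_ge)
  then show "ereal a \<le> liminf ?r" by (rule Liminf_bounded)
  have "\<forall>\<^sub>F n in sequentially. ereal (1 / real n) * log_prob (PA n) \<le> ereal b"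
    using assms eventually_ge_at_top[of 1]
  proof eventually_elim
    case (elim n)
    have "0 \<le> PA n" using elim exp_ge_zero[of "real n * a"] by linarith
    then show ?case using elim by (intro log_prob_le)
  qed
  then show "limsup ?r \<le> ereal b" by (rule Limsup_bounded)
  show "liminf ?r \<le> limsup ?r"
    by (rule Liminf_le_Limsup) simp
qed

text \<open>An upper bound on the probability of \<open>A\<close> for small \<open>\<delta>\<close>,
  a lower bound for every \<open>\<delta>\<close>, and the estimate that \<open>A'\<close> has at
  least the share \<open>1 - h\<close> of the probability of \<open>A\<close> suffice, since
  \<open>A'\<close> is contained in \<open>A\<close>.\<close>

theorem corollary2p3:
  fixes c :: real and cs :: "nat \<Rightarrow> real" and m :: nat and u :: "nat \<Rightarrow> real"
  assumes "cs \<longlonglongrightarrow> c" and "c > 0"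
    and "m \<ge> 1"
    and "\<forall>i\<in>{1..m}. u i \<in> {0<..1}"
    and "(\<Sum>i=1..m. u i) \<le> 1"
  defines "P \<equiv> \<lambda>n. measure_pmf (random_graph n (cs n / real n))"
    and "A \<equiv> \<lambda>\<delta> n. A_event n \<delta> m u"
    and "A' \<equiv> \<lambda>\<delta> \<epsilon> n. A_tilde_event c n \<delta> \<epsilon> m u"
    and "J \<equiv> (\<Sum>i=1..m. K c (u i)) + L c (\<Sum>i=1..m. u i)"
  shows "((\<lambda>\<delta>. limsup (\<lambda>n. ereal (1 / real n) * log_prob (measure (P n) (A \<delta> n))))
            \<longlongrightarrow> ereal (- J)) (at_right 0)
       \<and> ((\<lambda>\<delta>. liminf (\<lambda>n. ereal (1 / real n) * log_prob (measure (P n) (A \<delta> n))))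
            \<longlongrightarrow> ereal (- J)) (at_right 0)
       \<and> ((\<lambda>(\<delta>, \<epsilon>). limsup (\<lambda>n. ereal (1 / real n) * log_prob (measure (P n) (A' \<delta> \<epsilon> n))))
            \<longlongrightarrow> ereal (- J)) (at_right 0 \<times>\<^sub>F at_right 0)
       \<and> ((\<lambda>(\<delta>, \<epsilon>). liminf (\<lambda>n. ereal (1 / real n) * log_prob (measure (P n) (A' \<delta> \<epsilon> n))))
            \<longlongrightarrow> ereal (- J)) (at_right 0 \<times>\<^sub>F at_right 0)
       \<and> (\<forall>\<epsilon>>0. ((\<lambda>\<delta>. liminf (\<lambda>n. ereal (cond_prob (P n) (\<lambda>G. G \<in> A' \<delta> \<epsilon> n) (\<lambda>G. G \<in> A \<delta> n))))
            \<longlongrightarrow> 1) (at_right 0))"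
proof -
  note cs = assms(1) and c = assms(2) and s = assms(5)
  have u: "\<forall>i\<in>{1..m}. u i > 0" using assms(4) by auto
  note ev_p' = ev_p[OF cs c u]
  \<comment> \<open>Half of the smallest \<open>u i\<close>: for \<open>\<delta> \<le> b\<close> all
    chosen components have at least \<open>b n\<close> vertices, as \<open>A_event_ge\<close>
    requires.\<close>
  define b where "b = Min (u ` {1..m}) / 2"
  have "Min (u ` {1..m}) \<in> u ` {1..m}" using assms(3) by (intro Min_in) auto
  then have b: "b > 0" using u by (auto simp: b_def)
  have bu: "b \<le> u i - \<delta>" if "i \<in> {1..m}" "\<delta> \<le> b" for i \<delta>
  proof -
    have "2 * b \<le> u i" unfolding b_def using that(1) by simp
    then show ?thesis using that(2) by simp
  qed
  define PA where "PA \<delta> n = measure (P n) (A \<delta> n)" for \<delta> n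
  define PA' where "PA' \<delta> \<epsilon> n = measure (P n) (A' \<delta> \<epsilon> n)" for \<delta> \<epsilon> n
  define S where "S \<delta> n = (\<Sum>V\<in>window \<delta> n m u. comps_prob (cs n / real n) {..<n} {1..m} V)" for \<delta> n
  \<comment> \<open>Monotonicity extends an upper bound to smaller and a lower bound to larger
    \<open>\<delta>\<close>.\<close>
  have PA_mono: "PA \<delta> n \<le> PA \<delta>' n" if "\<delta> \<le> \<delta>'" for \<delta> \<delta>' n
    unfolding PA_def P_def A_def by (intro measure_pmf.finite_measure_mono A_event_mono[OF that]) simp
  have PA'_mono: "PA' \<delta> \<epsilon> n \<le> PA' \<delta>' \<epsilon> n" if "\<delta> \<le> \<delta>'" for \<delta> \<delta>' \<epsilon> n
    unfolding PA'_def P_def A'_def by (intro measure_pmf.finite_measure_mono A_tilde_event_mono[OF that]) simp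
  have PA'_le: "PA' \<delta> \<epsilon> n \<le> PA \<delta> n" for \<delta> \<epsilon> n
    unfolding PA'_def PA_def P_def A_def A'_def by (intro measure_pmf.finite_measure_mono A_tilde_event_subset) simp
  have link: "measure (P n) X = gex (cs n / real n) (edges {..<n}) (\<lambda>G. of_bool (G \<in> X))"
    if "0 < cs n / real n \<and> cs n / real n < 1" for n X
    unfolding P_def using that by (simp add: measure_random_graph all_edges_eq_edges)
  have upper: "\<exists>\<delta>0>0. \<forall>\<delta>\<le>\<delta>0. \<forall>\<^sub>F n in sequentially. PA \<delta> n \<le> exp (real n * (- J + \<eta>))" if \<eta>: "\<eta> > 0" for \<eta>
  proof -
    obtain \<delta>0 where \<delta>0: "\<delta>0 > 0" "\<forall>\<^sub>F n in sequentially. S \<delta>0 n \<le> exp (real n * (- J + \<eta>))"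
      unfolding S_def J_def using window_sum_upper[OF cs c u \<eta>] by blast
    have "\<forall>\<^sub>F n in sequentially. PA \<delta> n \<le> exp (real n * (- J + \<eta>))" if "\<delta> \<le> \<delta>0" for \<delta>
      using \<delta>0(2) ev_p'
    proof eventually_elim
      case (elim n)
      have "PA \<delta> n \<le> PA \<delta>0 n" by (rule PA_mono[OF that])
      also have "\<dots> \<le> S \<delta>0 n" unfolding PA_def link[OF elim(2)] A_def S_def using elim by (intro A_event_le) auto
      also have "\<dots> \<le> exp (real n * (- J + \<eta>))" using elim by blast
      finally show ?case .
    qed
    then show ?thesis using \<delta>0(1) by blast
  qed
  have S_le: "\<forall>\<^sub>F n in sequentially. S \<delta> n \<le> (1 / b) ^ m * PA \<delta> n" if "\<delta> \<le> b" for \<delta>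
    using ev_p' eventually_ge_at_top[of 1]
  proof eventually_elim
    case (elim n)
    show ?case unfolding PA_def link[OF elim(1)] A_def S_def
      using elim b bu that by (intro A_event_ge) auto
  qed
  \<comment> \<open>Constant factors such as \<open>b ^ m\<close> are paid for by half of
    \<open>\<eta>\<close> in the exponent.\<close>
  have absorb: "\<forall>\<^sub>F n in sequentially. exp (real n * (- J - \<eta>)) \<le> t * exp (real n * (- J - \<eta> / 2))"
    if "\<eta> > 0" "t > 0" for \<eta> t
  proof -
    have "((\<lambda>n. exp (- (\<eta> / 2 * real n))) \<longlongrightarrow> 0) sequentially"
      using that by (intro exp_decay[OF filterlim_ident]) simp
    then have "\<forall>\<^sub>F n in sequentially. exp (- (\<eta> / 2 * real n)) < t" using that(2) by (rule order_tendstoD(2))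
    then show ?thesis
    proof eventually_elim
      case (elim n)
      have "exp (real n * (- J - \<eta>)) = exp (- (\<eta> / 2 * real n)) * exp (real n * (- J - \<eta> / 2))"
        by (simp add: algebra_simps flip: exp_add)
      also have "\<dots> \<le> t * exp (real n * (- J - \<eta> / 2))" using elim by (intro mult_right_mono) auto
      finally show ?case .
    qed
  qed
  have lower: "\<forall>\<^sub>F n in sequentially. exp (real n * (- J - \<eta>)) \<le> PA \<delta> n" if \<eta>: "\<eta> > 0" and \<delta>: "\<delta> > 0" for \<eta> \<delta>
  proof -
    define d where "d = min \<delta> b"
    have d: "d > 0" "d \<le> \<delta>" "d \<le> b" using \<delta> b by (auto simp: d_def)
    have "\<forall>\<^sub>F n in sequentially. exp (real n * (- J - \<eta> / 2)) \<le> S d n"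
      unfolding S_def J_def using \<eta> by (intro window_sum_lower[OF cs c u s] d) auto
    then show ?thesis
      using S_le[OF d(3)] absorb[OF \<eta> zero_less_power[OF b, of m]]
    proof eventually_elim
      case (elim n)
      have "exp (real n * (- J - \<eta>)) \<le> b ^ m * exp (real n * (- J - \<eta> / 2))" using elim by blast
      also have "\<dots> \<le> b ^ m * ((1 / b) ^ m * PA d n)"
        using elim b by (intro mult_left_mono) auto
      also have "\<dots> = PA d n" using b by (simp add: power_divide)
      also have "\<dots> \<le> PA \<delta> n" by (rule PA_mono[OF d(2)])
      finally show ?case .
    qed
  qed
  have refined: "\<exists>\<delta>0>0. \<forall>\<delta>. 0 < \<delta> \<and> \<delta> \<le> \<delta>0 \<longrightarrow> (\<forall>\<^sub>F n in sequentially. (1 - h) * PA \<delta> n \<le> PA' \<delta> \<epsilon> n)"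
    if \<epsilon>: "\<epsilon> > 0" and h: "h > 0" for \<epsilon> h
  proof -
    \<comment> \<open>The factor \<open>b ^ m\<close> compensates the \<open>(1 / b) ^ m\<close>
      lost when the sum over tuples is bounded by the probability of \<open>A\<close>.\<close>
    define g where "g = h * b ^ m"
    have g: "g > 0" using h b by (simp add: g_def)
    obtain \<delta>1 where \<delta>1: "\<delta>1 > 0" "\<forall>\<^sub>F n in sequentially. \<forall>V\<in>window \<delta>1 n m u.
      gex (cs n / real n) (edges {..<n}) (\<lambda>G. of_bool (\<forall>i\<in>{1..m}. V i \<in> comps {..<n} G) * bad_count c m u \<epsilon> n V G)
        \<le> g * comps_prob (cs n / real n) {..<n} {1..m} V"
      using bad_rare[OF cs c u \<epsilon> g] by blast
    define \<delta>0 where "\<delta>0 = min \<delta>1 (min b (\<epsilon> / 4))"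
    have "\<forall>\<^sub>F n in sequentially. (1 - h) * PA \<delta> n \<le> PA' \<delta> \<epsilon> n" if \<delta>: "0 < \<delta>" "\<delta> \<le> \<delta>0" for \<delta>
    proof -
      have \<delta>': "\<delta> \<le> \<delta>1" "\<delta> \<le> b" "\<delta> \<le> \<epsilon> / 4" using \<delta> by (auto simp: \<delta>0_def)
      show ?thesis
        using \<delta>1(2) ev_p' S_le[OF \<delta>'(2)] ev_n_real_ge[OF filterlim_ident, of "4 / \<epsilon>"]
      proof eventually_elim
        case (elim n)
        have p: "0 \<le> cs n / real n" "cs n / real n \<le> 1" using elim by auto
        have n\<epsilon>: "1 \<le> \<epsilon> / 4 * real n" using elim \<epsilon> by (simp add: field_simps)
        have "PA \<delta> n - PA' \<delta> \<epsilon> n = measure (P n) (A \<delta> n - A' \<delta> \<epsilon> n)"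
          unfolding PA_def PA'_def P_def A_def A'_def
          using A_tilde_event_subset by (intro measure_pmf.finite_measure_Diff[symmetric]) auto
        also have "\<dots> = gex (cs n / real n) (edges {..<n}) (\<lambda>G. of_bool (G \<in> A_event n \<delta> m u \<and> G \<notin> A_tilde_event c n \<delta> \<epsilon> m u))"
          unfolding link[OF elim(2)] A_def A'_def by simp
        also have "\<dots> \<le> g * S \<delta> n"
          unfolding S_def
        proof (rule A_event_diff_le[OF p, where bad = "bad_count c m u \<epsilon> n"])
          fix V assume "V \<in> window \<delta> n m u"
          then have "V \<in> window \<delta>1 n m u" using window_mono[OF \<delta>'(1)] by blast
          then show "gex (cs n / real n) (edges {..<n}) (\<lambda>G. of_bool (\<forall>i\<in>{1..m}. V i \<in> comps {..<n} G) * bad_count c m u \<epsilon> n V G)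
            \<le> g * comps_prob (cs n / real n) {..<n} {1..m} V" using elim(1) by blast
        next
          fix V G
          assume "G \<subseteq> edges {..<n}" "V \<in> window \<delta> n m u" "\<forall>i\<in>{1..m}. V i \<in> comps {..<n} G"
            and bad: "bad_count c m u \<epsilon> n V G < 1"
          then show "G \<in> A_tilde_event c n \<delta> \<epsilon> m u"
            by (intro A_tilde_eventI[OF _ _ _ bad_count_less_1D(1)[OF cs c u bad] bad_count_less_1D(2)[OF cs c u bad] \<delta>'(3) n\<epsilon>])
        qed (rule bad_count_nonneg[OF cs c u])
        also have "\<dots> \<le> g * ((1 / b) ^ m * PA \<delta> n)" using g elim by (intro mult_left_mono) auto
        also have "\<dots> = h * PA \<delta> n" using b by (simp add: g_def power_divide)
        finally show ?case by (simp add: algebra_simps)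
      qed
    qed
    moreover have "\<delta>0 > 0" using \<delta>1 b \<epsilon> by (simp add: \<delta>0_def)
    ultimately show ?thesis by blast
  qed
  have lower': "\<forall>\<^sub>F n in sequentially. exp (real n * (- J - \<eta>)) \<le> PA' \<delta> \<epsilon> n"
    if \<eta>: "\<eta> > 0" and \<delta>: "\<delta> > 0" and \<epsilon>: "\<epsilon> > 0" for \<eta> \<delta> \<epsilon>
  proof -
    \<comment> \<open>Any fixed positive share of the probability of \<open>A\<close> does on the
      exponential scale; one half is taken.\<close>
    obtain \<delta>0 where \<delta>0: "\<delta>0 > 0" "\<And>d. 0 < d \<Longrightarrow> d \<le> \<delta>0 \<Longrightarrow> \<forall>\<^sub>F n in sequentially. (1 - 1 / 2) * PA d n \<le> PA' d \<epsilon> n"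
      using refined[OF \<epsilon>, of "1 / 2"] by auto
    define d where "d = min \<delta> \<delta>0"
    have d: "d > 0" "d \<le> \<delta>" "d \<le> \<delta>0" using \<delta> \<delta>0 by (auto simp: d_def)
    show ?thesis
      using \<delta>0(2)[OF d(1,3)] lower[OF half_gt_zero[OF \<eta>] d(1)] absorb[OF \<eta> half_gt_zero[OF zero_less_one]]
    proof eventually_elim
      case (elim n)
      have "exp (real n * (- J - \<eta>)) \<le> 1 / 2 * exp (real n * (- J - \<eta> / 2))" by (rule elim(3))
      also have "\<dots> \<le> 1 / 2 * PA d n" using elim(2) by (intro mult_left_mono) auto
      also have "\<dots> = (1 - 1 / 2) * PA d n" by simp
      also have "\<dots> \<le> PA' d \<epsilon> n" by (rule elim(1))
      also have "\<dots> \<le> PA' \<delta> \<epsilon> n" by (rule PA'_mono[OF d(2)])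
      finally show ?case .
    qed
  qed
  let ?r = "\<lambda>P n. ereal (1 / real n) * log_prob (P n)"
  have at_right: "\<forall>\<^sub>F \<delta> in at_right 0. 0 < \<delta> \<and> \<delta> \<le> \<delta>0" if "\<delta>0 > 0" for \<delta>0 :: real
    unfolding eventually_at_right_field using that by (intro exI[of _ \<delta>0]) auto
  have A_lim: "\<forall>\<^sub>F \<delta> in at_right 0. ereal (- J - \<eta>) \<le> liminf (?r (PA \<delta>))
      \<and> limsup (?r (PA \<delta>)) \<le> ereal (- J + \<eta>)
      \<and> liminf (?r (PA \<delta>)) \<le> limsup (?r (PA \<delta>))"
    if \<eta>: "\<eta> > 0" for \<eta>
  proof -
    obtain \<delta>0 where \<delta>0: "\<delta>0 > 0" "\<And>\<delta>. \<delta> \<le> \<delta>0 \<Longrightarrow> \<forall>\<^sub>F n in sequentially. PA \<delta> n \<le> exp (real n * (- J + \<eta>))"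
      using upper[OF \<eta>] by blast
    show ?thesis
      using at_right[OF \<delta>0(1)]
    proof eventually_elim
      case (elim \<delta>)
      then show ?case using rate_limits[OF lower[OF \<eta>, of \<delta>] \<delta>0(2)[of \<delta>]] by blast
    qed
  qed
  have A'_lim: "\<forall>\<^sub>F x in at_right 0 \<times>\<^sub>F at_right 0.
      ereal (- J - \<eta>) \<le> liminf (?r (PA' (fst x) (snd x)))
      \<and> limsup (?r (PA' (fst x) (snd x))) \<le> ereal (- J + \<eta>)
      \<and> liminf (?r (PA' (fst x) (snd x))) \<le> limsup (?r (PA' (fst x) (snd x)))"
    if \<eta>: "\<eta> > 0" for \<eta>
  proof -
    obtain \<delta>0 where \<delta>0: "\<delta>0 > 0" "\<And>\<delta>. \<delta> \<le> \<delta>0 \<Longrightarrow> \<forall>\<^sub>F n in sequentially. PA \<delta> n \<le> exp (real n * (- J + \<eta>))"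
      using upper[OF \<eta>] by blast
    show ?thesis
      using eventually_prodI[OF at_right[OF \<delta>0(1)] at_right[OF zero_less_one]]
    proof eventually_elim
      case (elim x)
      have "\<forall>\<^sub>F n in sequentially. PA' (fst x) (snd x) n \<le> exp (real n * (- J + \<eta>))"
        using \<delta>0(2)[of "fst x"] elim
        by (auto elim!: eventually_mono intro: order_trans[OF PA'_le])
      from rate_limits[OF lower'[OF \<eta>, of "fst x" "snd x"] this] elim show ?case by blast
    qed
  qed
  have cond: "((\<lambda>\<delta>. liminf (\<lambda>n. ereal (cond_prob (P n) (\<lambda>G. G \<in> A' \<delta> \<epsilon> n) (\<lambda>G. G \<in> A \<delta> n)))) \<longlongrightarrow> ereal 1) (at_right 0)"
    if \<epsilon>: "\<epsilon> > 0" for \<epsilon>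
  proof (rule tendsto_ereal_interval)
    fix h :: real assume h: "h > 0"
    have cp: "cond_prob (P n) (\<lambda>G. G \<in> A' \<delta> \<epsilon> n) (\<lambda>G. G \<in> A \<delta> n) = PA' \<delta> \<epsilon> n / PA \<delta> n" for \<delta> n
    proof -
      have "{G \<in> space (P n). G \<in> A' \<delta> \<epsilon> n \<and> G \<in> A \<delta> n} = A' \<delta> \<epsilon> n" "{G \<in> space (P n). G \<in> A \<delta> n} = A \<delta> n"
        using A_tilde_event_subset[of c n \<delta> \<epsilon> m u] by (auto simp: P_def A_def A'_def)
      then show ?thesis by (simp add: cond_prob_def PA_def PA'_def)
    qed
    obtain \<delta>0 where \<delta>0: "\<delta>0 > 0" "\<And>\<delta>. 0 < \<delta> \<Longrightarrow> \<delta> \<le> \<delta>0 \<Longrightarrow> \<forall>\<^sub>F n in sequentially. (1 - h) * PA \<delta> n \<le> PA' \<delta> \<epsilon> n"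
      using refined[OF \<epsilon> h] by blast
    show "\<forall>\<^sub>F \<delta> in at_right 0.
        ereal (1 - h) \<le> liminf (\<lambda>n. ereal (cond_prob (P n) (\<lambda>G. G \<in> A' \<delta> \<epsilon> n) (\<lambda>G. G \<in> A \<delta> n))) \<and>
        liminf (\<lambda>n. ereal (cond_prob (P n) (\<lambda>G. G \<in> A' \<delta> \<epsilon> n) (\<lambda>G. G \<in> A \<delta> n))) \<le> ereal (1 + h)"
      using at_right[OF \<delta>0(1)]
    proof eventually_elim
      case (elim \<delta>)
      \<comment> \<open>By \<open>lower\<close> the conditioning event eventually has positive
        probability, so the quotient is a genuine one; its upper bound follows from
        \<open>PA'_le\<close>.\<close>
      have ev: "\<forall>\<^sub>F n in sequentially. ereal (1 - h) \<le> ereal (PA' \<delta> \<epsilon> n / PA \<delta> n) \<and> ereal (PA' \<delta> \<epsilon> n / PA \<delta> n) \<le> ereal (1 + h)"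
        using \<delta>0(2)[OF conjunct1[OF elim] conjunct2[OF elim]] lower[OF zero_less_one conjunct1[OF elim]]
      proof eventually_elim
        case (elim n)
        then have pos: "PA \<delta> n > 0" using exp_gt_zero[of "real n * (- J - 1)"] by linarith
        have "PA' \<delta> \<epsilon> n \<le> (1 + h) * PA \<delta> n"
          using PA'_le[of \<delta> \<epsilon> n] pos h by (simp add: distrib_right add_increasing2)
        then show ?case using elim pos by (simp add: pos_le_divide_eq pos_divide_le_eq)
      qed
      have "ereal (1 - h) \<le> liminf (\<lambda>n. ereal (PA' \<delta> \<epsilon> n / PA \<delta> n))"
        by (rule Liminf_bounded) (use ev in \<open>auto elim: eventually_mono\<close>)
      moreover have "limsup (\<lambda>n. ereal (PA' \<delta> \<epsilon> n / PA \<delta> n)) \<le> ereal (1 + h)"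
        by (rule Limsup_bounded) (use ev in \<open>auto elim: eventually_mono\<close>)
      moreover have "liminf (\<lambda>n. ereal (PA' \<delta> \<epsilon> n / PA \<delta> n)) \<le> limsup (\<lambda>n. ereal (PA' \<delta> \<epsilon> n / PA \<delta> n))"
        by (rule Liminf_le_Limsup) simp
      ultimately show ?case unfolding cp by (meson order_trans)
    qed
  qed
  have "((\<lambda>\<delta>. limsup (?r (PA \<delta>))) \<longlongrightarrow> ereal (- J)) (at_right 0)"
    by (rule tendsto_ereal_interval, rule eventually_mono[OF A_lim]) (auto intro: order_trans)
  moreover have "((\<lambda>\<delta>. liminf (?r (PA \<delta>))) \<longlongrightarrow> ereal (- J)) (at_right 0)"
    by (rule tendsto_ereal_interval, rule eventually_mono[OF A_lim]) (auto intro: order_trans)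
  moreover have "((\<lambda>(\<delta>, \<epsilon>). limsup (?r (PA' \<delta> \<epsilon>))) \<longlongrightarrow> ereal (- J)) (at_right 0 \<times>\<^sub>F at_right 0)"
    by (rule tendsto_ereal_interval, rule eventually_mono[OF A'_lim]) (auto intro: order_trans)
  moreover have "((\<lambda>(\<delta>, \<epsilon>). liminf (?r (PA' \<delta> \<epsilon>))) \<longlongrightarrow> ereal (- J)) (at_right 0 \<times>\<^sub>F at_right 0)"
    by (rule tendsto_ereal_interval, rule eventually_mono[OF A'_lim]) (auto intro: order_trans)
  ultimately show ?thesis
    using cond unfolding PA_def PA'_def one_ereal_def by blast
qed

end
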